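(* Let $D$ be an almost Dedekind domain with SP-rank $\alpha$. Then there is a group isomorphism $$\mathrm{Inv}(D)\simeq\bigoplus_{i<\alpha}\mathcal{C}_c(\mathrm{Crit}_i(D)\setminus\mathrm{Crit}_{i+1}(D),\mathbb{Z}),$$ where $i$ ranges over the ordinals smaller than $\alpha$; in particular, $\mathrm{Inv}(D)$ is a free abelian group.
   Context: An almost Dedekind domain is an integral domain $D$ such that $D_M$ is a discrete valuation ring for every maximal ideal $M$ of $D$ (in particular $D$ is not a field). Let $K$ be the quotient field of $D$. $\mathrm{Inv}(D)$ is the group of invertible fractional ideals of $D$ under multiplication of ideals. $\mathcal{M}$ denotes $\mathrm{Max}(D)$ endowed with the constructible topology, i.e. the topology generated by the sets $\{M\in\mathrm{Max}(D)\mid I\subseteq M\}$ and $\{M\in\mathrm{Max}(D)\mid I\nsubseteq M\}$ as $I$ ranges among the finitely generated ideals of $D$. For a topological space $X$, $\mathcal{C}_c(X,\mathbb{Z})$ is the group (under pointwise addition) of continuous functions $X\to\mathbb{Z}$ of compact support, where $\mathbb{Z}$ is discrete. Subsets of $\mathcal{M}$ carry the subspace topology. A maximal ideal $M$ of an almost Dedekind domain $T$ is critical if $M$ does not contain any nonzero finitely generated radical ideal of $T$; $\mathrm{Crit}(T)$ is the set of critical maximal ideals of $T$. Define by transfinite recursion sets $\mathrm{Crit}_\alpha(D)\subseteq\mathcal{M}$ and overrings $T_\alpha$ of $D$ (rings between $D$ and $K$): - $\mathrm{Crit}_0(D):=\mathcal{M}$, $T_0:=D$; - if $\alpha=\gamma+1$,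 $\mathrm{Crit}_\alpha(D):=\{P\in\mathcal{M}\mid PT_\gamma\in\mathrm{Crit}(T_\gamma)\}$; - if $\alpha$ is a limit ordinal, $\mathrm{Crit}_\alpha(D):=\bigcap_{\gamma<\alpha}\mathrm{Crit}_\gamma(D)$; - $T_\alpha:=\bigcap\{D_P\mid P\in\mathrm{Crit}_\alpha(D)\}$. The maximal ideals of $T_\alpha$ are exactly the extensions $PT_\alpha$ of the $P\in\mathrm{Crit}_\alpha(D)$. Conventions: an empty intersection of overrings is $K$, and $\mathrm{Crit}(K)=\emptyset$. The chain $\{\mathrm{Crit}_\alpha(D)\}_\alpha$ is descending and stabilizes; the SP-rank of $D$ is the minimal ordinal $\alpha$ such that $\mathrm{Crit}_\alpha(D)=\mathrm{Crit}_{\alpha+1}(D)$. *)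

theory Defs
  imports
    "HOL-Algebra.Subrings"
    "HOL-Algebra.Ring_Divisibility"
    "HOL-Algebra.Ideal_Product"
    "HOL-Algebra.Free_Abelian_Groups"
    "HOL-Analysis.Abstract_Topology"
begin

section \<open>Subrings of a field, localizations, almost Dedekind domains\<close>

text \<open>Every ring that occurs is a subring of one ambient field \<open>K\<close>. A subring with underlying
  set \<open>T\<close> is the ring record \<open>K\<lparr>carrier := T\<rparr>\<close>, and its ideals are the HOL-Algebra ideals of
  that record.\<close>

definition is_quotient_field :: "('a, 'b) ring_scheme \<Rightarrow> 'a set \<Rightarrow> bool" where
  "is_quotient_field K D \<longleftrightarrow>
     field K \<and> subring D K \<and>
     carrier K = {a \<otimes>\<^bsub>K\<^esub> inv\<^bsub>K\<^esub> b | a b. a \<in> D \<and> b \<in> D - {\<zero>\<^bsub>K\<^esub>}}"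

definition Max_ideals :: "('a, 'b) ring_scheme \<Rightarrow> 'a set \<Rightarrow> 'a set set" where
  "Max_ideals K T = {M. maximalideal M (K\<lparr>carrier := T\<rparr>)}"

definition localization_at :: "('a, 'b) ring_scheme \<Rightarrow> 'a set \<Rightarrow> 'a set \<Rightarrow> 'a set" where
  "localization_at K T P = {a \<otimes>\<^bsub>K\<^esub> inv\<^bsub>K\<^esub> s | a s. a \<in> T \<and> s \<in> T - P}"

definition discrete_valuation_ring :: "('a, 'b) ring_scheme \<Rightarrow> bool" where
  "discrete_valuation_ring R \<longleftrightarrow>
     principal_domain R \<and> \<not> field R \<and> (\<exists>!M. maximalideal M R)"

text \<open>The zero ideal is the only maximal ideal of a field \<open>D\<close>, and the localization there is
  \<open>D\<close> itself, which is not a discrete valuation ring; so fields are excluded.\<close>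

definition almost_Dedekind :: "('a, 'b) ring_scheme \<Rightarrow> 'a set \<Rightarrow> bool" where
  "almost_Dedekind K D \<longleftrightarrow>
     is_quotient_field K D \<and>
     (\<forall>M \<in> Max_ideals K D. discrete_valuation_ring (K\<lparr>carrier := localization_at K D M\<rparr>))"


section \<open>The group of invertible fractional ideals\<close>

definition fractional_ideal :: "('a, 'b) ring_scheme \<Rightarrow> 'a set \<Rightarrow> 'a set \<Rightarrow> bool" where
  "fractional_ideal K D I \<longleftrightarrow>
     additive_subgroup I K \<and> I \<noteq> {\<zero>\<^bsub>K\<^esub>} \<and>
     (\<forall>d \<in> D. \<forall>x \<in> I. d \<otimes>\<^bsub>K\<^esub> x \<in> I) \<and>
     (\<exists>d \<in> D - {\<zero>\<^bsub>K\<^esub>}. \<forall>x \<in> I. d \<otimes>\<^bsub>K\<^esub> x \<in> D)"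

text \<open>\<^const>\<open>ideal_prod\<close> \<open>K I J\<close> consists of the finite sums of products \<open>x \<otimes> y\<close> with \<open>x \<in> I\<close>,
  \<open>y \<in> J\<close>; it only uses the operations of \<open>K\<close>, so it is also the product of fractional ideals.\<close>

definition Inv :: "('a, 'b) ring_scheme \<Rightarrow> 'a set \<Rightarrow> 'a set monoid" where
  "Inv K D =
     \<lparr>carrier = {I. fractional_ideal K D I \<and> (\<exists>J. fractional_ideal K D J \<and> ideal_prod K I J = D)},
      monoid.mult = ideal_prod K,
      one = D\<rparr>"


section \<open>The constructible topology on the maximal spectrum\<close>

definition fg_ideal :: "('a, 'b) ring_scheme \<Rightarrow> 'a set \<Rightarrow> bool" where
  "fg_ideal R I \<longleftrightarrow> (\<exists>A. finite A \<and> A \<subseteq> carrier R \<and> I = Idl\<^bsub>R\<^esub> A)"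

definition constructible_Max :: "('a, 'b) ring_scheme \<Rightarrow> 'a set \<Rightarrow> 'a set topology" where
  "constructible_Max K D = topology_generated_by
     ({{M \<in> Max_ideals K D. I \<subseteq> M} | I. fg_ideal (K\<lparr>carrier := D\<rparr>) I} \<union>
      {{M \<in> Max_ideals K D. \<not> I \<subseteq> M} | I. fg_ideal (K\<lparr>carrier := D\<rparr>) I})"

text \<open>Functions on the space \<open>X\<close> are represented by total functions extended by zero off
  \<^term>\<open>topspace X\<close>, which makes the representation unique.\<close>

definition Cc_int :: "'x topology \<Rightarrow> ('x \<Rightarrow> int) monoid" where
  "Cc_int X =
     \<lparr>carrier = {f. continuous_map X (discrete_topology UNIV) f \<and>
                    (\<forall>x. x \<notin> topspace X \<longrightarrow> f x = 0) \<and>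
                    compactin X (X closure_of {x \<in> topspace X. f x \<noteq> 0})},
      monoid.mult = (\<lambda>f g x. f x + g x),
      one = (\<lambda>x. 0)\<rparr>"

lemma comm_group_Cc_int: "comm_group (Cc_int X)"
proof (rule comm_groupI)
  have cont: "continuous_map X (discrete_topology UNIV) (h :: 'a \<Rightarrow> int) \<longleftrightarrow>
      (\<forall>n. openin X {x \<in> topspace X. h x = n})" for h
  proof
    assume "continuous_map X (discrete_topology UNIV) h"
    then have "openin X {x \<in> topspace X. h x \<in> {n}}" for n
      by (rule openin_continuous_map_preimage) simp
    then show "\<forall>n. openin X {x \<in> topspace X. h x = n}" by simp
  next
    assume *: "\<forall>n. openin X {x \<in> topspace X. h x = n}"
    have "openin X {x \<in> topspace X. h x \<in> V}" for V
    proof -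
      have "{x \<in> topspace X. h x \<in> V} = (\<Union>n\<in>V. {x \<in> topspace X. h x = n})" by auto
      with * show ?thesis by auto
    qed
    then show "continuous_map X (discrete_topology UNIV) h"
      by (simp add: continuous_map_def)
  qed
  have cont_add: "continuous_map X (discrete_topology UNIV) (\<lambda>x. f x + g x)"
    if "continuous_map X (discrete_topology UNIV) f" "continuous_map X (discrete_topology UNIV) g"
    for f g :: "'a \<Rightarrow> int"
    unfolding cont
  proof
    fix n
    have "{x \<in> topspace X. f x + g x = n} =
        (\<Union>m. {x \<in> topspace X. f x = m} \<inter> {x \<in> topspace X. g x = n - m})" by auto
    also have "openin X \<dots>"
      using that unfolding cont by (blast intro: openin_Int)
    finally show "openin X {x \<in> topspace X. f x + g x = n}" .
  qed
  have cont_uminus: "continuous_map X (discrete_topology UNIV) (\<lambda>x. - f x)"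
    if "continuous_map X (discrete_topology UNIV) f" for f :: "'a \<Rightarrow> int"
    unfolding cont
  proof
    fix n
    have "{x \<in> topspace X. - f x = n} = {x \<in> topspace X. f x = - n}" by auto
    then show "openin X {x \<in> topspace X. - f x = n}"
      using that unfolding cont by simp
  qed
  have comp_add: "compactin X (X closure_of {x \<in> topspace X. f x + g x \<noteq> 0})"
    if "compactin X (X closure_of {x \<in> topspace X. f x \<noteq> 0})"
       "compactin X (X closure_of {x \<in> topspace X. g x \<noteq> 0})"
    for f g :: "'a \<Rightarrow> int"
  proof (rule closed_compactin)
    show "compactin X (X closure_of {x \<in> topspace X. f x \<noteq> 0} \<union> X closure_of {x \<in> topspace X. g x \<noteq> 0})"
      using that by (rule compactin_Un)
    show "X closure_of {x \<in> topspace X. f x + g x \<noteq> 0} \<subseteq>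
        X closure_of {x \<in> topspace X. f x \<noteq> 0} \<union> X closure_of {x \<in> topspace X. g x \<noteq> 0}"
      unfolding closure_of_Un[symmetric] by (rule closure_of_mono) auto
  qed simp
  show "x \<otimes>\<^bsub>Cc_int X\<^esub> y \<in> carrier (Cc_int X)"
    if "x \<in> carrier (Cc_int X)" "y \<in> carrier (Cc_int X)" for x y
    using that by (auto simp: Cc_int_def cont_add comp_add)
  show "\<exists>y\<in>carrier (Cc_int X). y \<otimes>\<^bsub>Cc_int X\<^esub> x = \<one>\<^bsub>Cc_int X\<^esub>"
    if "x \<in> carrier (Cc_int X)" for x
    using that by (intro bexI[of _ "\<lambda>t. - x t"]) (auto simp: Cc_int_def cont_uminus)
qed (auto simp: Cc_int_def add_ac)


section \<open>Critical maximal ideals and the SP-rank\<close>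

definition radical_ideal :: "('a, 'b) ring_scheme \<Rightarrow> 'a set \<Rightarrow> bool" where
  "radical_ideal R I \<longleftrightarrow>
     ideal I R \<and> I = {x \<in> carrier R. \<exists>n::nat. n > 0 \<and> x [^]\<^bsub>R\<^esub> n \<in> I}"

text \<open>The case distinction is the convention that the quotient field \<open>K\<close>, whose maximal ideal is
  zero, has no critical maximal ideals.\<close>

definition Crit :: "('a, 'b) ring_scheme \<Rightarrow> 'a set \<Rightarrow> 'a set set" where
  "Crit K T =
     (if T = carrier K then {}
      else {M \<in> Max_ideals K T.
              \<not> (\<exists>I. fg_ideal (K\<lparr>carrier := T\<rparr>) I \<and> radical_ideal (K\<lparr>carrier := T\<rparr>) I \<and>
                     I \<noteq> {\<zero>\<^bsub>K\<^esub>} \<and> I \<subseteq> M)})"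

text \<open>The intersection with \<^term>\<open>carrier K\<close> only matters for \<open>S = {}\<close>.\<close>

definition overring_of :: "('a, 'b) ring_scheme \<Rightarrow> 'a set \<Rightarrow> 'a set set \<Rightarrow> 'a set" where
  "overring_of K D S = carrier K \<inter> (\<Inter>P \<in> S. localization_at K D P)"

lemma (in cring) proper_ideal_subset_maximalideal:
  assumes "ideal I R" "I \<noteq> carrier R"
  obtains M where "maximalideal M R" "I \<subseteq> M"
proof -
  define A where "A = {J. ideal J R \<and> I \<subseteq> J \<and> \<one> \<notin> J}"
  have "I \<in> A"
    using assms ideal.one_imp_carrier by (auto simp: A_def)
  moreover have "\<Union>C \<in> A" if "C \<noteq> {}" "subset.chain A C" for C
  proof -
    have "subset.chain {J. ideal J R} C"
      using that(2) by (auto simp: subset_chain_def A_def)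
    from chain_Union_is_ideal[OF this] show ?thesis
      using that by (auto simp: subset_chain_def A_def)
  qed
  ultimately obtain M where M: "M \<in> A" and max: "\<And>J. J \<in> A \<Longrightarrow> M \<subseteq> J \<Longrightarrow> J = M"
    using subset_Zorn_nonempty[of A] by blast
  have "maximalideal M R"
  proof (rule maximalidealI)
    show "ideal M R" "carrier R \<noteq> M"
      using M by (auto simp: A_def)
    fix J assume J: "ideal J R" "M \<subseteq> J"
    show "J = M \<or> J = carrier R"
      using max[of J] J M ideal.one_imp_carrier[OF J(1)] by (auto simp: A_def)
  qed
  with M that show ?thesis by (auto simp: A_def)
qed

lemma overring_of_Max_ideals:
  assumes "is_quotient_field K D"
  shows "overring_of K D (Max_ideals K D) = D"
proof -
  interpret field K using assms by (simp add: is_quotient_field_def)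
  let ?D = "K\<lparr>carrier := D\<rparr>"
  have D: "subring D K" using assms by (simp add: is_quotient_field_def)
  note DE = subringE[OF D]
  have DK: "d \<in> carrier K" if "d \<in> D" for d using DE(1) that by blast
  interpret D: cring ?D
    using subcring_iff[OF DE(1)] subcringI'[OF D] by simp
  have "x \<in> D" if x: "x \<in> carrier K" "\<And>M. M \<in> Max_ideals K D \<Longrightarrow> x \<in> localization_at K D M" for x
  proof (rule ccontr)
    assume "x \<notin> D"
    define I where "I = {d \<in> D. d \<otimes>\<^bsub>K\<^esub> x \<in> D}"
    have "ideal I ?D"
    proof (rule idealI)
      show "subgroup I (add_monoid ?D)"
      proof (rule group.subgroupI)
        show "Group.group (add_monoid ?D)" by (rule D.add.is_group)
        show "I \<subseteq> carrier (add_monoid ?D)" by (auto simp: I_def)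
        show "I \<noteq> {}" using DE(2) x(1) by (auto simp: I_def)
        fix a b assume ab: "a \<in> I" "b \<in> I"
        show "a \<otimes>\<^bsub>add_monoid ?D\<^esub> b \<in> I"
          using ab x(1) DE(7) by (auto simp: I_def l_distr DK)
        have "\<ominus>\<^bsub>?D\<^esub> a = \<ominus>\<^bsub>K\<^esub> a"
          by (rule D.minus_equality) (use ab DE in \<open>auto simp: I_def DK l_neg\<close>)
        then have "inv\<^bsub>add_monoid ?D\<^esub> a = \<ominus>\<^bsub>K\<^esub> a"
          by (simp add: a_inv_def)
        then show "inv\<^bsub>add_monoid ?D\<^esub> a \<in> I"
          using ab x(1) DE(5) by (auto simp: I_def l_minus DK)
      qed
      fix a d assume ad: "a \<in> I" "d \<in> carrier ?D"
      then show "d \<otimes>\<^bsub>?D\<^esub> a \<in> I"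
        using x(1) DE(6) by (auto simp: I_def m_assoc DK)
      with ad show "a \<otimes>\<^bsub>?D\<^esub> d \<in> I"
        by (auto simp: I_def m_comm DK)
    qed (rule D.ring_axioms)
    moreover have "\<one>\<^bsub>K\<^esub> \<notin> I"
      using x(1) \<open>x \<notin> D\<close> by (simp add: I_def)
    then have "I \<noteq> carrier ?D"
      using DE(3) by auto
    ultimately obtain M where M: "maximalideal M ?D" "I \<subseteq> M"
      by (rule D.proper_ideal_subset_maximalideal)
    then obtain a s where as: "x = a \<otimes>\<^bsub>K\<^esub> inv\<^bsub>K\<^esub> s" "a \<in> D" "s \<in> D" "s \<notin> M"
      using x(2)[of M] by (auto simp: Max_ideals_def localization_at_def)
    interpret M: maximalideal M ?D by (rule M)
    have "s \<noteq> \<zero>\<^bsub>K\<^esub>" using as(4) M.zero_closed by auto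
    then have "s \<otimes>\<^bsub>K\<^esub> x = a"
      using as by (simp add: DK m_lcomm field_Units)
    then show False using as M(2) by (auto simp: I_def)
  qed
  moreover have "d \<in> localization_at K D M" if "d \<in> D" "M \<in> Max_ideals K D" for d M
  proof -
    interpret M: maximalideal M ?D using that by (simp add: Max_ideals_def)
    have "\<one>\<^bsub>K\<^esub> \<notin> M" using M.one_imp_carrier M.I_notcarr by auto
    then show ?thesis
      unfolding localization_at_def using that DE(3)
      by (intro CollectI exI[of _ d] exI[of _ "\<one>\<^bsub>K\<^esub>"]) (simp add: DK)
  qed
  ultimately show ?thesis using DK by (auto simp: overring_of_def)
qed

text \<open>The passage from \<open>S = Crit\<^sub>\<gamma>(D)\<close> to \<open>Crit\<^sub>\<gamma>\<^sub>+\<^sub>1(D)\<close>. With \<open>T = overring_of K D S\<close> the ring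
  \<open>T\<^sub>\<gamma>\<close>, the ideal \<open>P T\<^sub>\<gamma>\<close> is the ideal of \<open>T\<close> generated by \<open>P\<close>.\<close>

definition Crit_step :: "('a, 'b) ring_scheme \<Rightarrow> 'a set \<Rightarrow> 'a set set \<Rightarrow> 'a set set" where
  "Crit_step K D S =
     {P \<in> Max_ideals K D.
        Idl\<^bsub>K\<lparr>carrier := overring_of K D S\<rparr>\<^esub> P \<in> Crit K (overring_of K D S)}"

text \<open>Ordinals are the elements of an arbitrary well-ordered type \<open>'o\<close>, the element \<open>\<alpha>\<close> standing
  for the order type of \<^term>\<open>{..<\<alpha>}\<close>. The chain below descends strictly until it stabilizes,
  so the SP-rank is attained in every well-ordered type that does not inject into \<open>'a set\<close>.\<close>

definition is_succ_of :: "'o::wellorder \<Rightarrow> 'o \<Rightarrow> bool" where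
  "is_succ_of \<alpha> \<gamma> \<longleftrightarrow> \<gamma> < \<alpha> \<and> (\<forall>\<beta>. \<gamma> < \<beta> \<longrightarrow> \<alpha> \<le> \<beta>)"

lemma is_succ_of_unique: "is_succ_of \<alpha> \<gamma> \<Longrightarrow> is_succ_of \<alpha> \<delta> \<Longrightarrow> \<gamma> = \<delta>"
  by (meson is_succ_of_def leD linorder_neqE)

lemma the_pred_less: "\<exists>\<gamma>. is_succ_of \<alpha> \<gamma> \<Longrightarrow> (THE \<gamma>. is_succ_of \<alpha> \<gamma>) < \<alpha>"
  by (metis is_succ_of_def is_succ_of_unique theI)

text \<open>The ring \<open>T\<^sub>\<alpha>\<close> is \<^term>\<open>overring_of K D (Crit_chain K D \<alpha>)\<close>. For the least ordinal this is \<open>D\<close>,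
  by \<open>overring_of_Max_ideals\<close>.\<close>

function Crit_chain :: "('a, 'b) ring_scheme \<Rightarrow> 'a set \<Rightarrow> 'o::wellorder \<Rightarrow> 'a set set" where
  "Crit_chain K D \<alpha> =
     (if \<forall>\<beta>. \<alpha> \<le> \<beta> then Max_ideals K D
      else if \<exists>\<gamma>. is_succ_of \<alpha> \<gamma> then Crit_step K D (Crit_chain K D (THE \<gamma>. is_succ_of \<alpha> \<gamma>))
      else (\<Inter>\<gamma> \<in> {..<\<alpha>}. Crit_chain K D \<gamma>))"
  by pat_completeness auto
termination
  by (relation "inv_image {(x, y). x < y} (\<lambda>(K, D, \<alpha>). \<alpha>)")
     (auto simp: the_pred_less intro: wf)

declare Crit_chain.simps [simp del]

lemma Crit_chain_zero: "\<forall>\<beta>. \<alpha> \<le> \<beta> \<Longrightarrow> Crit_chain K D \<alpha> = Max_ideals K D"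
  by (subst Crit_chain.simps) simp

lemma Crit_chain_succ:
  assumes "is_succ_of \<alpha> \<gamma>"
  shows "Crit_chain K D \<alpha> = Crit_step K D (Crit_chain K D \<gamma>)"
proof -
  have "(THE \<gamma>. is_succ_of \<alpha> \<gamma>) = \<gamma>"
    using assms is_succ_of_unique by blast
  moreover have "\<not> (\<forall>\<beta>. \<alpha> \<le> \<beta>)"
    using assms by (auto simp: is_succ_of_def not_le)
  ultimately show ?thesis
    using assms by (subst Crit_chain.simps) auto
qed

lemma Crit_chain_limit:
  assumes "\<not> (\<forall>\<beta>. \<alpha> \<le> \<beta>)" and "\<not> (\<exists>\<gamma>. is_succ_of \<alpha> \<gamma>)"
  shows "Crit_chain K D \<alpha> = (\<Inter>\<gamma> \<in> {..<\<alpha>}. Crit_chain K D \<gamma>)"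
  by (subst Crit_chain.simps) (simp only: assms if_False)

text \<open>\<open>Crit\<^sub>\<alpha>\<^sub>+\<^sub>1(D)\<close>. It is given by the successor clause of the recursion and not as a value of
  \<^const>\<open>Crit_chain\<close>, because \<open>\<alpha>\<close> may be the greatest element of \<open>'o\<close>.\<close>

definition Crit_next :: "('a, 'b) ring_scheme \<Rightarrow> 'a set \<Rightarrow> 'o::wellorder \<Rightarrow> 'a set set" where
  "Crit_next K D \<alpha> = Crit_step K D (Crit_chain K D \<alpha>)"

definition is_SP_rank :: "('a, 'b) ring_scheme \<Rightarrow> 'a set \<Rightarrow> 'o::wellorder \<Rightarrow> bool" where
  "is_SP_rank K D \<alpha> \<longleftrightarrow>
     Crit_chain K D \<alpha> = Crit_next K D \<alpha> \<and>
     (\<forall>\<beta><\<alpha>. Crit_chain K D \<beta> \<noteq> Crit_next K D \<beta>)"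


section \<open>Free abelian groups\<close>

text \<open>A basis can be taken inside \<open>G\<close>, so it is no restriction that the index set has the element
  type of \<open>G\<close>.\<close>

definition is_free_abelian :: "('g, 'm) monoid_scheme \<Rightarrow> bool" where
  "is_free_abelian G \<longleftrightarrow> (\<exists>B :: 'g set. G \<cong> free_Abelian_group B)"

end

theory Submission
  imports Defs "HOL-Analysis.Urysohn" "HOL-Library.Function_Algebras"
begin

text \<open>
  Every nonempty finite set \<open>A\<close> of nonzero elements of \<open>K\<close> gives a function
  \<open>\<nu>\<^sub>A(M) = min {v\<^sub>M(a) | a \<in> A}\<close> on \<open>Max(D)\<close>, and \<open>Inv(D)\<close> is isomorphic to the group \<open>G\<close> of
  these functions. \<open>G\<close> is closed under minima and its members have compact open supports, which
  generate the constructible topology. For a closed set \<open>S\<close> of maximal ideals, a point \<open>P \<in> S\<close>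
  survives the critical step iff no \<open>g \<in> G\<close> has \<open>g(P) = 1\<close> and takes only the values 0 and 1 on \<open>S\<close>.
  If all points of \<open>S \<noteq> {}\<close> survived, one could find in \<open>G\<close> functions \<open>h\<^sub>n \<ge> 2 h\<^sub>n\<^sub>+\<^sub>1 \<ge> 0\<close> whose supports
  meet \<open>S\<close>, and \<open>h\<^sub>0\<close> would be infinite at a common point of these supports; hence \<open>Crit\<^sub>\<alpha>(D) = {}\<close>.

  The subgroups \<open>G\<^sub>i\<close> of functions vanishing on \<open>Crit\<^sub>i(D)\<close> form a continuous chain from \<open>0\<close> to \<open>G\<close>, and
  restriction identifies \<open>G\<^sub>i\<^sub>+\<^sub>1 / G\<^sub>i\<close> with \<open>C\<^sub>c(Crit\<^sub>i(D) - Crit\<^sub>i\<^sub>+\<^sub>1(D), \<int>)\<close>. These quotients are free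
  by a theorem of Noebeling, so the chain splits.
\<close>

section \<open>Bases of groups of integer-valued functions\<close>

text \<open>The obstacle is that members of \<open>G\<close> are not known to be continuous on
  \<open>Max(D)\<close>: only their supports are clopen. At a point that leaves \<open>S\<close> in
  the critical step, a function \<open>e\<close> with value 1 there and only the values 0 and 1 on
  \<open>S\<close> repairs this: where \<open>e\<close> is nonzero and \<open>g - n e\<close> is
  zero, which is an open condition, \<open>g\<close> equals \<open>n\<close> on \<open>S\<close>. So
  continuity holds on each layer, and the layers rather than \<open>Max(D)\<close> carry the
  summands. Two ring-theoretic facts are behind \<open>G\<close>. Nonzero finitely generated ideals
  are invertible, which makes \<open>G\<close> a group; proper ideals lie in maximal ones, which
  makes supports compact. Compactness then excludes new functions at limit ordinals, since the
  complements of a descending chain of closed sets cover a support only if one of them contains it.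
  There is no canonical complement of \<open>G\<^sub>i\<close> in
  \<open>G\<^sub>i\<^sub>+\<^sub>1\<close>; freeness of the quotient supplies an additive section,
  and the sections are added up. Noebeling's argument requires a compact space, so each layer is
  compactified by one point, at the price of working modulo constants.\<close>

definition zscale :: "int \<Rightarrow> ('x \<Rightarrow> int) \<Rightarrow> 'x \<Rightarrow> int" where
  "zscale n f = (\<lambda>x. n * f x)"

interpretation zf: Modules.module "zscale :: int \<Rightarrow> ('x \<Rightarrow> int) \<Rightarrow> 'x \<Rightarrow> int"
  by unfold_locales (auto simp: zscale_def fun_eq_iff algebra_simps)

lemma zscale_apply [simp]: "zscale n f x = n * f x"
  by (simp add: zscale_def)

lemma sum_fun_apply: "(\<Sum>i\<in>A. f i) x = (\<Sum>i\<in>A. (f i :: 'x \<Rightarrow> int) x)"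
  by (induction A rule: infinite_finite_induct) auto

lemma finite_total_has_greatest:
  assumes "finite F" "F \<noteq> {}" and trans: "transp lt" and total: "\<And>i j. i \<noteq> j \<Longrightarrow> lt i j \<or> lt j i"
  shows "\<exists>m\<in>F. \<forall>i\<in>F. i = m \<or> lt i m"
  using assms(1,2)
proof (induction rule: finite_ne_induct)
  case (insert x F)
  then obtain m where "m \<in> F" "\<forall>i\<in>F. i = m \<or> lt i m" by blast
  then show ?case using total[of x m] transpD[OF trans, of _ m x] by (cases "x = m") auto
qed auto

text \<open>Linear independence in the quotient by \<open>C\<close>, without forming the quotient.
  The sums run over distinct members of \<open>B\<close>, so the coefficients 1 and -1 also exclude
  two members that are congruent modulo \<open>C\<close>.\<close>

definition indep_mod :: "('x \<Rightarrow> int) set \<Rightarrow> ('x \<Rightarrow> int) set \<Rightarrow> bool" where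
  "indep_mod C B \<longleftrightarrow>
     (\<forall>T c. finite T \<longrightarrow> T \<subseteq> B \<longrightarrow> (\<Sum>b\<in>T. zscale (c b) b) \<in> C \<longrightarrow> (\<forall>b\<in>T. c b = 0))"

lemma indep_modD:
  assumes "indep_mod C B" "finite T" "T \<subseteq> B" "(\<Sum>b\<in>T. zscale (c b) b) \<in> C" "b \<in> T"
  shows "c b = 0"
  using assms unfolding indep_mod_def by blast

lemma indep_mod_0: "indep_mod {0} B \<longleftrightarrow> zf.independent B"
  unfolding indep_mod_def zf.independent_explicit_module by auto

text \<open>Hypothesis \<open>lim\<close> is the continuity of the filtration: an element of
  \<open>A i\<close> outside \<open>C\<close> already occurs at an earlier stage. Independence
  follows by reducing a relation modulo \<open>A m\<close> for the greatest index \<open>m\<close>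
  that occurs in it; spanning is well-founded induction. The relation \<open>lt\<close> is a
  parameter because the lemma serves both a well-ordering of sets and the order of the
  ordinals.\<close>

lemma filtration_basis:
  fixes lt :: "'i \<Rightarrow> 'i \<Rightarrow> bool" and A A' B :: "'i \<Rightarrow> ('x \<Rightarrow> int) set"
  assumes wf: "wfp lt" and trans: "transp lt"
    and total: "\<And>i j. i \<noteq> j \<Longrightarrow> lt i j \<or> lt j i"
    and sub: "\<And>i. i \<in> I \<Longrightarrow> zf.subspace (A i)"
    and BA: "\<And>i. i \<in> I \<Longrightarrow> B i \<subseteq> A' i"
    and ind: "\<And>i. i \<in> I \<Longrightarrow> indep_mod (A i) (B i)"
    and spn: "\<And>i f. i \<in> I \<Longrightarrow> f \<in> A' i \<Longrightarrow> \<exists>g \<in> zf.span (B i). f - g \<in> A i"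
    and mono: "\<And>i j. i \<in> I \<Longrightarrow> j \<in> I \<Longrightarrow> lt i j \<Longrightarrow> A' i \<subseteq> A j"
    and lim: "\<And>i f. i \<in> I \<Longrightarrow> f \<in> A i \<Longrightarrow> f \<in> C \<or> (\<exists>j\<in>I. lt j i \<and> f \<in> A' j)"
    and CA: "\<And>i. i \<in> I \<Longrightarrow> C \<subseteq> A i"
  shows "indep_mod C (\<Union>i\<in>I. B i)" and "(\<Union>i\<in>I. A' i) \<subseteq> zf.span ((\<Union>i\<in>I. B i) \<union> C)"
proof -
  show "indep_mod C (\<Union>i\<in>I. B i)"
    unfolding indep_mod_def
  proof (intro allI impI)
    fix T c assume T: "finite T" "T \<subseteq> (\<Union>i\<in>I. B i)" and c: "(\<Sum>b\<in>T. zscale (c b) b) \<in> C"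
    \<comment> \<open>Only terms with nonzero coefficient are kept, so that the vanishing of a
      coefficient at the greatest index is a contradiction.\<close>
    define T' where "T' = {b\<in>T. c b \<noteq> 0}"
    obtain ix where ix: "\<And>b. b \<in> T \<Longrightarrow> ix b \<in> I \<and> b \<in> B (ix b)"
      using T(2) by (metis UN_iff subset_iff)
    have eq: "(\<Sum>b\<in>T. zscale (c b) b) = (\<Sum>b\<in>T'. zscale (c b) b)"
      by (rule sum.mono_neutral_right) (auto simp: T'_def T)
    have "T' = {}"
    proof (rule ccontr)
      assume "T' \<noteq> {}"
      have "finite (ix ` T')" "ix ` T' \<noteq> {}"
        using T \<open>T' \<noteq> {}\<close> by (auto simp: T'_def)
      from finite_total_has_greatest[OF this trans total]
      obtain m where m: "m \<in> ix ` T'" "\<And>i. i \<in> ix ` T' \<Longrightarrow> i = m \<or> lt i m" by blast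
      then have mI: "m \<in> I" using ix by (auto simp: T'_def)
      let ?R = "{b\<in>T'. ix b \<noteq> m}" and ?M = "{b\<in>T'. ix b = m}"
      have fin: "finite T'" using T by (auto simp: T'_def)
      have split: "(\<Sum>b\<in>T'. zscale (c b) b) = (\<Sum>b\<in>?M. zscale (c b) b) + (\<Sum>b\<in>?R. zscale (c b) b)"
        using fin by (subst sum.union_disjoint[symmetric]) (auto intro!: sum.cong)
      have "b \<in> A m" if "b \<in> ?R" for b
        using that m(2)[of "ix b"] mono[of "ix b" m] BA[of "ix b"] ix[of b] mI by (auto simp: T'_def)
      then have "(\<Sum>b\<in>?R. zscale (c b) b) \<in> A m"
        by (intro zf.subspace_sum[OF sub[OF mI]] zf.subspace_scale[OF sub[OF mI]]) auto
      moreover have "(\<Sum>b\<in>T'. zscale (c b) b) \<in> A m"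
        using c eq CA[OF mI] by auto
      ultimately have "(\<Sum>b\<in>?M. zscale (c b) b) \<in> A m"
        unfolding split using zf.subspace_diff[OF sub[OF mI]] by fastforce
      moreover have "?M \<subseteq> B m" using ix by (auto simp: T'_def)
      moreover obtain b where "b \<in> ?M" using m(1) by auto
      ultimately have "c b = 0"
        using fin by (intro indep_modD[OF ind[OF mI], of ?M]) auto
      with \<open>b \<in> ?M\<close> show False by (auto simp: T'_def)
    qed
    then show "\<forall>b\<in>T. c b = 0" by (auto simp: T'_def)
  qed
  let ?W = "zf.span ((\<Union>i\<in>I. B i) \<union> C)"
  have "A' i \<subseteq> ?W" if "i \<in> I" for i
    using wf that
  proof (induction i rule: wfp_induct_rule)
    case (less i)
    show ?case
    proof
      fix f assume "f \<in> A' i"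
      then obtain g where g: "g \<in> zf.span (B i)" "f - g \<in> A i"
        using spn less.prems by blast
      have "g \<in> ?W"
        using g(1) zf.span_mono[of "B i" "(\<Union>i\<in>I. B i) \<union> C"] less.prems by blast
      moreover have "f - g \<in> ?W"
        using lim[OF less.prems g(2)] less.IH by (blast intro: zf.span_base)
      ultimately show "f \<in> ?W"
        using zf.span_add[of g _ "f - g"] by simp
    qed
  qed
  then show "(\<Union>i\<in>I. A' i) \<subseteq> ?W" by blast
qed

text \<open>Here \<open>C\<close> is the kernel of \<delta> as far as \<open>A\<close> is concerned.
  Chosen preimages of basis vectors stay independent modulo \<open>C\<close>, because a relation
  among them is mapped to a relation in \<open>B\<close>.\<close>

lemma lift_basis:
  fixes \<delta> :: "('x \<Rightarrow> int) \<Rightarrow> ('y \<Rightarrow> int)"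
  assumes \<delta>: "module_hom zscale zscale \<delta>"
    and A: "zf.subspace A"
    and ker: "\<And>f. f \<in> A \<Longrightarrow> \<delta> f = 0 \<Longrightarrow> f \<in> C" "\<And>f. f \<in> C \<Longrightarrow> \<delta> f = 0"
    and ind: "zf.independent B" and B: "\<And>b. b \<in> B \<Longrightarrow> \<exists>f\<in>A. \<delta> f = b"
    and spn: "\<And>f. f \<in> A \<Longrightarrow> \<delta> f \<in> zf.span B"
  obtains L where "L \<subseteq> A" "indep_mod C L" "\<And>f. f \<in> A \<Longrightarrow> \<exists>g \<in> zf.span L. f - g \<in> C"
proof -
  interpret module_hom zscale zscale \<delta> by (rule \<delta>)
  obtain l where l: "\<And>b. b \<in> B \<Longrightarrow> l b \<in> A \<and> \<delta> (l b) = b" using B by metis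
  show ?thesis
  proof
    show "l ` B \<subseteq> A" using l by auto
    show "indep_mod C (l ` B)"
      unfolding indep_mod_def
    proof (intro allI impI)
      fix T c assume T: "finite T" "T \<subseteq> l ` B" "(\<Sum>b\<in>T. zscale (c b) b) \<in> C"
      have inj: "inj_on \<delta> T" using T(2) l by (intro inj_onI) (metis imageE subsetD)
      have "0 = \<delta> (\<Sum>b\<in>T. zscale (c b) b)" using ker T by simp
      also have "\<dots> = (\<Sum>b\<in>T. zscale (c b) (\<delta> b))" by (simp add: sum scale)
      also have "\<dots> = (\<Sum>b\<in>\<delta> ` T. zscale (c (inv_into T \<delta> b)) b)"
        by (subst sum.reindex[OF inj]) (auto simp: inj intro!: sum.cong)
      finally have "(\<Sum>b\<in>\<delta> ` T. zscale (c (inv_into T \<delta> b)) b) = 0" by simp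
      moreover have "finite (\<delta> ` T)" "\<delta> ` T \<subseteq> B" using T l by auto
      ultimately have "c (inv_into T \<delta> b) = 0" if "b \<in> \<delta> ` T" for b
        using that by (rule_tac zf.independentD[OF ind])
      then show "\<forall>b\<in>T. c b = 0" using inj by force
    qed
    fix f assume f: "f \<in> A"
    have "\<delta> f \<in> \<delta> ` zf.span (l ` B)"
      using spn[OF f] l by (simp add: span_image[symmetric] image_image)
    then obtain g where g: "g \<in> zf.span (l ` B)" "\<delta> f = \<delta> g" by blast
    have "g \<in> A" using g(1) \<open>l ` B \<subseteq> A\<close> A zf.span_minimal by blast
    then have "f - g \<in> C"
      using ker(1)[of "f - g"] g f zf.subspace_diff[OF A] by (auto simp: diff)
    with g show "\<exists>g\<in>zf.span (l ` B). f - g \<in> C" by blast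
  qed
qed

section \<open>Noebeling's theorem\<close>

text \<open>The sets in \<V> serve as coordinates: a point has an image in {0,1}^\<V>, and
  \<open>agree\<close> is equality of images.\<close>

definition agree :: "'x set set \<Rightarrow> 'x \<Rightarrow> 'x \<Rightarrow> bool" where
  "agree \<V> x y \<longleftrightarrow> (\<forall>U\<in>\<V>. x \<in> U \<longleftrightarrow> y \<in> U)"

lemma agree_refl [simp]: "agree \<V> x x"
  and agree_sym: "agree \<V> x y \<Longrightarrow> agree \<V> y x"
  and agree_trans: "agree \<V> x y \<Longrightarrow> agree \<V> y z \<Longrightarrow> agree \<V> x z"
  and agree_mono: "agree \<V> x y \<Longrightarrow> \<W> \<subseteq> \<V> \<Longrightarrow> agree \<W> x y"
  by (auto simp: agree_def)

text \<open>The functions on \<open>S\<close> that factor through finitely many coordinates. They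
  are set to zero off \<open>S\<close>, so that functions on different sets \<open>S\<close> live in
  one module.\<close>

definition cylinder :: "'x set set \<Rightarrow> 'x set \<Rightarrow> ('x \<Rightarrow> int) set" where
  "cylinder \<V> S =
     {f. (\<forall>x. x \<notin> S \<longrightarrow> f x = 0) \<and>
         (\<exists>F. finite F \<and> F \<subseteq> \<V> \<and> (\<forall>x\<in>S. \<forall>y\<in>S. agree F x y \<longrightarrow> f x = f y))}"

lemma cylinderE:
  assumes "f \<in> cylinder \<V> S"
  obtains F where "finite F" "F \<subseteq> \<V>" "\<And>x y. x \<in> S \<Longrightarrow> y \<in> S \<Longrightarrow> agree F x y \<Longrightarrow> f x = f y"
proof -
  from assms obtain F where "finite F" "F \<subseteq> \<V>" "\<forall>x\<in>S. \<forall>y\<in>S. agree F x y \<longrightarrow> f x = f y"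
    unfolding cylinder_def by blast
  then show ?thesis by (rule_tac that[of F]) blast+
qed

lemma cylinderI:
  assumes "\<And>x. x \<notin> S \<Longrightarrow> f x = 0" "finite F" "F \<subseteq> \<V>"
    "\<And>x y. x \<in> S \<Longrightarrow> y \<in> S \<Longrightarrow> agree F x y \<Longrightarrow> f x = f y"
  shows "f \<in> cylinder \<V> S"
  using assms unfolding cylinder_def by blast

lemma cylinder_outside: "f \<in> cylinder \<V> S \<Longrightarrow> x \<notin> S \<Longrightarrow> f x = 0"
  by (simp add: cylinder_def)

lemma cylinder_mono: "\<V> \<subseteq> \<W> \<Longrightarrow> cylinder \<V> S \<subseteq> cylinder \<W> S"
  by (auto simp: cylinder_def)

lemma subspace_cylinder: "zf.subspace (cylinder \<V> S)"
proof (rule zf.subspaceI)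
  show "0 \<in> cylinder \<V> S"
    by (rule cylinderI[of _ _ "{}"]) auto
  fix f g c assume f: "f \<in> cylinder \<V> S"
  from f obtain F where F: "finite F" "F \<subseteq> \<V>" "\<And>x y. x \<in> S \<Longrightarrow> y \<in> S \<Longrightarrow> agree F x y \<Longrightarrow> f x = f y"
    by (rule cylinderE) blast
  show "zscale c f \<in> cylinder \<V> S"
  proof (rule cylinderI[OF _ F(1,2)])
    show "zscale c f x = zscale c f y" if "x \<in> S" "y \<in> S" "agree F x y" for x y
      using F(3)[OF that] by simp
  qed (simp add: cylinder_outside[OF f])
  assume g: "g \<in> cylinder \<V> S"
  then obtain G where G: "finite G" "G \<subseteq> \<V>" "\<And>x y. x \<in> S \<Longrightarrow> y \<in> S \<Longrightarrow> agree G x y \<Longrightarrow> g x = g y"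
    by (rule cylinderE) blast
  show "f + g \<in> cylinder \<V> S"
  proof (rule cylinderI[of _ _ "F \<union> G"])
    fix x y assume "x \<in> S" "y \<in> S" "agree (F \<union> G) x y"
    then show "(f + g) x = (f + g) y"
      using F(3)[of x y] G(3)[of x y] by (simp add: agree_def)
  qed (use F(1,2) G(1,2) in \<open>auto simp: cylinder_outside[OF f] cylinder_outside[OF g]\<close>)
qed

lemma cylinder_empty:
  assumes "f \<in> cylinder {} S"
  shows "\<exists>n. f = zscale n (\<lambda>x. of_bool (x \<in> S))"
proof (cases "S = {}")
  case True
  with assms show ?thesis by (intro exI[of _ 0]) (auto simp: cylinder_def fun_eq_iff)
next
  case False
  then obtain x where "x \<in> S" by blast
  obtain F where F: "F \<subseteq> {}" "\<And>x y. x \<in> S \<Longrightarrow> y \<in> S \<Longrightarrow> agree F x y \<Longrightarrow> f x = f y"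
    using assms by (rule cylinderE) blast
  have "f y = zscale (f x) (\<lambda>x. of_bool (x \<in> S)) y" for y
    using F(2)[of x y] F(1) \<open>x \<in> S\<close> cylinder_outside[OF assms, of y]
    by (cases "y \<in> S") (auto simp: agree_def)
  then show ?thesis by blast
qed

locale clopen_family =
  fixes Z :: "'x topology" and \<U> :: "'x set set"
  assumes compact: "compact_space Z"
    and clopen: "U \<in> \<U> \<Longrightarrow> openin Z U" "U \<in> \<U> \<Longrightarrow> closedin Z U"
begin

lemma openin_cell:
  assumes "finite F" "F \<subseteq> \<U>"
  shows "openin Z {z \<in> topspace Z. agree F x z}"
proof -
  have "openin Z (topspace Z \<inter> \<Inter>((\<lambda>U. {z \<in> topspace Z. (x \<in> U) = (z \<in> U)}) ` F))"
  proof (intro openin_Int_Inter)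
    fix T assume "T \<in> (\<lambda>U. {z \<in> topspace Z. (x \<in> U) = (z \<in> U)}) ` F"
    then obtain U where U: "U \<in> \<U>" "T = {z \<in> topspace Z. (x \<in> U) = (z \<in> U)}"
      using assms(2) by blast
    then have "T = (if x \<in> U then U else topspace Z - U)"
      using clopen(1)[of U] openin_subset[of Z U] by auto
    then show "openin Z T" using clopen[OF U(1)] by auto
  qed (use assms in auto)
  moreover have "topspace Z \<inter> \<Inter>((\<lambda>U. {z \<in> topspace Z. (x \<in> U) = (z \<in> U)}) ` F) = {z \<in> topspace Z. agree F x z}"
    by (auto simp: agree_def)
  ultimately show ?thesis by simp
qed

text \<open>Compactness of \<open>W\<close>: the sets where a given coordinate differs from that of
  \<open>x\<close> are open, they cover \<open>W\<close>, and finitely many of them suffice.\<close>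

lemma separating_cell:
  assumes "\<V> \<subseteq> \<U>" "closedin Z W" "\<And>y. y \<in> W \<Longrightarrow> \<not> agree \<V> x y"
  obtains F where "finite F" "F \<subseteq> \<V>" "\<And>y. y \<in> W \<Longrightarrow> \<not> agree F x y"
proof -
  define N where "N = (\<lambda>U. {y \<in> topspace Z. (y \<in> U) \<noteq> (x \<in> U)})"
  have "openin Z (N U)" if "U \<in> \<V>" for U
  proof -
    have "N U = (if x \<in> U then topspace Z - U else U)"
      using that assms(1) clopen(1)[of U] openin_subset[of Z U] by (auto simp: N_def)
    then show ?thesis using that assms(1) clopen[of U] by auto
  qed
  moreover have "W \<subseteq> \<Union>(N ` \<V>)"
    using assms(2,3) closedin_subset[of Z W] by (fastforce simp: N_def agree_def)
  moreover have "compactin Z W"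
    using assms(2) compact closedin_compact_space by blast
  ultimately obtain \<F> where "finite \<F>" "\<F> \<subseteq> N ` \<V>" "W \<subseteq> \<Union>\<F>"
    using compactinD[of Z W "N ` \<V>"] by blast
  then obtain F where "finite F" "F \<subseteq> \<V>" "W \<subseteq> \<Union>(N ` F)"
    by (metis finite_subset_image)
  then show ?thesis by (intro that[of F]) (auto simp: N_def agree_def)
qed

text \<open>This keeps the induction of Noebeling's argument inside the class of closed sets. A
  finite cell around \<open>x\<close> that misses \<open>W\<close> excludes all of its points from
  the set at once.\<close>

lemma closedin_partners:
  assumes "\<V> \<subseteq> \<U>" "closedin Z S" "closedin Z W"
  shows "closedin Z {x \<in> S. \<exists>y\<in>W. agree \<V> x y}"
  unfolding closedin_def
proof
  show "{x \<in> S. \<exists>y\<in>W. agree \<V> x y} \<subseteq> topspace Z"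
    using assms(2) closedin_subset by blast
  show "openin Z (topspace Z - {x \<in> S. \<exists>y\<in>W. agree \<V> x y})"
  proof (subst openin_subopen, intro ballI)
    fix x assume x: "x \<in> topspace Z - {x \<in> S. \<exists>y\<in>W. agree \<V> x y}"
    show "\<exists>T. openin Z T \<and> x \<in> T \<and> T \<subseteq> topspace Z - {x \<in> S. \<exists>y\<in>W. agree \<V> x y}"
    proof (cases "x \<in> S")
      case False
      with x assms(2) show ?thesis
        by (intro exI[of _ "topspace Z - S"]) auto
    next
      case True
      then obtain F where F: "finite F" "F \<subseteq> \<V>" "\<And>y. y \<in> W \<Longrightarrow> \<not> agree F x y"
        using separating_cell[OF assms(1,3), of x] x by blast
      show ?thesis
      proof (intro exI conjI)
        show "openin Z {z \<in> topspace Z. agree F x z}"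
          using F assms(1) by (intro openin_cell) auto
        show "{z \<in> topspace Z. agree F x z} \<subseteq> topspace Z - {x \<in> S. \<exists>y\<in>W. agree \<V> x y}"
          using F(3) agree_mono[OF _ F(2)] agree_trans[of F x] by blast
      qed (use x in auto)
    qed
  qed
qed

end

text \<open>The induction step of Noebeling's theorem: on \<open>cylinder (insert V \<V>) S\<close> the map \<open>jump\<close> has
  kernel \<open>cylinder \<V> S\<close> and image \<open>cylinder \<V> (partners \<V> V S)\<close>, so this quotient is again
  a group of the same kind over the smaller family \<open>\<V>\<close>.\<close>

definition partners :: "'x set set \<Rightarrow> 'x set \<Rightarrow> 'x set \<Rightarrow> 'x set" where
  "partners \<V> V S = {x \<in> S \<inter> V. \<exists>y\<in>S - V. agree \<V> x y}"

definition partner :: "'x set set \<Rightarrow> 'x set \<Rightarrow> 'x set \<Rightarrow> 'x \<Rightarrow> 'x" where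
  "partner \<V> V S x = (SOME y. y \<in> S - V \<and> agree \<V> x y)"

definition jump :: "'x set set \<Rightarrow> 'x set \<Rightarrow> 'x set \<Rightarrow> ('x \<Rightarrow> int) \<Rightarrow> 'x \<Rightarrow> int" where
  "jump \<V> V S f = (\<lambda>x. if x \<in> partners \<V> V S then f x - f (partner \<V> V S x) else 0)"

lemma partner:
  assumes "x \<in> partners \<V> V S"
  shows "partner \<V> V S x \<in> S - V" "agree \<V> x (partner \<V> V S x)"
proof -
  from assms have "\<exists>y. y \<in> S - V \<and> agree \<V> x y" by (auto simp: partners_def)
  from someI_ex[OF this] show "partner \<V> V S x \<in> S - V" "agree \<V> x (partner \<V> V S x)"
    by (auto simp: partner_def)
qed

lemma module_hom_jump: "module_hom zscale zscale (jump \<V> V S)"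
  by unfold_locales (auto simp: jump_def fun_eq_iff algebra_simps)

text \<open>The choice made in \<open>partner\<close> is immaterial: two points of \<open>S\<close>
  outside \<open>V\<close> that agree with \<open>x\<close> on \<open>F\<close> cannot be told apart
  by \<open>f\<close>.\<close>

lemma jump_eq:
  assumes F: "F \<subseteq> \<V>" "\<And>x y. x \<in> S \<Longrightarrow> y \<in> S \<Longrightarrow> agree (insert V F) x y \<Longrightarrow> f x = f y"
    and x: "x \<in> partners \<V> V S" "y \<in> S - V" "agree F x y"
  shows "jump \<V> V S f x = f x - f y"
proof -
  let ?p = "partner \<V> V S x"
  have "?p \<in> S - V" "agree F x ?p"
    using partner[OF x(1)] agree_mono[OF _ F(1)] by blast+
  then have "f ?p = f y"
    using x(2,3) by (intro F(2)) (auto simp: agree_def)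
  with x(1) show ?thesis by (simp add: jump_def)
qed

lemma jump_cylinder:
  assumes "f \<in> cylinder (insert V \<V>) S"
  shows "jump \<V> V S f \<in> cylinder \<V> (partners \<V> V S)"
proof -
  from assms obtain F where F: "finite F" "F \<subseteq> insert V \<V>"
      "\<And>x y. x \<in> S \<Longrightarrow> y \<in> S \<Longrightarrow> agree F x y \<Longrightarrow> f x = f y"
    by (rule cylinderE) blast
  have F': "F - {V} \<subseteq> \<V>" "finite (F - {V})" using F by auto
  have det: "f x = f y" if "x \<in> S" "y \<in> S" "agree (insert V (F - {V})) x y" for x y
    using that by (intro F(3)) (auto simp: agree_def)
  show ?thesis
  proof (rule cylinderI[OF _ F'(2,1)])
    fix x y assume xy: "x \<in> partners \<V> V S" "y \<in> partners \<V> V S" "agree (F - {V}) x y"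
    have "f x = f y" using xy by (intro det) (auto simp: partners_def agree_def)
    moreover have "agree (F - {V}) x (partner \<V> V S y)"
      using agree_mono[OF partner(2)[OF xy(2)] F'(1)] xy(3) by (simp add: agree_def)
    ultimately show "jump \<V> V S f x = jump \<V> V S f y"
      using jump_eq[where f = f and V = V and y = "partner \<V> V S y", OF F'(1) det xy(1)] partner[OF xy(2)] xy(2)
      by (simp add: jump_def)
  qed (simp add: jump_def)
qed

lemma jump_eq_0:
  assumes "f \<in> cylinder \<V> S"
  shows "jump \<V> V S f = 0"
proof
  fix x
  from assms obtain F where F: "F \<subseteq> \<V>" "\<And>x y. x \<in> S \<Longrightarrow> y \<in> S \<Longrightarrow> agree F x y \<Longrightarrow> f x = f y"
    by (rule cylinderE) blast
  show "jump \<V> V S f x = 0 x"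
    using partner[of x \<V> V S] F(2)[of x "partner \<V> V S x"] agree_mono[OF _ F(1)]
    by (auto simp: jump_def partners_def)
qed

text \<open>The preimage is concentrated on \<open>V\<close>, so partners contribute zero and the
  jump is the value itself. The values of \<open>g\<close> are spread over whole
  \<open>F\<close>-classes of \<open>S \<inter> V\<close>, which keeps the preimage determined by
  \<open>V\<close> and \<open>F\<close>.\<close>

lemma jump_surj:
  assumes "g \<in> cylinder \<V> (partners \<V> V S)"
  obtains f where "f \<in> cylinder (insert V \<V>) S" "jump \<V> V S f = g"
proof -
  let ?S = "partners \<V> V S"
  from assms obtain F where F: "finite F" "F \<subseteq> \<V>"
      "\<And>x y. x \<in> ?S \<Longrightarrow> y \<in> ?S \<Longrightarrow> agree F x y \<Longrightarrow> g x = g y"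
    by (rule cylinderE) blast
  define f where "f x = (if x \<in> S \<inter> V \<and> (\<exists>z\<in>?S. agree F x z) then g (SOME z. z \<in> ?S \<and> agree F x z) else 0)" for x
  have f: "f x = g z" if "x \<in> S \<inter> V" "z \<in> ?S" "agree F x z" for x z
  proof -
    have "\<exists>z. z \<in> ?S \<and> agree F x z" using that by blast
    then have "(SOME z. z \<in> ?S \<and> agree F x z) \<in> ?S \<and> agree F x (SOME z. z \<in> ?S \<and> agree F x z)"
      by (rule someI_ex)
    then have "g (SOME z. z \<in> ?S \<and> agree F x z) = g z"
      using that(2) agree_trans[OF agree_sym that(3)] by (metis F(3))
    then show ?thesis using that by (auto simp: f_def)
  qed
  have f0: "f x = 0" if "x \<notin> S \<inter> V \<or> \<not> (\<exists>z\<in>?S. agree F x z)" for x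
    using that by (auto simp: f_def)
  show ?thesis
  proof
    show "f \<in> cylinder (insert V \<V>) S"
    proof (rule cylinderI[of _ _ "insert V F"])
      fix x y assume xy: "x \<in> S" "y \<in> S" "agree (insert V F) x y"
      then have V: "x \<in> V \<longleftrightarrow> y \<in> V" and ag: "agree F x y" by (auto simp: agree_def)
      show "f x = f y"
      proof (cases "x \<in> V \<and> (\<exists>z\<in>?S. agree F x z)")
        case True
        then obtain z where z: "z \<in> ?S" "agree F x z" by blast
        then have "agree F y z" using ag by (simp add: agree_def)
        then show ?thesis using f[of x z] f[of y z] xy V True z by auto
      next
        case False
        then have "y \<notin> S \<inter> V \<or> \<not> (\<exists>z\<in>?S. agree F y z)" using V agree_trans[OF ag] by blast
        then show ?thesis using f0[of x] f0[of y] False by auto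
      qed
    qed (use F f0 in auto)
    show "jump \<V> V S f = g"
    proof
      fix x
      show "jump \<V> V S f x = g x"
      proof (cases "x \<in> ?S")
        case True
        then show ?thesis
          using f[of x x] f0[of "partner \<V> V S x"] partner[OF True] by (auto simp: jump_def partners_def)
      qed (use assms in \<open>auto simp: jump_def cylinder_outside\<close>)
    qed
  qed
qed

context clopen_family begin

text \<open>A zero jump says only that \<open>f\<close> takes equal values at points of
  \<open>S \<inter> V\<close> and \<open>S - V\<close> that agree on all of \<V>; finitely many
  coordinates must be shown to suffice. The bad set \<open>P\<close> is where the finite set
  \<open>F'\<close> is not enough. It is compact, each of its points is separated from
  \<open>S - V\<close> by finitely many coordinates, and finitely many such separations repair
  \<open>F'\<close>.\<close>

lemma jump_kernel:
  assumes \<V>: "insert V \<V> \<subseteq> \<U>" and S: "closedin Z S"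
    and f: "f \<in> cylinder (insert V \<V>) S" and 0: "jump \<V> V S f = 0"
  shows "f \<in> cylinder \<V> S"
proof -
  from f obtain F where F: "finite F" "F \<subseteq> insert V \<V>"
      "\<And>x y. x \<in> S \<Longrightarrow> y \<in> S \<Longrightarrow> agree F x y \<Longrightarrow> f x = f y"
    by (rule cylinderE) blast
  define F' where "F' = F - {V}"
  have F': "F' \<subseteq> \<V>" "finite F'" using F by (auto simp: F'_def)
  have det: "f x = f y" if "x \<in> S" "y \<in> S" "agree (insert V F') x y" for x y
    using that by (intro F(3)) (auto simp: agree_def F'_def)
  define P where "P = {x \<in> S \<inter> V. \<exists>y\<in>S - V. agree F' x y \<and> f x \<noteq> f y}"
  have SV: "closedin Z (S \<inter> V)" "closedin Z (S - V)"
    using S \<V> clopen by (auto intro: closedin_diff)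
  \<comment> \<open>\<open>P\<close> is a union of \<open>F'\<close>-classes of
    \<open>S \<inter> V\<close>, because \<open>f\<close> is constant on these classes; the other
    classes are open in \<open>S \<inter> V\<close>, so \<open>P\<close> is closed.\<close>
  have "compactin Z P"
  proof -
    have "openin Z {z\<in>topspace Z. agree F' x z}" for x
      using F' \<V> by (intro openin_cell) auto
    then have "openin Z (\<Union>x\<in>S \<inter> V - P. {z\<in>topspace Z. agree F' x z})" by blast
    moreover have "P = S \<inter> V - (\<Union>x\<in>S \<inter> V - P. {z\<in>topspace Z. agree F' x z})"
    proof -
      have "x \<in> P" if "z \<in> P" "x \<in> S \<inter> V" "agree F' x z" for x z
      proof -
        obtain y where y: "y \<in> S - V" "agree F' z y" "f z \<noteq> f y" using \<open>z \<in> P\<close> by (auto simp: P_def)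
        have "f x = f z" using that by (intro det) (auto simp: P_def agree_def)
        moreover have "agree F' x y" using y that(3) by (simp add: agree_def)
        ultimately show ?thesis using that y by (auto simp: P_def)
      qed
      moreover have "P \<subseteq> S \<inter> V" by (auto simp: P_def)
      moreover have "S \<subseteq> topspace Z" using S closedin_subset by blast
      ultimately show ?thesis by auto
    qed
    ultimately have "closedin Z P" using SV(1) by (metis closedin_diff)
    then show ?thesis using compact closedin_compact_space by blast
  qed
  have "\<exists>H. finite H \<and> H \<subseteq> \<V> \<and> (\<forall>y\<in>S - V. \<not> agree H x y)" if "x \<in> P" for x
  proof -
    have "x \<notin> partners \<V> V S"
    proof
      assume x: "x \<in> partners \<V> V S"
      obtain y where y: "y \<in> S - V" "agree F' x y" "f x \<noteq> f y" using \<open>x \<in> P\<close> by (auto simp: P_def)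
      then show False using jump_eq[where f = f and V = V and y = y, OF F'(1) det x y(1,2)] 0 by (simp add: fun_eq_iff)
    qed
    then have "\<not> agree \<V> x y" if "y \<in> S - V" for y
      using that \<open>x \<in> P\<close> by (auto simp: partners_def P_def)
    then show ?thesis
      using separating_cell[OF _ SV(2), of \<V> x] \<V> by (metis insert_subset)
  qed
  then obtain H where H: "\<And>x. x \<in> P \<Longrightarrow> finite (H x)" "\<And>x. x \<in> P \<Longrightarrow> H x \<subseteq> \<V>"
      "\<And>x y. x \<in> P \<Longrightarrow> y \<in> S - V \<Longrightarrow> \<not> agree (H x) x y" by metis
  have "openin Z {z\<in>topspace Z. agree (H x) x z}" if "x \<in> P" for x
    using H that \<V> by (intro openin_cell) (auto, meson insert_subset subset_iff)
  moreover have "P \<subseteq> (\<Union>x\<in>P. {z\<in>topspace Z. agree (H x) x z})"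
    using S closedin_subset by (fastforce simp: P_def)
  ultimately obtain \<F> where "finite \<F>" "\<F> \<subseteq> (\<lambda>x. {z\<in>topspace Z. agree (H x) x z}) ` P" "P \<subseteq> \<Union>\<F>"
    using compactinD[OF \<open>compactin Z P\<close>, of "(\<lambda>x. {z\<in>topspace Z. agree (H x) x z}) ` P"] by blast
  moreover from this(1,2) obtain Q where "Q \<subseteq> P" "finite Q" "\<F> = (\<lambda>x. {z\<in>topspace Z. agree (H x) x z}) ` Q"
    using finite_subset_image by meson
  ultimately have Q: "finite Q" "Q \<subseteq> P" "P \<subseteq> (\<Union>x\<in>Q. {z\<in>topspace Z. agree (H x) x z})"
    by simp_all
  let ?E = "F' \<union> (\<Union>x\<in>Q. H x)"
  have same: "f x = f y" if xy: "x \<in> S \<inter> V" "y \<in> S - V" "agree ?E x y" for x y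
  proof (rule ccontr)
    assume "f x \<noteq> f y"
    then have "x \<in> P" using xy by (auto simp: P_def agree_def)
    then obtain q where q: "q \<in> Q" "agree (H q) q x" using Q(3) by blast
    then have "agree (H q) q y" using xy(3) by (auto simp: agree_def)
    then show False using H(3)[of q y] q Q(2) xy by blast
  qed
  show ?thesis
  proof (rule cylinderI[of _ _ ?E])
    fix x y assume xy: "x \<in> S" "y \<in> S" "agree ?E x y"
    show "f x = f y"
    proof (cases "x \<in> V \<longleftrightarrow> y \<in> V")
      case True
      then show ?thesis using xy by (intro det) (auto simp: agree_def)
    next
      case False
      then show ?thesis using same[of x y] same[of y x] xy agree_sym[OF xy(3)] by auto
    qed
  qed (use Q(1,2) H(1,2) F' in \<open>auto simp: cylinder_outside[OF f]\<close>)
qed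

text \<open>All sets are well-ordered and the coordinates are adjoined one by one. Adjoining
  \<open>i\<close> leaves a quotient that lives on \<open>partners (\<V> i) i S\<close> and uses
  only the coordinates before \<open>i\<close>. Constants are kept apart because the later passage
  from the compactification to the space kills them.\<close>

lemma cylinder_basis:
  assumes "closedin Z S"
  shows "\<exists>B. B \<subseteq> cylinder \<U> S \<and> indep_mod (cylinder {} S) B \<and>
             cylinder \<U> S \<subseteq> zf.span (B \<union> cylinder {} S)"
proof -
  have "\<exists>r :: 'x set rel. Well_order r \<and> Field r = UNIV" by (rule well_ordering)
  then obtain r :: "'x set rel" where r: "Well_order r" "Field r = UNIV"
    by (elim exE conjE)
  define lt where "lt i j \<longleftrightarrow> (i, j) \<in> r - Id" for i j
  have wo: "wf (r - Id)" "trans (r - Id)" "total r"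
    using r by (auto simp: well_order_on_def linear_order_on_def partial_order_on_def preorder_on_def trans_diff_Id)
  have "{(i, j). lt i j} = r - Id" by (auto simp: lt_def)
  with wo(1) have wf: "wfp lt" by (simp add: wfp_def)
  have trans: "lt i k" if "lt i j" "lt j k" for i j k
    using wo(2) that unfolding lt_def by (meson transE)
  have transp: "transp lt" using trans by (rule transpI)
  have total: "lt i j \<or> lt j i" if "i \<noteq> j" for i j
    using wo(3) that by (auto simp: lt_def total_on_def)
  define \<V> where "\<V> i = {j\<in>\<U>. lt j i}" for i
  have reach: "\<exists>m\<in>F. f \<in> cylinder (insert m (\<V> m)) S"
    if f: "f \<in> cylinder \<U> S" and F: "finite F" "F \<noteq> {}" "F \<subseteq> \<U>"
      "\<forall>x\<in>S. \<forall>y\<in>S. agree F x y \<longrightarrow> f x = f y" for f F S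
  proof -
    obtain m where m: "m \<in> F" "\<forall>i\<in>F. i = m \<or> lt i m"
      using finite_total_has_greatest[OF F(1,2) transp total] by blast
    then have "F \<subseteq> insert m (\<V> m)" using F by (auto simp: \<V>_def)
    then show ?thesis
      using m(1) F(1,4) cylinder_outside[OF f]
      by (intro bexI[of _ m] cylinderI[of _ _ F]) blast+
  qed
  \<comment> \<open>The set \<open>S\<close> has to vary in the induction, since the step at
    \<open>i\<close> calls for a basis on the set of partners.\<close>
  define full :: "'x set \<Rightarrow> 'x set set \<Rightarrow> bool" where "full S W \<longleftrightarrow> (\<exists>B. B \<subseteq> cylinder W S \<and>
      indep_mod (cylinder {} S) B \<and>
      cylinder W S \<subseteq> zf.span (B \<union> cylinder {} S))" for S W
  have combine: "full S W"
    if S: "closedin Z S"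
      and W: "W \<subseteq> \<U>" "\<And>i j. i \<in> W \<Longrightarrow> lt j i \<Longrightarrow> j \<in> \<U> \<Longrightarrow> j \<in> W"
      and IH: "\<And>i S. i \<in> W \<Longrightarrow> closedin Z S \<Longrightarrow> full S (\<V> i)" for S W
  proof -
    have "\<exists>L. L \<subseteq> cylinder (insert i (\<V> i)) S \<and> indep_mod (cylinder (\<V> i) S) L \<and>
        (\<forall>f \<in> cylinder (insert i (\<V> i)) S. \<exists>g \<in> zf.span L. f - g \<in> cylinder (\<V> i) S)"
      if i: "i \<in> W" for i
    proof -
      let ?S = "partners (\<V> i) i S"
      let ?e = "\<lambda>x. of_bool (x \<in> ?S) :: int"
      have iU: "insert i (\<V> i) \<subseteq> \<U>" using i W by (auto simp: \<V>_def)
      have "closedin Z ?S"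
        using closedin_partners[of "\<V> i" "S \<inter> i" "S - i"] S iU clopen
        by (auto simp: partners_def intro: closedin_diff)
      then obtain B where B: "B \<subseteq> cylinder (\<V> i) ?S"
          "indep_mod (cylinder {} ?S) B"
          "cylinder (\<V> i) ?S \<subseteq> zf.span (B \<union> cylinder {} ?S)"
        using IH[OF i] unfolding full_def by blast
      have e: "?e \<in> cylinder {} ?S"
        by (rule cylinderI[of _ _ "{}"]) auto
      \<comment> \<open>The indicator \<open>?e\<close> spans the constants on \<open>?S\<close>; it
        is zero when \<open>?S\<close> is empty, and then it must be left out of an independent
        set.\<close>
      let ?B = "B \<union> ({?e} - {0})"
      have span: "cylinder (\<V> i) ?S \<subseteq> zf.span ?B"
      proof -
        have "cylinder {} ?S \<subseteq> zf.span ?B"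
        proof
          fix f assume "f \<in> cylinder {} ?S"
          then obtain n where "f = zscale n ?e" using cylinder_empty by blast
          moreover have "?e \<in> zf.span ?B"
            by (cases "?e = 0") (simp_all add: zf.span_zero zf.span_base)
          ultimately show "f \<in> zf.span ?B" using zf.span_scale by blast
        qed
        then show ?thesis
          using B(3) zf.span_minimal[of "B \<union> cylinder {} ?S" "zf.span ?B"] zf.span_superset[of ?B]
          by (meson Un_least Un_upper1 order_trans zf.subspace_span)
      qed
      have ind: "zf.independent ?B"
        unfolding zf.independent_explicit_module
      proof (intro allI impI)
        fix T u v assume T: "finite T" "T \<subseteq> ?B" "(\<Sum>b\<in>T. zscale (u b) b) = 0" and v: "v \<in> T"
        have eB: "?e \<notin> B"
        proof
          assume "?e \<in> B"
          then show False
            using indep_modD[OF B(2), of "{?e}" "\<lambda>_. 1" ?e] e by simp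
        qed
        let ?T = "T - {?e}"
        have split: "(\<Sum>b\<in>T. zscale (u b) b) = (if ?e \<in> T then zscale (u ?e) ?e else 0) + (\<Sum>b\<in>?T. zscale (u b) b)"
          using T(1) by (simp add: sum.remove)
        have "(\<Sum>b\<in>?T. zscale (u b) b) \<in> cylinder {} ?S"
        proof -
          have "(\<Sum>b\<in>?T. zscale (u b) b) = - (if ?e \<in> T then zscale (u ?e) ?e else 0)"
            using split T(3) by (simp add: add_eq_0_iff2)
          also have "\<dots> \<in> cylinder {} ?S"
            using e subspace_cylinder
            by (auto intro!: zf.subspace_neg zf.subspace_scale zf.subspace_0)
          finally show ?thesis .
        qed
        then have 0: "u b = 0" if "b \<in> ?T" for b
          using T that by (intro indep_modD[OF B(2), of ?T]) auto
        then have "(if ?e \<in> T then zscale (u ?e) ?e else 0) = 0"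
          using split T(3) by simp
        then have "u ?e = 0" if "?e \<in> T"
        proof -
          have "?e \<noteq> 0" using that T(2) eB by blast
          with \<open>(if ?e \<in> T then zscale (u ?e) ?e else 0) = 0\<close> that show ?thesis
            by (auto simp: fun_eq_iff split: if_splits)
        qed
        with 0 v show "u v = 0" by (cases "v = ?e") auto
      qed
      have surj: "\<exists>f\<in>cylinder (insert i (\<V> i)) S. jump (\<V> i) i S f = b" if "b \<in> ?B" for b
      proof -
        have "b \<in> cylinder (\<V> i) ?S"
          using that B(1) e cylinder_mono[of "{}" "\<V> i"] by auto
        then show ?thesis using jump_surj by blast
      qed
      show ?thesis
      proof (rule lift_basis[where C = "cylinder (\<V> i) S", OF module_hom_jump subspace_cylinder _ _ ind surj])
        show "jump (\<V> i) i S f \<in> zf.span ?B" if "f \<in> cylinder (insert i (\<V> i)) S" for f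
          using span jump_cylinder[OF that] by blast
      qed (use jump_kernel[OF iU S] jump_eq_0 in blast)+
    qed
    then obtain L where L: "\<And>i. i \<in> W \<Longrightarrow> L i \<subseteq> cylinder (insert i (\<V> i)) S"
        "\<And>i. i \<in> W \<Longrightarrow> indep_mod (cylinder (\<V> i) S) (L i)"
        "\<And>i f. i \<in> W \<Longrightarrow> f \<in> cylinder (insert i (\<V> i)) S \<Longrightarrow>
           \<exists>g \<in> zf.span (L i). f - g \<in> cylinder (\<V> i) S"
      by metis
    have lim: "f \<in> cylinder {} S \<or> (\<exists>j\<in>W. f \<in> cylinder (insert j (\<V> j)) S \<and> j \<in> V)"
      if f: "f \<in> cylinder V S" and "V \<subseteq> W" for f V
    proof -
      from f obtain F where F: "finite F" "F \<subseteq> V" "\<And>x y. x \<in> S \<Longrightarrow> y \<in> S \<Longrightarrow> agree F x y \<Longrightarrow> f x = f y"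
        by (rule cylinderE) blast
      show ?thesis
      proof (cases "F = {}")
        case True
        with F cylinder_outside[OF f] show ?thesis
          by (intro disjI1 cylinderI[of _ _ "{}"]) blast+
      next
        case False
        have "f \<in> cylinder \<U> S" using f that(2) W(1) cylinder_mono by blast
        from reach[OF this F(1) False] F that(2) W(1) show ?thesis by blast
      qed
    qed
    have mono: "cylinder (insert i (\<V> i)) S \<subseteq> cylinder (\<V> j) S"
      if "i \<in> W" "j \<in> W" "lt i j" for i j
      using that W(1) trans by (intro cylinder_mono) (auto simp: \<V>_def)
    have lim': "f \<in> cylinder {} S \<or> (\<exists>j\<in>W. lt j i \<and> f \<in> cylinder (insert j (\<V> j)) S)"
      if "i \<in> W" "f \<in> cylinder (\<V> i) S" for i f
      using that lim[of f "\<V> i"] W(2) by (auto simp: \<V>_def)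
    note * = filtration_basis[where A = "\<lambda>i. cylinder (\<V> i) S" and lt = lt
        and A' = "\<lambda>i. cylinder (insert i (\<V> i)) S",
        OF wf transp total subspace_cylinder L(1,2,3) mono lim' cylinder_mono[OF empty_subsetI]]
    show ?thesis
      unfolding full_def
    proof (intro exI conjI)
      show "(\<Union>i\<in>W. L i) \<subseteq> cylinder W S"
      proof -
        have "cylinder (insert i (\<V> i)) S \<subseteq> cylinder W S" if "i \<in> W" for i
          using that W by (intro cylinder_mono) (auto simp: \<V>_def)
        then show ?thesis using L(1) by blast
      qed
      show "cylinder W S \<subseteq> zf.span ((\<Union>i\<in>W. L i) \<union> cylinder {} S)"
      proof
        fix f assume "f \<in> cylinder W S"
        with lim[of f W] have "f \<in> cylinder {} S \<or> f \<in> (\<Union>i\<in>W. cylinder (insert i (\<V> i)) S)"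
          by auto
        then show "f \<in> zf.span ((\<Union>i\<in>W. L i) \<union> cylinder {} S)"
          using *(2) by (elim disjE) (simp add: zf.span_base, rule subsetD)
      qed
    qed (rule *)
  qed
  have initial: "full S (\<V> i)" if "closedin Z S" for i S
    using wf that
  proof (induction i arbitrary: S rule: wfp_induct_rule)
    case (less i)
    show ?case
      by (rule combine[OF less.prems]) (use less.IH trans in \<open>auto simp: \<V>_def\<close>)
  qed
  \<comment> \<open>The whole family need not be of the form \<V> i, so the combination step is
    applied once more, to \<U> itself.\<close>
  have "full S \<U>" by (rule combine[OF assms subset_refl _ initial])
  then show ?thesis by (simp add: full_def)
qed

end

text \<open>Counterpart of \<open>lift_basis\<close>, used to divide out the constants: a relation
  among images lifts to a combination in the kernel, where independence modulo \<open>C\<close>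
  applies.\<close>

lemma push_basis:
  fixes \<phi> :: "('x \<Rightarrow> int) \<Rightarrow> ('y \<Rightarrow> int)"
  assumes \<phi>: "module_hom zscale zscale \<phi>"
    and A: "zf.subspace A" "B \<subseteq> A"
    and ker: "\<And>f. f \<in> A \<Longrightarrow> \<phi> f = 0 \<Longrightarrow> f \<in> C" "\<And>f. f \<in> C \<Longrightarrow> \<phi> f = 0"
    and ind: "indep_mod C B" and spn: "A \<subseteq> zf.span (B \<union> C)"
  shows "zf.independent (\<phi> ` B)" "\<phi> ` A \<subseteq> zf.span (\<phi> ` B)"
proof -
  interpret module_hom zscale zscale \<phi> by (rule \<phi>)
  show "zf.independent (\<phi> ` B)"
    unfolding zf.independent_explicit_module
  proof (intro allI impI)
    fix T u v assume T: "finite T" "T \<subseteq> \<phi> ` B" "(\<Sum>v\<in>T. zscale (u v) v) = 0" "v \<in> T"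
    obtain T' where T': "T' \<subseteq> B" "inj_on \<phi> T'" "T = \<phi> ` T'"
      using T(2) by (meson subset_image_inj)
    have fin: "finite T'" using T(1) T' finite_image_iff by blast
    have "\<phi> (\<Sum>b\<in>T'. zscale (u (\<phi> b)) b) = 0"
      using T(3) by (simp add: T'(3) sum.reindex[OF T'(2)] sum scale)
    moreover have "(\<Sum>b\<in>T'. zscale (u (\<phi> b)) b) \<in> A"
      using T'(1) A by (intro zf.subspace_sum zf.subspace_scale) auto
    ultimately have "(\<Sum>b\<in>T'. zscale (u (\<phi> b)) b) \<in> C" by (rule ker(1)[rotated])
    from indep_modD[OF ind fin T'(1) this] show "u v = 0" using T(4) T'(3) by auto
  qed
  have "\<phi> ` A \<subseteq> zf.span (\<phi> ` (B \<union> C))"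
    using spn by (auto simp: span_image)
  also have "\<dots> \<subseteq> zf.span (\<phi> ` B)"
    by (rule zf.span_minimal) (auto simp: ker(2) zf.span_zero intro: zf.span_base)
  finally show "\<phi> ` A \<subseteq> zf.span (\<phi> ` B)" .
qed

section \<open>Integer-valued continuous functions of compact support\<close>

lemma openin_level_sets_imp_continuous:
  assumes "\<And>n. openin X {x \<in> topspace X. f x = n}"
  shows "continuous_map X (discrete_topology UNIV) f"
proof -
  have "{x \<in> topspace X. f x \<in> V} = (\<Union>n\<in>V. {x \<in> topspace X. f x = n})" for V by auto
  with assms show ?thesis by (auto simp: continuous_map_def)
qed

lemma clopen_level_set:
  assumes "continuous_map X (discrete_topology UNIV) f"
  shows "openin X {x \<in> topspace X. f x \<in> V}" "closedin X {x \<in> topspace X. f x \<in> V}"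
  using assms openin_continuous_map_preimage[of X _ f V] closedin_continuous_map_preimage[of X _ f V]
  by auto

text \<open>The support is the preimage of the clopen set of nonzero integers; it is closed already,
  and the closure in \<open>Cc_int\<close> disappears.\<close>

lemma carrier_Cc_intE:
  assumes "f \<in> carrier (Cc_int X)"
  shows "continuous_map X (discrete_topology UNIV) f" "x \<notin> topspace X \<Longrightarrow> f x = 0"
    "compactin X {x \<in> topspace X. f x \<noteq> 0}"
proof -
  show f: "continuous_map X (discrete_topology UNIV) f"
    using assms by (simp add: Cc_int_def)
  then have "closedin X {x \<in> topspace X. f x \<in> - {0}}" by (rule clopen_level_set)
  then have "X closure_of {x \<in> topspace X. f x \<noteq> 0} = {x \<in> topspace X. f x \<noteq> 0}"
    by (simp add: closure_of_closedin)
  then show "compactin X {x \<in> topspace X. f x \<noteq> 0}"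
    using assms by (simp add: Cc_int_def)
qed (use assms in \<open>simp add: Cc_int_def\<close>)

lemma carrier_Cc_intI:
  assumes "\<And>n. openin X {x \<in> topspace X. f x = n}" "\<And>x. x \<notin> topspace X \<Longrightarrow> f x = 0"
    and K: "compactin X K" "closedin X K" "{x \<in> topspace X. f x \<noteq> 0} \<subseteq> K"
  shows "f \<in> carrier (Cc_int X)"
proof -
  have "compactin X (X closure_of {x \<in> topspace X. f x \<noteq> 0})"
    using closure_of_minimal[OF K(3,2)] by (rule closed_compactin[OF K(1)]) simp
  then show ?thesis
    using assms openin_level_sets_imp_continuous[of X f] by (auto simp: Cc_int_def)
qed

lemma finite_image_Cc_int:
  assumes "f \<in> carrier (Cc_int X)"
  shows "finite (f ` topspace X)"
proof -
  have "compactin (discrete_topology UNIV) (f ` {x \<in> topspace X. f x \<noteq> 0})"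
    using carrier_Cc_intE[OF assms] image_compactin by blast
  then have "finite (f ` {x \<in> topspace X. f x \<noteq> 0})"
    by (simp add: compactin_discrete_topology)
  then have "finite (insert 0 (f ` {x \<in> topspace X. f x \<noteq> 0}))" by simp
  then show ?thesis by (rule finite_subset[rotated]) auto
qed

text \<open>\<open>Y\<close> is an arbitrary space. In its one-point compactification the compact
  clopen subsets of \<open>Y\<close> become a clopen family on a compact space, and subtracting the
  value at infinity identifies the cylinder functions modulo constants with
  \<open>Cc_int Y\<close>.\<close>

theorem Cc_int_free:
  obtains B where "B \<subseteq> carrier (Cc_int Y)" "zf.independent B" "carrier (Cc_int Y) \<subseteq> zf.span B"
proof -
  define Z where "Z = Alexandroff_compactification Y"
  define \<U> where "\<U> = {Some ` K |K. compactin Y K \<and> closedin Y K \<and> openin Y K}"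
  interpret clopen_family Z \<U>
    by unfold_locales (auto simp: Z_def \<U>_def)
  define S where "S = topspace Z"
  have S: "S = insert None (Some ` topspace Y)" by (simp add: S_def Z_def)
  obtain B where B: "B \<subseteq> cylinder \<U> S" "indep_mod (cylinder {} S) B"
      "cylinder \<U> S \<subseteq> zf.span (B \<union> cylinder {} S)"
    using cylinder_basis[of S] by (auto simp: S_def)
  define \<phi> :: "('a option \<Rightarrow> int) \<Rightarrow> ('a \<Rightarrow> int)"
    where "\<phi> f = (\<lambda>y. if y \<in> topspace Y then f (Some y) - f None else 0)" for f
  have \<phi>: "module_hom zscale zscale \<phi>"
    by unfold_locales (auto simp: \<phi>_def fun_eq_iff algebra_simps)
  have ker1: "f \<in> cylinder {} S" if "f \<in> cylinder \<U> S" "\<phi> f = 0" for f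
  proof (rule cylinderI[of _ _ "{}"])
    have "f x = f None" if "x \<in> S" for x
      using \<open>\<phi> f = 0\<close> that by (auto simp: S \<phi>_def fun_eq_iff split: if_splits)
    then show "f x = f y" if "x \<in> S" "y \<in> S" for x y
      using that(1) that(2)[THEN \<open>\<And>x. x \<in> S \<Longrightarrow> f x = f None\<close>] by simp
  qed (use that in \<open>auto simp: cylinder_outside\<close>)
  have ker2: "\<phi> f = 0" if f: "f \<in> cylinder {} S" for f
  proof -
    obtain n where "f = zscale n (\<lambda>x. of_bool (x \<in> S))"
      using cylinder_empty[OF f] by blast
    then show ?thesis by (auto simp: \<phi>_def S fun_eq_iff)
  qed
  have img: "\<phi> f \<in> carrier (Cc_int Y)" if f: "f \<in> cylinder \<U> S" for f
  proof -
    obtain F where F: "finite F" "F \<subseteq> \<U>" "\<And>x y. x \<in> S \<Longrightarrow> y \<in> S \<Longrightarrow> agree F x y \<Longrightarrow> f x = f y"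
      using f by (rule cylinderE) blast
    \<comment> \<open>Off \<open>K\<close> a point has the same coordinates in \<open>F\<close> as
      infinity, because no member of \<U> contains \<open>None\<close>; so \<open>K\<close> bounds
      the support.\<close>
    define K where "K = {y \<in> topspace Y. \<exists>U\<in>F. Some y \<in> U}"
    have vim: "compactin Y (Some -` U) \<and> closedin Y (Some -` U) \<and> openin Y (Some -` U)" if "U \<in> F" for U
      using F(2) that by (auto simp: \<U>_def inj_vimage_image_eq)
    have K: "K = \<Union>((\<lambda>U. Some -` U) ` F)"
      using vim closedin_subset[of Y] by (fastforce simp: K_def)
    show ?thesis
    proof (rule carrier_Cc_intI)
      fix n
      show "openin Y {y \<in> topspace Y. \<phi> f y = n}"
      proof (subst openin_subopen, intro ballI)
        fix y assume y: "y \<in> {y \<in> topspace Y. \<phi> f y = n}"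
        let ?T = "{z \<in> topspace Y. agree F (Some y) (Some z)}"
        have "openin Y {z \<in> topspace Y. Some z \<in> {z \<in> topspace Z. agree F (Some y) z}}"
          using openin_cell[OF F(1,2)] continuous_map_Some[of Y]
          by (intro openin_continuous_map_preimage[of Y Z]) (simp_all add: Z_def)
        moreover have "{z \<in> topspace Y. Some z \<in> {z \<in> topspace Z. agree F (Some y) z}} = ?T"
          by (auto simp: Z_def)
        ultimately have "openin Y ?T" by simp
        moreover have "?T \<subseteq> {y \<in> topspace Y. \<phi> f y = n}"
        proof
          fix z assume z: "z \<in> ?T"
          then have "f (Some y) = f (Some z)" using y by (intro F(3)) (auto simp: S)
          then show "z \<in> {y \<in> topspace Y. \<phi> f y = n}" using z y by (auto simp: \<phi>_def)
        qed
        ultimately show "\<exists>T. openin Y T \<and> y \<in> T \<and> T \<subseteq> {y \<in> topspace Y. \<phi> f y = n}"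
          using y by (intro exI[of _ ?T]) simp
      qed
    next
      show "compactin Y K" "closedin Y K"
        unfolding K using F(1) vim by (auto intro!: compactin_Union closedin_Union)
      show "{y \<in> topspace Y. \<phi> f y \<noteq> 0} \<subseteq> K"
      proof
        fix y assume y: "y \<in> {y \<in> topspace Y. \<phi> f y \<noteq> 0}"
        show "y \<in> K"
        proof (rule ccontr)
          assume "y \<notin> K"
          moreover have "None \<notin> U" if "U \<in> F" for U using that F(2) by (auto simp: \<U>_def)
          ultimately have "agree F (Some y) None" using y by (auto simp: K_def agree_def)
          then have "f (Some y) = f None" using y by (intro F(3)) (auto simp: S)
          with y show False by (auto simp: \<phi>_def)
        qed
      qed
    qed (simp add: \<phi>_def)
  qed
  have surj: "f \<in> \<phi> ` cylinder \<U> S" if f: "f \<in> carrier (Cc_int Y)" for f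
  proof
    let ?g = "case_option 0 f"
    note fE = carrier_Cc_intE[OF f]
    let ?L = "\<lambda>n. {y \<in> topspace Y. f y = n}"
    \<comment> \<open>Finitely many coordinates suffice because \<open>f\<close> has finitely many
      values. The value zero is omitted, as its level set need not be compact.\<close>
    define F where "F = (\<lambda>n. Some ` ?L n) ` (f ` topspace Y - {0})"
    show "f = \<phi> ?g" using fE(2) by (auto simp: \<phi>_def fun_eq_iff)
    show "?g \<in> cylinder \<U> S"
    proof (rule cylinderI)
      show "finite F" using finite_image_Cc_int[OF f] by (simp add: F_def)
      show "F \<subseteq> \<U>"
      proof
        fix U assume "U \<in> F"
        then obtain n where n: "U = Some ` ?L n" "n \<noteq> 0" by (auto simp: F_def)
        have "openin Y (?L n)" "closedin Y (?L n)"
          using clopen_level_set[OF fE(1), of "{n}"] by simp_all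
        moreover from this have "compactin Y (?L n)"
          using n(2) by (intro closed_compactin[OF fE(3)]) auto
        ultimately show "U \<in> \<U>" using n(1) by (auto simp: \<U>_def)
      qed
      show "?g x = 0" if "x \<notin> S" for x using that fE(2) by (auto simp: S split: option.split)
      \<comment> \<open>The coordinates detect nonzero values only; the case of a zero value at
        \<open>x\<close> follows by exchanging \<open>x\<close> and \<open>y\<close>.\<close>
      have *: "?g y = ?g x" if xy: "x \<in> S" "y \<in> S" "agree F x y" "?g x \<noteq> 0" for x y
      proof -
        obtain x' where x': "x = Some x'" "f x' \<noteq> 0" "x' \<in> topspace Y"
          using xy(1,4) by (auto simp: S)
        then have "Some ` ?L (f x') \<in> F" "x \<in> Some ` ?L (f x')" by (auto simp: F_def)
        then have "y \<in> Some ` ?L (f x')" using xy(3) unfolding agree_def by blast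
        then show ?thesis using x' by auto
      qed
      show "?g x = ?g y" if "x \<in> S" "y \<in> S" "agree F x y" for x y
      proof (cases "?g x = 0")
        case True
        then show ?thesis using *[OF that(2,1) agree_sym[OF that(3)]] by argo
      next
        case False
        then show ?thesis using *[OF that] by argo
      qed
    qed
  qed
  note pb = push_basis[OF \<phi> subspace_cylinder B(1) ker1 ker2 B(2,3)]
  show ?thesis
  proof
    show "\<phi> ` B \<subseteq> carrier (Cc_int Y)" using img B(1) by blast
    show "zf.independent (\<phi> ` B)" by (rule pb)
    show "carrier (Cc_int Y) \<subseteq> zf.span (\<phi> ` B)" using surj pb(2) by blast
  qed
qed

section \<open>Splitting along a basis\<close>

text \<open>Freeness makes the section additive: preimages are chosen for basis vectors only and
  extended through coordinates.\<close>

lemma basis_section: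
  fixes \<delta> :: "('x \<Rightarrow> int) \<Rightarrow> ('y \<Rightarrow> int)"
  assumes \<delta>: "module_hom zscale zscale \<delta>" and A: "zf.subspace A"
    and ind: "zf.independent B" and B: "\<And>b. b \<in> B \<Longrightarrow> \<exists>f\<in>A. \<delta> f = b"
  obtains \<sigma> where "\<And>f. f \<in> zf.span B \<Longrightarrow> \<sigma> f \<in> A" "\<And>f. f \<in> zf.span B \<Longrightarrow> \<delta> (\<sigma> f) = f"
    "\<And>f g. f \<in> zf.span B \<Longrightarrow> g \<in> zf.span B \<Longrightarrow> \<sigma> (f + g) = \<sigma> f + \<sigma> g"
proof -
  interpret module_hom zscale zscale \<delta> by (rule \<delta>)
  obtain l where l: "\<And>b. b \<in> B \<Longrightarrow> l b \<in> A \<and> \<delta> (l b) = b" using B by metis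
  let ?R = "zf.representation B"
  define \<sigma> where "\<sigma> f = (\<Sum>b | ?R f b \<noteq> 0. zscale (?R f b) (l b))" for f
  show ?thesis
  proof
    fix f assume f: "f \<in> zf.span B"
    have mem: "b \<in> B" if "?R f b \<noteq> 0" for b
      using that zf.representation_ne_zero by blast
    show "\<sigma> f \<in> A"
      unfolding \<sigma>_def using mem l by (intro zf.subspace_sum[OF A] zf.subspace_scale[OF A]) auto
    have "\<delta> (\<sigma> f) = (\<Sum>b | ?R f b \<noteq> 0. zscale (?R f b) b)"
      unfolding \<sigma>_def sum scale by (rule sum.cong) (use mem l in auto)
    also have "\<dots> = f" by (rule zf.sum_nonzero_representation_eq[OF ind f])
    finally show "\<delta> (\<sigma> f) = f" .
    fix g assume g: "g \<in> zf.span B"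
    let ?T = "{b. ?R f b \<noteq> 0} \<union> {b. ?R g b \<noteq> 0}"
    have T: "finite ?T" by (simp add: zf.finite_representation)
    have eq: "\<sigma> h = (\<Sum>b\<in>?T. zscale (?R h b) (l b))" if "\<And>b. b \<notin> ?T \<Longrightarrow> ?R h b = 0" for h
      unfolding \<sigma>_def using that by (intro sum.mono_neutral_left[OF T]) auto
    show "\<sigma> (f + g) = \<sigma> f + \<sigma> g"
    proof -
      have "\<sigma> (f + g) = (\<Sum>b\<in>?T. zscale (?R (f + g) b) (l b))"
        by (rule eq) (simp add: zf.representation_add[OF ind g f])
      also have "\<dots> = (\<Sum>b\<in>?T. zscale (?R f b) (l b)) + (\<Sum>b\<in>?T. zscale (?R g b) (l b))"
        unfolding zf.representation_add[OF ind g f] zf.scale_left_distrib sum.distrib ..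
      also have "\<dots> = \<sigma> f + \<sigma> g"
        using eq[of f] eq[of g] by simp
      finally show ?thesis .
    qed
  qed
qed

definition fun_group :: "('x \<Rightarrow> int) set \<Rightarrow> ('x \<Rightarrow> int) monoid" where
  "fun_group G = \<lparr>carrier = G, monoid.mult = (+), one = 0\<rparr>"

lemma group_fun_group:
  assumes "zf.subspace G"
  shows "group (fun_group G)"
proof (rule groupI)
  show "\<exists>y\<in>carrier (fun_group G). y \<otimes>\<^bsub>fun_group G\<^esub> x = \<one>\<^bsub>fun_group G\<^esub>"
    if "x \<in> carrier (fun_group G)" for x
    using that zf.subspace_neg[OF assms] by (intro bexI[of _ "- x"]) (auto simp: fun_group_def)
qed (use assms in \<open>auto simp: fun_group_def zf.subspace_add zf.subspace_0 add.assoc\<close>)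

lemma fun_group_free:
  assumes "zf.independent B" "zf.span B = G"
  shows "free_Abelian_group B \<cong> fun_group G"
proof -
  define \<Psi> where "\<Psi> c = (\<Sum>b\<in>Poly_Mapping.keys c. zscale (Poly_Mapping.lookup c b) b)" for c :: "('a \<Rightarrow> int) \<Rightarrow>\<^sub>0 int"
  have ext: "\<Psi> c = (\<Sum>b\<in>T. zscale (Poly_Mapping.lookup c b) b)" if "finite T" "Poly_Mapping.keys c \<subseteq> T" for c T
    unfolding \<Psi>_def using that by (intro sum.mono_neutral_left) (auto simp: in_keys_iff)
  have "\<Psi> \<in> iso (free_Abelian_group B) (fun_group G)"
  proof (rule isoI)
    show "\<Psi> \<in> hom (free_Abelian_group B) (fun_group G)"
    proof (rule homI)
      fix x assume x: "x \<in> carrier (free_Abelian_group B)"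
      then have "\<Psi> x \<in> zf.span B"
        unfolding \<Psi>_def by (intro zf.span_sum zf.span_scale) (auto intro: zf.span_base)
      then show "\<Psi> x \<in> carrier (fun_group G)"
        using assms(2) by (simp add: fun_group_def)
      fix y assume y: "y \<in> carrier (free_Abelian_group B)"
      let ?T = "Poly_Mapping.keys x \<union> Poly_Mapping.keys y"
      have "\<Psi> (x + y) = (\<Sum>b\<in>?T. zscale (Poly_Mapping.lookup (x + y) b) b)"
        by (rule ext) (simp_all add: keys_add)
      also have "\<dots> = \<Psi> x + \<Psi> y"
        using ext[of ?T x] ext[of ?T y] by (simp add: lookup_add zf.scale_left_distrib sum.distrib)
      finally show "\<Psi> (x \<otimes>\<^bsub>free_Abelian_group B\<^esub> y) = \<Psi> x \<otimes>\<^bsub>fun_group G\<^esub> \<Psi> y"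
        by (simp add: fun_group_def)
    qed
    show "bij_betw \<Psi> (carrier (free_Abelian_group B)) (carrier (fun_group G))"
      unfolding bij_betw_def
    proof
      show "inj_on \<Psi> (carrier (free_Abelian_group B))"
      proof (rule inj_onI)
        fix x y assume xy: "x \<in> carrier (free_Abelian_group B)" "y \<in> carrier (free_Abelian_group B)" "\<Psi> x = \<Psi> y"
        let ?T = "Poly_Mapping.keys x \<union> Poly_Mapping.keys y"
        have "(\<Sum>b\<in>?T. zscale (Poly_Mapping.lookup x b - Poly_Mapping.lookup y b) b) = \<Psi> x - \<Psi> y"
          using ext[of ?T x] ext[of ?T y] by (simp add: zf.scale_left_diff_distrib sum_subtractf)
        then have "Poly_Mapping.lookup x b - Poly_Mapping.lookup y b = 0" if "b \<in> ?T" for b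
          using xy that by (intro zf.independentD[OF assms(1), of ?T _ b]) auto
        then have "Poly_Mapping.lookup x b = Poly_Mapping.lookup y b" for b
          by (cases "b \<in> ?T") (auto simp: in_keys_iff)
        then show "x = y" by (simp add: poly_mapping_eqI)
      qed
      have "g \<in> \<Psi> ` carrier (free_Abelian_group B)" if "g \<in> G" for g
      proof
        let ?R = "zf.representation B g"
        have g: "g \<in> zf.span B" using that assms(2) by simp
        have lk: "Poly_Mapping.lookup (Abs_poly_mapping ?R) = ?R"
          by (simp add: zf.finite_representation)
        then have keys: "Poly_Mapping.keys (Abs_poly_mapping ?R) = {b. ?R b \<noteq> 0}"
          by (auto simp: in_keys_iff)
        show "g = \<Psi> (Abs_poly_mapping ?R)"
          unfolding \<Psi>_def keys lk by (rule zf.sum_nonzero_representation_eq[OF assms(1) g, symmetric])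
        show "Abs_poly_mapping ?R \<in> carrier (free_Abelian_group B)"
          using keys zf.representation_ne_zero by fastforce
      qed
      moreover have "\<Psi> c \<in> G" if "c \<in> carrier (free_Abelian_group B)" for c
        using \<open>\<Psi> \<in> hom _ _\<close> that by (auto simp: hom_def fun_group_def)
      ultimately show "\<Psi> ` carrier (free_Abelian_group B) = carrier (fun_group G)"
        by (auto simp: fun_group_def)
    qed
  qed
  then show ?thesis by (rule is_isoI)
qed

text \<open>The index set in \<open>is_free_abelian\<close> must have the element type of
  \<open>A\<close>, so \<open>B\<close> is carried into \<open>A\<close> by the inverse of
  \<phi>.\<close>

lemma is_free_abelian_iso:
  assumes \<phi>: "\<phi> \<in> iso A (fun_group G)" and B: "zf.independent B" "zf.span B = G"
  shows "is_free_abelian A"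
proof -
  have bij: "bij_betw \<phi> (carrier A) G"
    using \<phi> by (simp add: iso_def fun_group_def)
  have "B \<subseteq> G" using B(2) zf.span_superset by blast
  then have "B \<approx> inv_into (carrier A) \<phi> ` B"
    using bij by (intro inj_on_image_eqpoll_self[THEN eqpoll_sym] inj_on_subset[OF inj_on_inv_into])
      (auto simp: bij_betw_def)
  then have "free_Abelian_group B \<cong> free_Abelian_group (inv_into (carrier A) \<phi> ` B)"
    by (simp add: isomorphic_free_Abelian_groups)
  moreover have "group (fun_group G)"
    using B(2) group_fun_group zf.subspace_span by blast
  moreover have "A \<cong> fun_group G" using \<phi> by (rule is_isoI)
  moreover have "fun_group G \<cong> free_Abelian_group B"
    using fun_group_free[OF B] group.iso_sym group_free_Abelian_group by blast
  ultimately show ?thesis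
    unfolding is_free_abelian_def by (meson iso_trans)
qed

section \<open>Lattice-ordered groups of functions with compact open supports\<close>

abbreviation supp :: "('x \<Rightarrow> int) \<Rightarrow> 'x set" where
  "supp g \<equiv> {x. g x \<noteq> 0}"

text \<open>The interface through which the ring enters. \<open>common_point\<close> is the
  existence of a maximal ideal above a proper ideal, said of functions; \<open>clopen_supp\<close>
  asks about nonnegative functions because these come from generators inside
  \<open>D\<close>.\<close>

locale lattice_group_space =
  fixes X :: "'x topology" and G :: "('x \<Rightarrow> int) set" and \<S> :: "'x set set"
  assumes supp_topspace: "g \<in> G \<Longrightarrow> supp g \<subseteq> topspace X"
    and subspace_G: "zf.subspace G"
    and min_G: "f \<in> G \<Longrightarrow> g \<in> G \<Longrightarrow> (\<lambda>x. min (f x) (g x)) \<in> G"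
    and unit_G: "x \<in> topspace X \<Longrightarrow> \<exists>g\<in>G. g x = 1"
    and generated: "X = topology_generated_by \<S>"
    and subbase: "S \<in> \<S> \<Longrightarrow> S = topspace X \<or> S = {} \<or> (\<exists>g\<in>G. S = supp g \<or> S = topspace X - supp g)"
    and clopen_supp: "g \<in> G \<Longrightarrow> (\<And>x. 0 \<le> g x) \<Longrightarrow> openin X (supp g) \<and> closedin X (supp g)"
    and common_point: "F \<subseteq> G \<Longrightarrow> F \<noteq> {} \<Longrightarrow> (\<And>h. h \<in> F \<Longrightarrow> h \<noteq> 0 \<and> (\<forall>x. 0 \<le> h x)) \<Longrightarrow>
      (\<And>h k. h \<in> F \<Longrightarrow> k \<in> F \<Longrightarrow> (\<lambda>x. min (h x) (k x)) \<in> F) \<Longrightarrow>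
      \<exists>x\<in>topspace X. \<forall>h\<in>F. h x \<noteq> 0"
begin

lemmas zero_G = zf.subspace_0[OF subspace_G]
  and add_G = zf.subspace_add[OF subspace_G]
  and diff_G = zf.subspace_diff[OF subspace_G]
  and neg_G = zf.subspace_neg[OF subspace_G]
  and scale_G = zf.subspace_scale[OF subspace_G]

lemma pos_G: "g \<in> G \<Longrightarrow> (\<lambda>x. max (g x) 0) \<in> G"
proof -
  assume "g \<in> G"
  then have "- (\<lambda>x. min ((- g) x) ((0 :: 'x \<Rightarrow> int) x)) \<in> G" by (intro neg_G min_G zero_G)
  moreover have "- (\<lambda>x. min ((- g) x) ((0 :: 'x \<Rightarrow> int) x)) = (\<lambda>x. max (g x) 0)" by (auto simp: fun_eq_iff)
  ultimately show ?thesis by simp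
qed

lemma abs_G: "g \<in> G \<Longrightarrow> (\<lambda>x. \<bar>g x\<bar>) \<in> G"
proof -
  assume "g \<in> G"
  then have "(\<lambda>x. max (g x) 0) + (\<lambda>x. max ((- g) x) 0) \<in> G" by (intro add_G pos_G neg_G)
  moreover have "(\<lambda>x. max (g x) 0) + (\<lambda>x. max ((- g) x) 0) = (\<lambda>x. \<bar>g x\<bar>)" by (auto simp: fun_eq_iff)
  ultimately show ?thesis by simp
qed

lemma excess_G: "f \<in> G \<Longrightarrow> g \<in> G \<Longrightarrow> (\<lambda>x. max (f x - n * g x) 0) \<in> G"
  using pos_G[OF diff_G[OF _ scale_G, of f g n]] by simp

lemma clopen: "g \<in> G \<Longrightarrow> openin X (supp g)" "g \<in> G \<Longrightarrow> closedin X (supp g)"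
  using clopen_supp[OF abs_G, of g] by auto

lemma open_le: "f \<in> G \<Longrightarrow> g \<in> G \<Longrightarrow> openin X {x \<in> topspace X. f x \<le> n * g x}"
proof -
  assume fg: "f \<in> G" "g \<in> G"
  have "openin X (topspace X - supp (\<lambda>x. max (f x - n * g x) 0))"
    using clopen(2)[OF excess_G[OF fg]] by blast
  moreover have "topspace X - supp (\<lambda>x. max (f x - n * g x) 0) = {x \<in> topspace X. f x \<le> n * g x}"
    by auto
  ultimately show ?thesis by simp
qed

text \<open>This trades open sets for members of \<open>G\<close>: within \<open>supp g\<close>, the
  complement of \<open>U\<close> is contained in the support of a function that vanishes at
  \<open>x\<close>. The induction follows the generation of the topology; an intersection is handled
  by adding the two functions.\<close>

lemma separating_function:
  assumes "openin X U" "x \<in> U" and g: "g \<in> G" "\<And>y. 0 \<le> g y"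
  shows "\<exists>h\<in>G. (\<forall>y. 0 \<le> h y) \<and> h x = 0 \<and> (\<forall>y \<in> supp g - U. h y \<noteq> 0)"
proof -
  have "generate_topology_on \<S> U"
    using assms(1) unfolding generated by (simp add: openin_topology_generated_by)
  then show ?thesis using assms(2)
  proof (induction U)
    case (Int a b)
    then obtain h k where h: "h \<in> G" "\<forall>y. 0 \<le> h y" "h x = 0" "\<forall>y \<in> supp g - a. h y \<noteq> 0"
      and k: "k \<in> G" "\<forall>y. 0 \<le> k y" "k x = 0" "\<forall>y \<in> supp g - b. k y \<noteq> 0" by blast
    have nz: "h y + k y \<noteq> 0" if "h y \<noteq> 0 \<or> k y \<noteq> 0" for y
      using that h(2)[rule_format, of y] k(2)[rule_format, of y] by linarith
    show ?case
      by (rule bexI[of _ "h + k"]) (use h k nz in \<open>auto simp: add_G\<close>)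
  next
    case (UN K)
    then obtain k where k: "k \<in> K" "x \<in> k" by blast
    then obtain h where h: "h \<in> G" "\<forall>y. 0 \<le> h y" "h x = 0" "\<forall>y \<in> supp g - k. h y \<noteq> 0"
      using UN.IH by blast
    then show ?case using k by (intro bexI[of _ h]) auto
  next
    case (Basis S)
    then consider "S = topspace X" | k where "k \<in> G" "S = supp k" | k where "k \<in> G" "S = topspace X - supp k"
      using subbase[of S] by blast
    then show ?case
    proof cases
      case 1
      then show ?thesis using supp_topspace[OF g(1)] zero_G by (intro bexI[of _ 0]) auto
    next
      case 2
      \<comment> \<open>At \<open>x\<close> the factor \<open>\<bar>k x\<bar> \<ge> 1\<close> lets
        the subtracted term reach \<open>g x\<close>; off \<open>S\<close> the function
        \<open>k\<close> is zero and \<open>g\<close> survives.\<close>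
      let ?h = "\<lambda>y. max (g y - g x * \<bar>k y\<bar>) 0"
      have "g x * \<bar>k x\<bar> \<ge> g x * 1"
        using 2 Basis.prems g(2) by (intro mult_left_mono) auto
      moreover have "?h y \<noteq> 0" if "y \<in> supp g - S" for y
        using that 2 g(2)[of y] by auto
      ultimately show ?thesis
        using excess_G[OF g(1) abs_G[OF 2(1)]] by (intro bexI[of _ ?h]) auto
    next
      case 3
      then show ?thesis
        using Basis.prems supp_topspace[OF g(1)] abs_G[OF 3(1)] by (intro bexI[of _ "\<lambda>y. \<bar>k y\<bar>"]) auto
    qed
  qed simp
qed

text \<open>If no finite subfamily covers, consider the functions whose support contains what some
  finite subfamily leaves of \<open>supp g\<close>. They are nonzero and closed under minima, hence
  all nonzero at some point \<open>x\<close>. But \<open>x\<close> lies in a member \<open>U\<close>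
  of the cover, and a function separating \<open>x\<close> from \<open>supp g - U\<close> belongs to
  the family and vanishes at \<open>x\<close>.\<close>

lemma compact_supp_nonneg:
  assumes g: "g \<in> G" "\<And>x. 0 \<le> g x"
  shows "compactin X (supp g)"
  unfolding compactin_def
proof (intro conjI allI impI)
  show "supp g \<subseteq> topspace X" using supp_topspace g(1) .
  fix \<C> assume "Ball \<C> (openin X) \<and> supp g \<subseteq> \<Union>\<C>"
  then have \<C>: "\<And>U. U \<in> \<C> \<Longrightarrow> openin X U" "supp g \<subseteq> \<Union>\<C>" by auto
  show "\<exists>\<F>. finite \<F> \<and> \<F> \<subseteq> \<C> \<and> supp g \<subseteq> \<Union>\<F>"
  proof (rule ccontr)
    assume no: "\<nexists>\<F>. finite \<F> \<and> \<F> \<subseteq> \<C> \<and> supp g \<subseteq> \<Union>\<F>"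
    define F where "F = {h \<in> G. (\<forall>x. 0 \<le> h x) \<and> (\<exists>\<F>. finite \<F> \<and> \<F> \<subseteq> \<C> \<and> supp g - \<Union>\<F> \<subseteq> supp h)}"
    have "\<exists>x\<in>topspace X. \<forall>h\<in>F. h x \<noteq> 0"
    proof (rule common_point)
      show "F \<noteq> {}" using g by (auto simp: F_def)
      show "h \<noteq> 0 \<and> (\<forall>x. 0 \<le> h x)" if "h \<in> F" for h
        using that no by (fastforce simp: F_def)
      fix h k assume hk: "h \<in> F" "k \<in> F"
      then obtain \<F> \<F>' where "finite \<F>" "\<F> \<subseteq> \<C>" "supp g - \<Union>\<F> \<subseteq> supp h"
          "finite \<F>'" "\<F>' \<subseteq> \<C>" "supp g - \<Union>\<F>' \<subseteq> supp k" by (auto simp: F_def)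
      then have "finite (\<F> \<union> \<F>') \<and> \<F> \<union> \<F>' \<subseteq> \<C> \<and> supp g - \<Union>(\<F> \<union> \<F>') \<subseteq> supp (\<lambda>x. min (h x) (k x))"
        by (auto simp: min_def)
      moreover have "(\<lambda>x. min (h x) (k x)) \<in> G" "\<forall>x. 0 \<le> min (h x) (k x)"
        using hk by (auto simp: F_def min_G)
      ultimately show "(\<lambda>x. min (h x) (k x)) \<in> F"
        unfolding F_def by blast
    qed (auto simp: F_def)
    then obtain x where x: "\<And>h. h \<in> F \<Longrightarrow> h x \<noteq> 0" by blast
    have "g \<in> F" using g by (auto simp: F_def intro!: exI[of _ "{}"])
    then obtain U where U: "U \<in> \<C>" "x \<in> U" using x \<C>(2) by blast
    obtain h where h: "h \<in> G" "\<forall>y. 0 \<le> h y" "h x = 0" "\<forall>y \<in> supp g - U. h y \<noteq> 0"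
      using separating_function[OF \<C>(1)[OF U(1)] U(2) g] by blast
    then have "h \<in> F" using U by (auto simp: F_def intro!: exI[of _ "{U}"])
    then show False using x h(3) by blast
  qed
qed

lemma compact_supp: "g \<in> G \<Longrightarrow> compactin X (supp g)"
  using compact_supp_nonneg[OF abs_G, of g] by simp

text \<open>Integrality gives \<open>h \<ge> 1\<close> on its support, so the open sets where
  \<open>g \<le> n * h\<close> cover this support; by compactness one \<open>n\<close> is
  enough.\<close>

lemma bounded_on_supp:
  assumes g: "g \<in> G" and h: "h \<in> G" "\<And>x. 0 \<le> h x"
  shows "\<exists>n\<ge>0. \<forall>x\<in>supp h. g x \<le> n * h x"
proof -
  let ?U = "\<lambda>n. {x \<in> topspace X. g x \<le> n * h x}"
  have "x \<in> ?U \<bar>g x\<bar>" if "x \<in> supp h" for x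
  proof -
    have "h x \<ge> 1" using h(2)[of x] that by simp
    then have "\<bar>g x\<bar> * 1 \<le> \<bar>g x\<bar> * h x" by (intro mult_left_mono) auto
    then show ?thesis using that supp_topspace[OF h(1)] by auto
  qed
  then have "supp h \<subseteq> \<Union>(?U ` {0..})" by force
  moreover have "openin X V" if "V \<in> ?U ` {0..}" for V
    using that open_le[OF g h(1)] by auto
  ultimately obtain \<F> where "finite \<F>" "\<F> \<subseteq> ?U ` {0..}" "supp h \<subseteq> \<Union>\<F>"
    using compactinD[OF compact_supp[OF h(1)], of "?U ` {0..}"] by auto
  moreover from this(1,2) obtain N where "N \<subseteq> {0..}" "finite N" "\<F> = ?U ` N"
    using finite_subset_image by meson
  ultimately have N: "finite N" "N \<subseteq> {0..}" "supp h \<subseteq> \<Union>(?U ` N)" by auto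
  show ?thesis
  proof (intro exI conjI ballI)
    show "0 \<le> Max (insert 0 N)" using N(1) by simp
    fix x assume "x \<in> supp h"
    then obtain n where n: "n \<in> N" "g x \<le> n * h x" using N(3) by blast
    have "n * h x \<le> Max (insert 0 N) * h x"
      using N(1) n(1) h(2) by (intro mult_right_mono) auto
    with n(2) show "g x \<le> Max (insert 0 N) * h x" by linarith
  qed
qed

definition restrict_to :: "'x set \<Rightarrow> ('x \<Rightarrow> int) \<Rightarrow> 'x \<Rightarrow> int" where
  "restrict_to S g = (\<lambda>x. if x \<in> S then g x else 0)"

lemma restrict_to_apply [simp]: "restrict_to S g x = (if x \<in> S then g x else 0)"
  by (simp add: restrict_to_def)

lemma module_hom_restrict_to: "module_hom zscale zscale (restrict_to S)"
  by unfold_locales (auto simp: restrict_to_def fun_eq_iff algebra_simps)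

text \<open>If \<open>f \<ge> 0\<close> is bounded by \<open>n * \<bar>h\<bar>\<close> on the
  support of \<open>h\<close>, the minimum of the two is \<open>f\<close> there and zero elsewhere.
  The general case splits \<open>g\<close> into positive and negative part.\<close>

lemma restrict_supp_G:
  assumes "g \<in> G" "h \<in> G"
  shows "restrict_to (supp h) g \<in> G"
proof -
  have *: "restrict_to (supp h) f \<in> G" if f: "f \<in> G" "\<And>x. 0 \<le> f x" for f
  proof -
    obtain n where n: "n \<ge> 0" "\<forall>x\<in>supp (\<lambda>x. \<bar>h x\<bar>). f x \<le> n * \<bar>h x\<bar>"
      using bounded_on_supp[OF f(1) abs_G[OF assms(2)]] by auto
    have "(\<lambda>x. min (f x) (zscale n (\<lambda>x. \<bar>h x\<bar>) x)) \<in> G"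
      using f assms by (intro min_G scale_G abs_G)
    moreover have "min (f x) (zscale n (\<lambda>x. \<bar>h x\<bar>) x) = restrict_to (supp h) f x" for x
      using n f(2)[of x] by (cases "h x = 0") auto
    ultimately show ?thesis by (simp add: restrict_to_def)
  qed
  have "restrict_to (supp h) (\<lambda>x. max (g x) 0) - restrict_to (supp h) (\<lambda>x. max ((- g) x) 0) \<in> G"
    using assms by (intro diff_G * pos_G neg_G) auto
  moreover have "restrict_to (supp h) (\<lambda>x. max (g x) 0) - restrict_to (supp h) (\<lambda>x. max ((- g) x) 0) =
      restrict_to (supp h) g" by (auto simp: fun_eq_iff)
  ultimately show ?thesis by simp
qed

lemma restrict_compl_supp_G:
  assumes "g \<in> G" "h \<in> G"
  shows "restrict_to (- supp h) g \<in> G"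
proof -
  have "g - restrict_to (supp h) g \<in> G" using assms by (intro diff_G restrict_supp_G)
  moreover have "g - restrict_to (supp h) g = restrict_to (- supp h) g" by (auto simp: fun_eq_iff)
  ultimately show ?thesis by simp
qed

text \<open>A nonnegative function with value 1 at \<open>x\<close> is erased on the support of a
  function that separates \<open>x\<close> from the complement of \<open>U\<close>.\<close>

lemma local_unit:
  assumes U: "openin X U" "x \<in> U"
  obtains e where "e \<in> G" "\<And>y. 0 \<le> e y" "e x = 1" "supp e \<subseteq> U"
proof -
  have "x \<in> topspace X" using U openin_subset by blast
  then obtain t where t: "t \<in> G" "t x = 1" using unit_G by blast
  let ?t = "\<lambda>y. max (t y) 0"
  obtain h where h: "h \<in> G" "h x = 0" "\<forall>y \<in> supp ?t - U. h y \<noteq> 0"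
    using separating_function[OF U pos_G[OF t(1)]] by auto
  show ?thesis
  proof
    show "restrict_to (- supp h) ?t \<in> G" using t h by (intro restrict_compl_supp_G pos_G)
  qed (use t h in auto)
qed

section \<open>Functions with values 0 and 1 on a closed set\<close>

definition noncrit :: "'x set \<Rightarrow> 'x set" where
  "noncrit S = {x \<in> S. \<exists>g\<in>G. g x = 1 \<and> (\<forall>y\<in>S. g y \<in> {0, 1})}"

text \<open>A member of \<open>G\<close> with only the values 0 and 1 on \<open>S\<close> is 1
  wherever it is nonzero on \<open>S\<close>, so \<open>noncrit S\<close> is the trace on
  \<open>S\<close> of a union of open supports.\<close>

lemma closedin_diff_noncrit:
  assumes "closedin X S"
  shows "closedin X (S - noncrit S)"
proof -
  let ?E = "{g \<in> G. \<forall>y\<in>S. g y \<in> {0, 1}}"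
  have "S - noncrit S = S - (\<Union>g\<in>?E. supp g)"
    by (auto simp: noncrit_def)
  also have "closedin X \<dots>"
    using assms clopen(1) by (intro closedin_diff openin_Union) auto
  finally show ?thesis .
qed

text \<open>As \<open>x\<close> survives, a function \<open>e \<le> h\<close> with value 1 at
  \<open>x\<close> must exceed 1 at some \<open>y\<close> in \<open>S\<close>, so
  \<open>h y \<ge> 2\<close>. A function \<open>f \<le> h\<close> with value 1 at \<open>y\<close>
  is then restricted to the set where \<open>2 * f \<le> h\<close>, which contains
  \<open>y\<close>.\<close>

lemma halving:
  assumes no: "noncrit S = {}" and h: "h \<in> G" "\<And>x. 0 \<le> h x" "supp h \<inter> S \<noteq> {}"
  obtains k where "k \<in> G" "\<And>x. 0 \<le> k x" "supp k \<inter> S \<noteq> {}" "\<And>x. 2 * k x \<le> h x"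
proof -
  have meet: "\<exists>e\<in>G. (\<forall>y. 0 \<le> e y \<and> e y \<le> h y) \<and> e x = 1" if "x \<in> supp h" for x
  proof -
    have "x \<in> topspace X" using that supp_topspace[OF h(1)] by blast
    then obtain t where t: "t \<in> G" "t x = 1" using unit_G by blast
    have "(\<lambda>y. min (max (t y) 0) (h y)) \<in> G" using t h by (intro min_G pos_G)
    moreover have "1 \<le> h x" using h(2)[of x] that by simp
    ultimately show ?thesis
      using t h(2) by (intro bexI[of _ "\<lambda>y. min (max (t y) 0) (h y)"]) auto
  qed
  obtain x where x: "x \<in> supp h" "x \<in> S" using h(3) by blast
  obtain e where e: "e \<in> G" "\<And>y. 0 \<le> e y" "\<And>y. e y \<le> h y" "e x = 1" using meet[OF x(1)] by blast
  have "x \<notin> noncrit S" using no by blast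
  then obtain y where y: "y \<in> S" "e y \<notin> {0, 1}" using x(2) e(1,4) by (auto simp: noncrit_def)
  then have "2 \<le> h y" using e(2,3)[of y] by auto
  then obtain f where f: "f \<in> G" "\<And>z. 0 \<le> f z" "\<And>z. f z \<le> h z" "f y = 1" using meet[of y] by auto
  let ?d = "\<lambda>z. max (zscale 2 f z - 1 * h z) 0"
  let ?k = "restrict_to (- supp ?d) f"
  show ?thesis
  proof
    show "?k \<in> G" by (intro restrict_compl_supp_G excess_G scale_G f h)
    have "y \<in> supp ?k \<inter> S" using y(1) f(4) \<open>2 \<le> h y\<close> by simp
    then show "supp ?k \<inter> S \<noteq> {}" by blast
    show "2 * ?k z \<le> h z" for z using h(2)[of z] by auto
    show "0 \<le> ?k z" for z using f(2) by simp
  qed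
qed

lemma noncrit_nonempty:
  assumes S: "closedin X S" "S \<noteq> {}"
  shows "noncrit S \<noteq> {}"
proof
  assume no: "noncrit S = {}"
  obtain x where "x \<in> S" "x \<in> topspace X" using S closedin_subset by blast
  then obtain t where t: "t \<in> G" "t x = 1" using unit_G by blast
  let ?P = "\<lambda>h. h \<in> G \<and> (\<forall>x. 0 \<le> h x) \<and> supp h \<inter> S \<noteq> {}"
  have "x \<in> supp (\<lambda>y. max (t y) 0) \<inter> S" using t(2) \<open>x \<in> S\<close> by simp
  then have "?P (\<lambda>y. max (t y) 0)" using pos_G[OF t(1)] by auto
  then have "\<exists>h. \<forall>n. ?P (h n) \<and> (\<forall>x. 2 * h (Suc n) x \<le> h n x)"
  proof (intro dependent_nat_choice[of "\<lambda>_. ?P" "\<lambda>_ h k. \<forall>x. 2 * k x \<le> h x"])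
    fix h assume h: "?P h"
    then obtain k where "k \<in> G" "\<And>x. 0 \<le> k x" "supp k \<inter> S \<noteq> {}" "\<And>x. 2 * k x \<le> h x"
      by (elim conjE) (rule halving[OF no], blast+)
    then show "\<exists>k. ?P k \<and> (\<forall>x. 2 * k x \<le> h x)" by blast
  qed blast
  then obtain h where "\<forall>n. ?P (h n) \<and> (\<forall>x. 2 * h (Suc n) x \<le> h n x)" by (rule exE)
  then have h: "\<And>n. ?P (h n)" "\<And>n x. 2 * h (Suc n) x \<le> h n x" by simp_all
  have pow: "2 ^ n * h n x \<le> h 0 x" for n x
  proof (induction n)
    case (Suc n)
    have "2 ^ n * (2 * h (Suc n) x) \<le> 2 ^ n * h n x" using h(2) by (intro mult_left_mono) auto
    moreover have "2 ^ n * (2 * h (Suc n) x) = 2 ^ Suc n * h (Suc n) x" by simp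
    ultimately show ?case using Suc by linarith
  qed simp
  let ?U = "\<lambda>n. topspace X - supp (h n)"
  have mono: "supp (h n) \<subseteq> supp (h m)" if "m \<le> n" for m n
    using that
  proof (induction n rule: dec_induct)
    case (step n)
    have "supp (h (Suc n)) \<subseteq> supp (h n)"
    proof
      fix x assume "x \<in> supp (h (Suc n))"
      with h(1)[of "Suc n"] h(2)[of n x] have "h (Suc n) x > 0" by (simp add: order_less_le)
      then show "x \<in> supp (h n)" using h(2)[of n x] by simp
    qed
    with step show ?case by blast
  qed simp
  have "compactin X (S \<inter> supp (h 0))"
    using S(1) compact_supp h(1) by (blast intro: closed_Int_compactin)
  moreover have "openin X (?U n)" for n using clopen(2) h(1) by blast
  moreover have "S \<inter> supp (h 0) \<subseteq> \<Union>(range ?U)"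
  proof
    fix x assume x: "x \<in> S \<inter> supp (h 0)"
    \<comment> \<open>With \<open>m = h 0 x\<close>, a nonzero value of \<open>h m\<close> at
      \<open>x\<close> would be at least 1, and \<open>pow\<close> would give
      \<open>2 ^ m \<le> m\<close>.\<close>
    have "h 0 x < 2 ^ nat (h 0 x)" using of_nat_less_two_power[of "nat (h 0 x)"] h(1)[of 0] by simp
    then have "h (nat (h 0 x)) x = 0"
      using pow[of "nat (h 0 x)" x] h(1)[of "nat (h 0 x)"]
      by (smt (verit, ccfv_SIG) mult_le_cancel_left1 zero_less_power)
    then show "x \<in> \<Union>(range ?U)" using x S(1) closedin_subset by blast
  qed
  ultimately obtain \<F> where \<F>: "finite \<F>" "\<F> \<subseteq> range ?U" "S \<inter> supp (h 0) \<subseteq> \<Union>\<F>"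
    using compactinD[of X "S \<inter> supp (h 0)" "range ?U"] by blast
  then obtain N where N: "finite N" "\<F> = ?U ` N" by (meson finite_subset_image)
  \<comment> \<open>Supports decrease, so a point of \<open>S\<close> in the support with the
    largest index escapes the whole finite subcover; 0 is inserted in case \<open>N\<close> is
    empty.\<close>
  let ?m = "Max (insert 0 N)"
  obtain z where z: "z \<in> supp (h ?m)" "z \<in> S" using h(1)[of ?m] by blast
  then have "z \<in> supp (h 0)" using mono[of 0 ?m] by blast
  then obtain n where "n \<in> N" "z \<notin> supp (h n)" using \<F>(3) N(2) z(2) by blast
  then show False using mono[of n ?m] N(1) z(1) by auto
qed

end

section \<open>The transfinite chain and its layers\<close>

locale critical_chain = lattice_group_space X G \<S>
  for X :: "'x topology" and G :: "('x \<Rightarrow> int) set" and \<S> :: "'x set set" +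
  fixes C :: "'o::wellorder \<Rightarrow> 'x set" and \<alpha> :: 'o
  assumes C_zero: "\<forall>\<beta>. i \<le> \<beta> \<Longrightarrow> C i = topspace X"
    and C_succ: "is_succ_of j i \<Longrightarrow> closedin X (C i) \<Longrightarrow> C j = C i - noncrit (C i)"
    and C_limit: "\<not> (\<forall>\<beta>. i \<le> \<beta>) \<Longrightarrow> \<not> (\<exists>j. is_succ_of i j) \<Longrightarrow> C i = (\<Inter>j\<in>{..<i}. C j)"
    and C_final: "closedin X (C \<alpha>) \<Longrightarrow> noncrit (C \<alpha>) = {}"
begin

abbreviation C' :: "'o \<Rightarrow> 'x set" where
  "C' i \<equiv> C i - noncrit (C i)"

text \<open>Closedness and inclusion are proved together, because the successor rule of the locale
  is available only for closed sets.\<close>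

lemma chain: "closedin X (C i) \<and> (\<forall>j<i. C i \<subseteq> C' j)"
proof (induction i rule: less_induct)
  case (less i)
  consider "\<forall>\<beta>. i \<le> \<beta>" | k where "is_succ_of i k" | "\<not> (\<forall>\<beta>. i \<le> \<beta>)" "\<not> (\<exists>j. is_succ_of i j)"
    by blast
  then show ?case
  proof cases
    case 1
    then show ?thesis using C_zero by (auto simp: leD)
  next
    case (2 k)
    then have k: "k < i" "closedin X (C k)" using less.IH by (auto simp: is_succ_of_def)
    have Ci: "C i = C' k" using C_succ[OF 2 k(2)] .
    have "C i \<subseteq> C' j" if "j < i" for j
    proof (cases "j = k")
      case False
      then have "j < k" using 2 that by (meson is_succ_of_def leD linorder_neqE)
      then show ?thesis using less.IH[OF k(1)] Ci by blast
    qed (simp add: Ci)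
    then show ?thesis using Ci closedin_diff_noncrit[OF k(2)] by simp
  next
    case 3
    have Ci: "C i = (\<Inter>j\<in>{..<i}. C j)" using C_limit[OF 3] .
    have "{..<i} \<noteq> {}" using 3(1) by (auto simp: not_le)
    then have "closedin X (C i)"
      unfolding Ci using less.IH by (intro closedin_Inter) auto
    moreover have "C i \<subseteq> C' j" if "j < i" for j
    proof -
      \<comment> \<open>The limit \<open>i\<close> is no successor of \<open>j\<close>, which leaves
        room for \<open>k\<close>; passing from \<open>j\<close> to \<open>k\<close> already removes
        the points of \<open>noncrit (C j)\<close>.\<close>
      obtain k where "j < k" "k < i" using 3(2) \<open>j < i\<close> by (auto simp: is_succ_of_def not_le)
      then show ?thesis using less.IH[of k] Ci by blast
    qed
    ultimately show ?thesis by blast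
  qed
qed

lemma closedin_C: "closedin X (C i)" and C_sub_next: "j < i \<Longrightarrow> C i \<subseteq> C' j"
  using chain by blast+

lemma closedin_next: "closedin X (C' i)"
  by (rule closedin_diff_noncrit[OF closedin_C])

lemma C_mono: "j \<le> i \<Longrightarrow> C i \<subseteq> C j"
  using C_sub_next[of j i] by (cases "j = i") (auto dest: le_neq_trans)

lemma C_alpha_empty: "C \<alpha> = {}"
  using noncrit_nonempty[OF closedin_C] C_final[OF closedin_C] by blast

lemma noncrit_subset: "noncrit S \<subseteq> S"
  by (auto simp: noncrit_def)

definition vanishing :: "'x set \<Rightarrow> ('x \<Rightarrow> int) set" where
  "vanishing S = {g \<in> G. \<forall>x\<in>S. g x = 0}"

lemma subspace_vanishing: "zf.subspace (vanishing S)"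
  by (rule zf.subspaceI) (auto simp: vanishing_def zero_G add_G scale_G)

lemma vanishing_mono: "S \<subseteq> T \<Longrightarrow> vanishing T \<subseteq> vanishing S"
  by (auto simp: vanishing_def)

text \<open>Continuity of the filtration. The least stage at which \<open>g\<close> vanishes is not
  a limit: the complements of the earlier closed sets would cover the compact support of
  \<open>g\<close>, and as they are nested one of them would contain it. At a successor stage
  \<open>C k0\<close> is \<open>C' k\<close>.\<close>

lemma vanishing_limit:
  assumes g: "g \<in> vanishing (C i)"
  shows "g = 0 \<or> (\<exists>j<i. g \<in> vanishing (C' j))"
proof -
  define k0 where "k0 = (LEAST j. g \<in> vanishing (C j))"
  have j: "g \<in> vanishing (C k0)" unfolding k0_def using g by (rule LeastI)
  have le: "k0 \<le> k" if "g \<in> vanishing (C k)" for k unfolding k0_def using that by (rule Least_le)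
  have gG: "g \<in> G" using g by (simp add: vanishing_def)
  consider "\<forall>\<beta>. k0 \<le> \<beta>" | k where "is_succ_of k0 k" | "\<not> (\<forall>\<beta>. k0 \<le> \<beta>)" "\<not> (\<exists>k. is_succ_of k0 k)"
    by blast
  then show ?thesis
  proof cases
    case 1
    have "g x = 0" for x
      using j C_zero[OF 1] supp_topspace[OF gG] by (auto simp: vanishing_def)
    then show ?thesis by (simp add: fun_eq_iff)
  next
    case (2 k)
    then have "k < i" using le[OF g] by (auto simp: is_succ_of_def)
    then show ?thesis using j C_succ[OF 2 closedin_C] by metis
  next
    case 3
    have "supp g \<subseteq> \<Union>((\<lambda>k. topspace X - C k) ` {..<k0})"
    proof
      fix x assume x: "x \<in> supp g"
      then have "x \<notin> C k0" using j by (auto simp: vanishing_def)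
      then show "x \<in> \<Union>((\<lambda>k. topspace X - C k) ` {..<k0})"
        using C_limit[OF 3] supp_topspace[OF gG] x by blast
    qed
    moreover have "openin X V" if "V \<in> (\<lambda>k. topspace X - C k) ` {..<k0}" for V
      using that closedin_C by auto
    ultimately obtain \<F> where "finite \<F>" "\<F> \<subseteq> (\<lambda>k. topspace X - C k) ` {..<k0}" "supp g \<subseteq> \<Union>\<F>"
      using compactinD[OF compact_supp[OF gG], of "(\<lambda>k. topspace X - C k) ` {..<k0}"] by auto
    moreover from this(1,2) obtain N where "N \<subseteq> {..<k0}" "finite N" "\<F> = (\<lambda>k. topspace X - C k) ` N"
      using finite_subset_image by meson
    ultimately have N: "N \<subseteq> {..<k0}" "finite N" "supp g \<subseteq> \<Union>((\<lambda>k. topspace X - C k) ` N)" by auto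
    show ?thesis
    proof (cases "N = {}")
      case True
      with N(3) show ?thesis by (auto simp: fun_eq_iff)
    next
      case False
      have "C (Max N) \<subseteq> C k" if "k \<in> N" for k using that N(2) by (intro C_mono) simp
      then have "g \<in> vanishing (C (Max N))" using N(3) gG by (fastforce simp: vanishing_def)
      moreover have "Max N < k0" using N(1,2) False Max_in by blast
      ultimately show ?thesis using le leD by blast
    qed
  qed
qed

abbreviation layer :: "'o \<Rightarrow> 'x topology" where
  "layer i \<equiv> subtopology X (C i - C' i)"

abbreviation Cc where "Cc i \<equiv> carrier (Cc_int (layer i))"

lemma layer_eq: "C i - C' i = noncrit (C i)"
  using noncrit_subset by blast

lemma topspace_layer: "topspace (layer i) = noncrit (C i)"
  using closedin_subset[OF closedin_C[of i]] layer_eq noncrit_subset[of "C i"] by auto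

abbreviation res :: "'o \<Rightarrow> ('x \<Rightarrow> int) \<Rightarrow> 'x \<Rightarrow> int" where
  "res i \<equiv> restrict_to (noncrit (C i))"

text \<open>Since \<open>g\<close> vanishes on \<open>C' i\<close>, its support in the layer is the
  trace of \<open>supp g\<close> on the closed set \<open>C i\<close>, hence compact. Local
  constancy comes from the functions that witness noncriticality.\<close>

lemma res_in_Cc:
  assumes "g \<in> vanishing (C' i)"
  shows "res i g \<in> Cc i"
proof (rule carrier_Cc_intI)
  have g: "g \<in> G" using assms by (simp add: vanishing_def)
  let ?L = "{x \<in> topspace (layer i). res i g x \<noteq> 0}"
  have L: "?L = C i \<inter> supp g"
    using assms noncrit_subset[of "C i"] unfolding topspace_layer by (auto simp: vanishing_def)
  show "compactin (layer i) ?L"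
    unfolding compactin_subtopology
  proof
    show "compactin X ?L" unfolding L
      by (rule closed_Int_compactin[OF closedin_C compact_supp[OF g]])
    show "?L \<subseteq> C i - C' i" using topspace_layer layer_eq by auto
  qed
  have "closedin (layer i) ((C i \<inter> supp g) \<inter> (C i - C' i))"
    using closedin_Int[OF closedin_C clopen(2)[OF g]] by (metis closedin_subtopology)
  moreover have "(C i \<inter> supp g) \<inter> (C i - C' i) = ?L"
  proof -
    have "?L \<subseteq> C i - C' i" using topspace_layer[of i] layer_eq[of i] by blast
    then show ?thesis unfolding L by blast
  qed
  ultimately show "closedin (layer i) ?L" by simp
  fix n
  show "openin (layer i) {x \<in> topspace (layer i). res i g x = n}"
  proof (subst openin_subopen, intro ballI)
    fix x assume x: "x \<in> {x \<in> topspace (layer i). res i g x = n}"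
    then obtain e where e: "e \<in> G" "e x = 1" "\<And>y. y \<in> C i \<Longrightarrow> e y \<in> {0, 1}"
      by (auto simp: topspace_layer noncrit_def)
    \<comment> \<open>At points of the layer in this open set \<open>e\<close> is nonzero, hence 1,
      and \<open>g = n * e\<close>; so \<open>g\<close> has the value \<open>n\<close>
      there.\<close>
    let ?U = "supp e - supp (g - zscale n e)"
    have "openin X ?U"
      using e(1) g by (intro openin_diff clopen diff_G scale_G)
    then have "openin (layer i) (?U \<inter> (C i - C' i))" by (auto simp: openin_subtopology)
    moreover have "x \<in> ?U \<inter> (C i - C' i)" using x e(2) by (auto simp: topspace_layer layer_eq)
    moreover have "?U \<inter> (C i - C' i) \<subseteq> {x \<in> topspace (layer i). res i g x = n}"
    proof
      fix y assume y: "y \<in> ?U \<inter> (C i - C' i)"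
      then have "e y = 1" using e(3)[of y] by auto
      moreover have "y \<in> noncrit (C i)" using y layer_eq by blast
      ultimately have "y \<in> noncrit (C i) \<and> res i g y = n" using y by simp
      then show "y \<in> {x \<in> topspace (layer i). res i g x = n}"
        unfolding topspace_layer by blast
    qed
    ultimately show "\<exists>T. openin (layer i) T \<and> x \<in> T \<and> T \<subseteq> {x \<in> topspace (layer i). res i g x = n}"
      by blast
  qed
next
  fix x assume "x \<notin> topspace (layer i)"
  then show "res i g x = 0" unfolding topspace_layer by simp
qed (rule subset_refl)

text \<open>Each point of the layer has a function in \<open>vanishing (C' i)\<close> that is 1
  there, has only the values 0 and 1 on the layer, and whose support in the layer stays inside a
  level set of \<open>f\<close>. Finitely many such supports cover that of \<open>f\<close>; they
  may overlap, so the lift is built by overwriting one support at a time.\<close>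

lemma res_surj:
  assumes f: "f \<in> Cc i"
  shows "\<exists>g\<in>vanishing (C' i). res i g = f"
proof -
  note fE = carrier_Cc_intE[OF f]
  let ?Y = "noncrit (C i)"
  have f0: "f x = 0" if "x \<notin> ?Y" for x using fE(2)[of x] that by (auto simp: topspace_layer)
  have ex: "\<exists>e. e \<in> vanishing (C' i) \<and> e x = 1 \<and> (\<forall>y\<in>?Y. e y = 0 \<or> e y = 1 \<and> f y = f x)" if x: "x \<in> ?Y" for x
  proof -
    have "openin (layer i) {y \<in> topspace (layer i). f y \<in> {f x}}"
      by (rule clopen_level_set[OF fE(1)])
    then obtain U where U: "openin X U" "{y \<in> topspace (layer i). f y \<in> {f x}} = U \<inter> (C i - C' i)"
      by (auto simp: openin_subtopology)
    have UY: "U \<inter> ?Y = {y \<in> ?Y. f y = f x}" using U(2) topspace_layer layer_eq by auto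
    have "openin X (U - C' i)" using U(1) closedin_next by blast
    moreover have "x \<in> U - C' i" using x UY by blast
    ultimately obtain h where h: "h \<in> G" "h x = 1" "supp h \<subseteq> U - C' i"
      by (rule local_unit)
    obtain e where e: "e \<in> G" "e x = 1" "\<And>y. y \<in> C i \<Longrightarrow> e y \<in> {0, 1}"
      using x by (auto simp: noncrit_def)
    let ?e = "restrict_to (supp h) e"
    have "?e \<in> vanishing (C' i)"
      using restrict_supp_G[OF e(1) h(1)] h(3) by (auto simp: vanishing_def)
    moreover have "?e y = 0 \<or> ?e y = 1 \<and> f y = f x" if "y \<in> ?Y" for y
    proof (cases "h y = 0")
      case False
      then have "y \<in> U" using h(3) by blast
      then have "f y = f x" using UY that by blast
      then show ?thesis using e(3)[of y] that noncrit_subset by auto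
    qed simp
    moreover have "?e x = 1" using h(2) e(2) by simp
    ultimately show ?thesis by blast
  qed
  obtain e where "\<forall>x\<in>?Y. e x \<in> vanishing (C' i) \<and> e x x = 1 \<and> (\<forall>y\<in>?Y. e x y = 0 \<or> e x y = 1 \<and> f y = f x)"
    using bchoice[of ?Y "\<lambda>x e. e \<in> vanishing (C' i) \<and> e x = 1 \<and> (\<forall>y\<in>?Y. e y = 0 \<or> e y = 1 \<and> f y = f x)"] ex
    by blast
  then have e: "\<And>x. x \<in> ?Y \<Longrightarrow> e x \<in> vanishing (C' i)" "\<And>x. x \<in> ?Y \<Longrightarrow> e x x = 1"
      "\<And>x y. x \<in> ?Y \<Longrightarrow> y \<in> ?Y \<Longrightarrow> e x y = 0 \<or> e x y = 1 \<and> f y = f x" by blast+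
  have eG: "e x \<in> G" if "x \<in> ?Y" for x using e(1)[OF that] by (simp add: vanishing_def)
  let ?K = "{x \<in> topspace (layer i). f x \<noteq> 0}"
  have "compactin X ?K" using fE(3) by (simp add: compactin_subtopology)
  moreover have "openin X V" if "V \<in> (\<lambda>x. supp (e x)) ` ?K" for V
    using that clopen(1) eG by (auto simp: topspace_layer)
  moreover have "?K \<subseteq> \<Union>((\<lambda>x. supp (e x)) ` ?K)"
    using e(2) by (auto simp: topspace_layer)
  ultimately obtain \<F> where "finite \<F>" "\<F> \<subseteq> (\<lambda>x. supp (e x)) ` ?K" "?K \<subseteq> \<Union>\<F>"
    using compactinD[of X ?K "(\<lambda>x. supp (e x)) ` ?K"] by auto
  moreover from this(1,2) obtain N where "N \<subseteq> ?K" "finite N" "\<F> = (\<lambda>x. supp (e x)) ` N"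
    using finite_subset_image by meson
  ultimately have N: "finite N" "N \<subseteq> ?Y" "?K \<subseteq> (\<Union>x\<in>N. supp (e x))"
    by (auto simp: topspace_layer)
  have "\<exists>g\<in>vanishing (C' i). \<forall>y\<in>?Y. g y = restrict_to (\<Union>x\<in>M. supp (e x)) f y" if "finite M" "M \<subseteq> ?Y" for M
    using that
  proof (induction M rule: finite_induct)
    case empty
    show ?case using zf.subspace_0[OF subspace_vanishing] by (intro bexI[of _ 0]) auto
  next
    case (insert x M)
    then obtain g where g: "g \<in> vanishing (C' i)"
        "\<And>y. y \<in> ?Y \<Longrightarrow> g y = restrict_to (\<Union>x\<in>M. supp (e x)) f y" by blast
    have x: "x \<in> ?Y" using insert.prems by blast
    \<comment> \<open>The old function is erased on \<open>supp (e x)\<close> before the new piece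
      is added; on the layer \<open>e x\<close> is 1 there and \<open>f\<close> has the constant
      value \<open>f x\<close>.\<close>
    let ?g = "restrict_to (- supp (e x)) g + zscale (f x) (e x)"
    have "restrict_to (- supp (e x)) g \<in> vanishing (C' i)"
      using g(1) restrict_compl_supp_G[OF _ eG[OF x]] by (auto simp: vanishing_def)
    then have "?g \<in> vanishing (C' i)"
      using e(1)[OF x] subspace_vanishing by (intro zf.subspace_add zf.subspace_scale)
    moreover have "?g y = restrict_to (\<Union>x\<in>insert x M. supp (e x)) f y" if y: "y \<in> ?Y" for y
      using e(3)[OF x y] g(2)[OF y] by auto
    ultimately show ?case by blast
  qed
  from this[OF N(1,2)] obtain g where g: "g \<in> vanishing (C' i)"
      "\<And>y. y \<in> ?Y \<Longrightarrow> g y = restrict_to (\<Union>x\<in>N. supp (e x)) f y" by blast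
  have "y \<in> (\<Union>x\<in>N. supp (e x))" if "y \<in> ?Y" "f y \<noteq> 0" for y
    using N(3) that unfolding topspace_layer by blast
  then have "res i g y = f y" for y
    using g(2)[of y] f0[of y] by (cases "y \<in> ?Y") auto
  then show ?thesis using g(1) by (intro bexI[of _ g] ext)
qed

lemma res_kernel:
  assumes "g \<in> vanishing (C' i)"
  shows "res i g = 0 \<longleftrightarrow> g \<in> vanishing (C i)"
  using assms noncrit_subset[of "C i"] by (auto simp: vanishing_def fun_eq_iff)

section \<open>Splitting the filtration\<close>

lemma section_exists:
  obtains \<sigma> where "\<And>f. f \<in> Cc i \<Longrightarrow> \<sigma> f \<in> vanishing (C' i)"
    "\<And>f. f \<in> Cc i \<Longrightarrow> res i (\<sigma> f) = f"
    "\<And>f g. f \<in> Cc i \<Longrightarrow> g \<in> Cc i \<Longrightarrow> \<sigma> (f + g) = \<sigma> f + \<sigma> g"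
proof -
  obtain B where B: "B \<subseteq> Cc i" "zf.independent B" "Cc i \<subseteq> zf.span B"
    by (rule Cc_int_free)
  have "\<exists>f\<in>vanishing (C' i). res i f = b" if "b \<in> B" for b using that B(1) res_surj by blast
  from basis_section[OF module_hom_restrict_to subspace_vanishing B(2) this]
  obtain \<sigma> where "\<And>f. f \<in> zf.span B \<Longrightarrow> \<sigma> f \<in> vanishing (C' i)" "\<And>f. f \<in> zf.span B \<Longrightarrow> res i (\<sigma> f) = f"
    "\<And>f g. f \<in> zf.span B \<Longrightarrow> g \<in> zf.span B \<Longrightarrow> \<sigma> (f + g) = \<sigma> f + \<sigma> g" by metis
  then show ?thesis using B(3) by (intro that[of \<sigma>]) (simp_all add: subset_iff)
qed

text \<open>Bases of the layers, lifted to \<open>G\<close>, are collected along the chain. As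
  \<open>C \<alpha>\<close> is empty, the stages below \<alpha> exhaust \<open>G\<close>.\<close>

lemma G_basis:
  obtains B where "zf.independent B" "zf.span B = G"
proof -
  have "\<exists>L. L \<subseteq> vanishing (C' i) \<and> indep_mod (vanishing (C i)) L \<and>
      (\<forall>f \<in> vanishing (C' i). \<exists>g \<in> zf.span L. f - g \<in> vanishing (C i))" for i
  proof -
    obtain B where B: "B \<subseteq> Cc i" "zf.independent B" "Cc i \<subseteq> zf.span B"
      by (rule Cc_int_free)
    have surj: "\<exists>f\<in>vanishing (C' i). res i f = b" if "b \<in> B" for b using that B(1) res_surj by blast
    have ker: "f \<in> vanishing (C i)" if "f \<in> vanishing (C' i)" "res i f = 0" for f
      using that res_kernel by blast
    have ker': "res i f = 0" if "f \<in> vanishing (C i)" for f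
    proof -
      have "f \<in> vanishing (C' i)" using that vanishing_mono[of "C' i" "C i"] by blast
      then show ?thesis using that res_kernel by blast
    qed
    have sp: "res i f \<in> zf.span B" if "f \<in> vanishing (C' i)" for f
      using res_in_Cc[OF that] B(3) by blast
    show ?thesis
      by (rule lift_basis[where C = "vanishing (C i)", OF module_hom_restrict_to subspace_vanishing ker ker' B(2) surj sp])
        blast+
  qed
  then obtain L where L: "\<And>i. L i \<subseteq> vanishing (C' i)" "\<And>i. indep_mod (vanishing (C i)) (L i)"
      "\<And>i f. f \<in> vanishing (C' i) \<Longrightarrow> \<exists>g \<in> zf.span (L i). f - g \<in> vanishing (C i)" by metis
  have mono: "vanishing (C' i) \<subseteq> vanishing (C j)" if "i < j" for i j
    using vanishing_mono[OF C_sub_next[OF that]] .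
  have lim: "f \<in> {0} \<or> (\<exists>j\<in>{..<\<alpha>}. j < i \<and> f \<in> vanishing (C' j))" if "i \<in> {..<\<alpha>}" "f \<in> vanishing (C i)" for f i
    using vanishing_limit[OF that(2)] that(1) by (auto intro: less_trans)
  have zero: "{0} \<subseteq> vanishing (C i)" for i
    using zf.subspace_0[OF subspace_vanishing] by blast
  have total: "i < j \<or> j < i" if "i \<noteq> j" for i j :: 'o using that by (rule linorder_neq_iff[THEN iffD1])
  note fb = filtration_basis[where I = "{..<\<alpha>}" and lt = "(<)" and A = "\<lambda>i. vanishing (C i)" and
      A' = "\<lambda>i. vanishing (C' i)" and B = L and C = "{0}",
      OF wfp_on_less transp_on_less total subspace_vanishing L(1,2,3) mono lim zero]
  show ?thesis
  proof
    show "zf.independent (\<Union>i\<in>{..<\<alpha>}. L i)"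
      using fb(1) by (simp add: indep_mod_0)
    show "zf.span (\<Union>i\<in>{..<\<alpha>}. L i) = G"
    proof
      have "vanishing (C' i) \<subseteq> G" for i by (auto simp: vanishing_def)
      then show "zf.span (\<Union>i\<in>{..<\<alpha>}. L i) \<subseteq> G"
        using L(1) by (intro zf.span_minimal subspace_G) blast
      show "G \<subseteq> zf.span (\<Union>i\<in>{..<\<alpha>}. L i)"
      proof
        fix g assume "g \<in> G"
        then have "g \<in> vanishing (C \<alpha>)" by (simp add: vanishing_def C_alpha_empty)
        then consider "g = 0" | j where "j < \<alpha>" "g \<in> vanishing (C' j)" using vanishing_limit by blast
        then show "g \<in> zf.span (\<Union>i\<in>{..<\<alpha>}. L i)"
        proof cases
          case 2
          then have "g \<in> (\<Union>i\<in>{..<\<alpha>}. vanishing (C' i))" by blast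
          with fb(2) have "g \<in> zf.span (insert 0 (\<Union>i\<in>{..<\<alpha>}. L i))" by auto
          moreover have "zf.span (insert 0 (\<Union>i\<in>{..<\<alpha>}. L i)) \<subseteq> zf.span (\<Union>i\<in>{..<\<alpha>}. L i)"
            by (rule zf.span_minimal) (auto simp: zf.span_zero intro: zf.span_base)
          ultimately show ?thesis by blast
        qed (simp add: zf.span_zero)
      qed
    qed
  qed
qed

lemma carrier_sum_Cc:
  "carrier (sum_group I (\<lambda>i. Cc_int (layer i))) =
    {f \<in> \<Pi>\<^sub>E i\<in>I. Cc i. finite {i \<in> I. f i \<noteq> 0}}"
proof -
  have "\<one>\<^bsub>Cc_int (layer i)\<^esub> = 0" for i by (simp add: Cc_int_def zero_fun_def)
  then show ?thesis
    by (subst carrier_sum_group) (simp_all add: comm_group_Cc_int comm_group.axioms(2))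
qed

lemma mult_Cc_int: "f \<otimes>\<^bsub>Cc_int Y\<^esub> g = f + g"
  by (simp add: Cc_int_def plus_fun_def)

text \<open>The isomorphism adds the sections of all components and is triangular with respect to
  the ordinals. On layer \<open>m\<close> the sections from earlier layers vanish, so the component
  at the greatest index can be read off; this is injectivity. Surjectivity subtracts the section of
  the restriction to a layer \<open>j\<close>: what is left vanishes on all of \<open>C j\<close>
  and is reached by induction.\<close>

theorem sum_group_iso: "sum_group {..<\<alpha>} (\<lambda>i. Cc_int (layer i)) \<cong> fun_group G"
proof -
  let ?S = "sum_group {..<\<alpha>} (\<lambda>i. Cc_int (layer i))"
  have "\<exists>\<sigma>. (\<forall>f \<in> Cc i. \<sigma> f \<in> vanishing (C' i) \<and> res i (\<sigma> f) = f) \<and>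
      (\<forall>f \<in> Cc i. \<forall>g \<in> Cc i. \<sigma> (f + g) = \<sigma> f + \<sigma> g)" for i
    by (rule section_exists[of i]) blast
  then obtain \<sigma> where \<sigma>: "\<And>i f. f \<in> Cc i \<Longrightarrow> \<sigma> i f \<in> vanishing (C' i)"
      "\<And>i f. f \<in> Cc i \<Longrightarrow> res i (\<sigma> i f) = f"
      "\<And>i f g. f \<in> Cc i \<Longrightarrow> g \<in> Cc i \<Longrightarrow> \<sigma> i (f + g) = \<sigma> i f + \<sigma> i g"
    by metis
  have grpC: "group (Cc_int (layer i))" for i by (simp add: comm_group_Cc_int comm_group.axioms(2))
  have Cc0: "0 \<in> Cc i" for i
    using group.is_monoid[OF grpC, THEN monoid.one_closed] by (simp add: Cc_int_def zero_fun_def)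
  have \<sigma>0: "\<sigma> i 0 = 0" for i using \<sigma>(3)[OF Cc0 Cc0, of i] by simp
  define \<Phi> where "\<Phi> f = (\<Sum>i | i < \<alpha> \<and> f i \<noteq> 0. \<sigma> i (f i))" for f
  have ext: "\<Phi> f = (\<Sum>i\<in>T. \<sigma> i (f i))" if "finite T" "{i. i < \<alpha> \<and> f i \<noteq> 0} \<subseteq> T" "T \<subseteq> {..<\<alpha>}" for f T
    unfolding \<Phi>_def by (rule sum.mono_neutral_left) (use that \<sigma>0 in auto)
  have S: "f i \<in> Cc i" "finite {i. i < \<alpha> \<and> f i \<noteq> 0}" "f \<in> extensional {..<\<alpha>}"
    if "f \<in> carrier ?S" "i < \<alpha>" for f i
    using that by (auto simp: carrier_sum_Cc PiE_def)
  have fin: "finite {i. i < \<alpha> \<and> f i \<noteq> 0}" if "f \<in> carrier ?S" for f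
    using that by (auto simp: carrier_sum_Cc)
  have vG: "vanishing S \<subseteq> G" for S by (auto simp: vanishing_def)
  have hom: "\<Phi> \<in> hom ?S (fun_group G)"
  proof (rule homI)
    fix f assume f: "f \<in> carrier ?S"
    have "\<Phi> f \<in> G"
      unfolding \<Phi>_def using S(1)[OF f] \<sigma>(1) vG by (intro zf.subspace_sum[OF subspace_G]) blast
    then show "\<Phi> f \<in> carrier (fun_group G)" by (simp add: fun_group_def)
    fix g assume g: "g \<in> carrier ?S"
    let ?T = "{i. i < \<alpha> \<and> f i \<noteq> 0} \<union> {i. i < \<alpha> \<and> g i \<noteq> 0}"
    have T: "finite ?T" using fin f g by simp
    have "\<Phi> (f \<otimes>\<^bsub>?S\<^esub> g) = (\<Sum>i\<in>?T. \<sigma> i ((f \<otimes>\<^bsub>?S\<^esub> g) i))"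
      by (rule ext[OF T]) (auto simp: mult_Cc_int)
    also have "\<dots> = (\<Sum>i\<in>?T. \<sigma> i (f i) + \<sigma> i (g i))"
      using S(1)[OF f] S(1)[OF g] by (intro sum.cong) (auto simp: mult_Cc_int \<sigma>(3))
    also have "\<dots> = \<Phi> f + \<Phi> g"
    proof -
      have "?T \<subseteq> {..<\<alpha>}" by blast
      then show ?thesis using ext[OF T, of f] ext[OF T, of g] by (simp add: sum.distrib)
    qed
    finally show "\<Phi> (f \<otimes>\<^bsub>?S\<^esub> g) = \<Phi> f \<otimes>\<^bsub>fun_group G\<^esub> \<Phi> g" by (simp add: fun_group_def)
  qed
  have grpS: "group ?S" using grpC by simp
  interpret group_hom ?S "fun_group G" \<Phi>
    by (simp add: group_hom_def group_hom_axioms_def grpS group_fun_group[OF subspace_G] hom)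
  have "f = \<one>\<^bsub>?S\<^esub>" if f: "f \<in> carrier ?S" "\<Phi> f = 0" for f
  proof -
    let ?T = "{i. i < \<alpha> \<and> f i \<noteq> 0}"
    have "?T = {}"
    proof (rule ccontr)
      assume "?T \<noteq> {}"
      then have m: "Max ?T \<in> ?T" using fin[OF f(1)] by (rule Max_in[rotated])
      let ?m = "Max ?T"
      have fm: "f ?m \<in> Cc ?m" using S(1)[OF f(1)] m by blast
      have "f ?m y = 0" for y
      proof (cases "y \<in> noncrit (C ?m)")
        case True
        have "\<sigma> i (f i) y = 0" if i: "i \<in> ?T - {?m}" for i
        proof -
          have "i < ?m" using i Max_ge[OF fin[OF f(1)], of i] by auto
          then have "y \<in> C' i" using C_sub_next[of i ?m] True noncrit_subset by blast
          then show ?thesis using \<sigma>(1)[OF S(1)[OF f(1)], of i] i by (auto simp: vanishing_def)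
        qed
        then have "(\<Sum>i\<in>?T - {?m}. \<sigma> i (f i) y) = 0" by (intro sum.neutral) blast
        moreover have "\<Phi> f y = (\<Sum>i\<in>?T. \<sigma> i (f i) y)"
          unfolding \<Phi>_def by (rule sum_fun_apply)
        moreover have "\<dots> = \<sigma> ?m (f ?m) y + (\<Sum>i\<in>?T - {?m}. \<sigma> i (f i) y)"
          by (rule sum.remove[OF fin[OF f(1)] m])
        ultimately have "\<Phi> f y = \<sigma> ?m (f ?m) y" by linarith
        also have "\<dots> = f ?m y" using fun_cong[OF \<sigma>(2)[OF fm], of y] True by (simp only: restrict_to_apply if_True)
        finally show ?thesis using f(2) by simp
      next
        case False
        then show ?thesis using carrier_Cc_intE(2)[OF fm] by (simp add: topspace_layer)
      qed
      then show False using m by (auto simp: fun_eq_iff)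
    qed
    then have "f i = \<one>\<^bsub>?S\<^esub> i" for i
    proof (cases "i < \<alpha>")
      case True
      then have "f i = 0" using \<open>?T = {}\<close> by blast
      with True show ?thesis by (simp add: Cc_int_def zero_fun_def)
    next
      case False
      then have "f i = undefined"
        using f(1) unfolding carrier_sum_Cc PiE_def extensional_def by simp
      with False show ?thesis by simp
    qed
    then show ?thesis by blast
  qed
  then have inj: "inj_on \<Phi> (carrier ?S)"
    unfolding inj_on_one_iff by (auto simp: fun_group_def)
  have surj: "g \<in> \<Phi> ` carrier ?S" if "i \<le> \<alpha>" "g \<in> vanishing (C i)" for g i
    using that
  proof (induction i arbitrary: g rule: less_induct)
    case (less i)
    consider "g = 0" | j where "j < i" "g \<in> vanishing (C' j)" using vanishing_limit[OF less.prems(2)] by blast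
    then show ?case
    proof cases
      case 1
      have "\<Phi> \<one>\<^bsub>?S\<^esub> = 0" using hom_one by (simp add: fun_group_def)
      with 1 have "g = \<Phi> \<one>\<^bsub>?S\<^esub>" by (simp only:)
      then show ?thesis using G.one_closed by (rule image_eqI)
    next
      case (2 j)
      then have j: "j < \<alpha>" using less.prems(1) by simp
      let ?f = "res j g"
      have f: "?f \<in> Cc j" by (rule res_in_Cc[OF 2(2)])
      have "g - \<sigma> j ?f \<in> vanishing (C' j)"
        by (rule zf.subspace_diff[OF subspace_vanishing 2(2) \<sigma>(1)[OF f]])
      moreover have "res j (g - \<sigma> j ?f) = 0"
        unfolding module_hom.diff[OF module_hom_restrict_to] \<sigma>(2)[OF f] by simp
      ultimately have "g - \<sigma> j ?f \<in> vanishing (C j)" using res_kernel by blast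
      then have "g - \<sigma> j ?f \<in> \<Phi> ` carrier ?S"
        by (rule less.IH[OF 2(1) less_imp_le[OF j]])
      then obtain h where h: "h \<in> carrier ?S" "\<Phi> h = g - \<sigma> j ?f"
        by (rule imageE) simp
      \<comment> \<open>The family with the single component \<open>?f\<close>; off the index set it
        is \<open>undefined\<close>, as members of \<open>sum_group\<close> are extensional.\<close>
      let ?s = "\<lambda>k\<in>{..<\<alpha>}. if k = j then ?f else 0"
      have "{k \<in> {..<\<alpha>}. ?s k \<noteq> 0} \<subseteq> {j}" by auto
      then have s: "?s \<in> carrier ?S"
        using f Cc0 finite_subset[of _ "{j}"] by (auto simp: carrier_sum_Cc)
      have "\<Phi> ?s = (\<Sum>i\<in>{j}. \<sigma> i (?s i))" by (rule ext) (use j in auto)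
      then have "\<Phi> (?s \<otimes>\<^bsub>?S\<^esub> h) = g"
        using hom_mult[OF s h(1)] h(2) j by (simp add: fun_group_def)
      then have "g = \<Phi> (?s \<otimes>\<^bsub>?S\<^esub> h)" by (rule sym)
      then show ?thesis using G.m_closed[OF s h(1)] by (rule image_eqI)
    qed
  qed
  have "\<Phi> ` carrier ?S = G"
  proof
    show "\<Phi> ` carrier ?S \<subseteq> G" using hom by (auto simp: hom_def fun_group_def)
    show "G \<subseteq> \<Phi> ` carrier ?S"
      using surj[OF order_refl] by (auto simp: vanishing_def C_alpha_empty)
  qed
  then have "\<Phi> \<in> iso ?S (fun_group G)"
    using hom inj by (simp add: iso_def bij_betw_def fun_group_def)
  then show ?thesis by (rule is_isoI)
qed

end

section \<open>Discrete valuation rings\<close>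

text \<open>Closure under negatives follows from -1 in \<open>T\<close> and closure under
  multiples.\<close>

lemma (in ring) subring_idealI:
  assumes R: "subring T R" and J: "J \<subseteq> T" "\<zero> \<in> J"
    and add: "\<And>a b. a \<in> J \<Longrightarrow> b \<in> J \<Longrightarrow> a \<oplus> b \<in> J"
    and mult: "\<And>r a. r \<in> T \<Longrightarrow> a \<in> J \<Longrightarrow> r \<otimes> a \<in> J" "\<And>r a. r \<in> T \<Longrightarrow> a \<in> J \<Longrightarrow> a \<otimes> r \<in> J"
  shows "ideal J (R\<lparr>carrier := T\<rparr>)"
proof -
  interpret T: ring "R\<lparr>carrier := T\<rparr>" by (rule subring_is_ring[OF R])
  have TR: "T \<subseteq> carrier R" using subringE(1)[OF R] .
  show ?thesis
  proof (rule idealI)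
    show "subgroup J (add_monoid (R\<lparr>carrier := T\<rparr>))"
    proof (rule T.add.subgroupI)
      fix a assume a: "a \<in> J"
      have "\<ominus>\<^bsub>R\<lparr>carrier := T\<rparr>\<^esub> a = \<ominus> a"
        by (rule T.minus_equality) (use a J TR subringE(5)[OF R] in \<open>auto simp: l_neg\<close>)
      also have "\<ominus> a = (\<ominus> \<one>) \<otimes> a"
        using a J TR by (auto simp: l_minus)
      also have "\<dots> \<in> J" using a subringE(3,5)[OF R] by (intro mult) auto
      finally show "\<ominus>\<^bsub>R\<lparr>carrier := T\<rparr>\<^esub> a \<in> J" .
    qed (use J add in auto)
  qed (use mult T.ring_axioms in auto)
qed

lemma (in field) field_inv:
  assumes "a \<in> carrier R" "a \<noteq> \<zero>"
  shows "inv a \<in> carrier R" "inv a \<otimes> a = \<one>" "a \<otimes> inv a = \<one>" "inv a \<noteq> \<zero>"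
proof -
  have "a \<in> Units R" using assms field_Units by simp
  then show "inv a \<in> carrier R" "inv a \<otimes> a = \<one>" "a \<otimes> inv a = \<one>" by simp_all
  then show "inv a \<noteq> \<zero>" using assms by force
qed

lemma (in field) field_inv_mult:
  assumes "a \<in> carrier R" "a \<noteq> \<zero>" "b \<in> carrier R" "b \<noteq> \<zero>"
  shows "inv (a \<otimes> b) = inv a \<otimes> inv b"
proof (rule comm_inv_char)
  have "a \<otimes> b \<otimes> (inv a \<otimes> inv b) = (a \<otimes> inv a) \<otimes> (b \<otimes> inv b)"
    using assms field_inv(1) by (simp add: m_ac)
  then show "a \<otimes> b \<otimes> (inv a \<otimes> inv b) = \<one>" using assms field_inv(3) by simp
qed (use assms field_inv(1) in auto)

text \<open>The generator \<open>t\<close> of the maximal ideal divides every nonunit, and each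
  nonzero element of \<open>R\<close> is a unit times a power of \<open>t\<close>. The exponent
  extends to fractions as a difference. The value at zero is left open.\<close>

lemma dvr_valuation:
  fixes K (structure)
  assumes "field K" and RK: "R \<subseteq> carrier K" and dvr: "discrete_valuation_ring (K\<lparr>carrier := R\<rparr>)"
    and frac: "\<And>x. x \<in> carrier K \<Longrightarrow> \<exists>a\<in>R. \<exists>b\<in>R - {\<zero>}. x = a \<otimes> inv b"
  obtains v :: "'a \<Rightarrow> int"
  where "\<And>x y. x \<in> carrier K - {\<zero>} \<Longrightarrow> y \<in> carrier K - {\<zero>} \<Longrightarrow> v (x \<otimes> y) = v x + v y"
    "\<And>x. x \<in> carrier K - {\<zero>} \<Longrightarrow> x \<in> R \<longleftrightarrow> 0 \<le> v x"
    "\<exists>t \<in> carrier K - {\<zero>}. v t = 1"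
proof -
  interpret field K by fact
  let ?R = "K\<lparr>carrier := R\<rparr>"
  interpret R: principal_domain ?R using dvr by (simp add: discrete_valuation_ring_def)
  have sub: "subring R K" using ring_incl_imp_subring[OF RK R.ring_axioms] .
  note RE = subringE[OF sub]
  have K: "a \<in> carrier K" if "a \<in> R" for a using that RK by blast
  have nz: "a \<otimes> b \<noteq> \<zero>" if "a \<in> carrier K" "b \<in> carrier K" "a \<noteq> \<zero>" "b \<noteq> \<zero>" for a b
    using integral that by blast
  note inv = field_inv
  obtain M where M: "maximalideal M ?R" "\<And>N. maximalideal N ?R \<Longrightarrow> N = M"
    using dvr unfolding discrete_valuation_ring_def by blast
  interpret M: maximalideal M ?R by (rule M(1))
  obtain t where t: "t \<in> R" "M = PIdl\<^bsub>?R\<^esub> t"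
    using R.exists_gen[OF M.is_ideal] by auto
  have tM: "t \<in> M" using R.cgenideal_self[of t] t by simp
  have one_M: "\<one> \<notin> M" using M.one_imp_carrier M.I_notcarr by auto
  have nonunit: "\<exists>b\<in>R. a = b \<otimes> t" if a: "a \<in> R" "a \<noteq> \<zero>" "inv a \<notin> R" for a
  proof -
    have "ideal (PIdl\<^bsub>?R\<^esub> a) ?R" using a by (intro R.cgenideal_ideal) simp
    moreover have "\<one> \<notin> PIdl\<^bsub>?R\<^esub> a"
    proof
      assume "\<one> \<in> PIdl\<^bsub>?R\<^esub> a"
      then obtain x where x: "x \<in> R" "\<one> = x \<otimes> a" by (auto simp: cgenideal_def)
      then have "inv a = x" using a K by (metis comm_inv_char m_comm)
      with x a show False by simp
    qed
    then have "PIdl\<^bsub>?R\<^esub> a \<noteq> carrier ?R" using RE(3) by auto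
    ultimately obtain N where "maximalideal N ?R" "PIdl\<^bsub>?R\<^esub> a \<subseteq> N"
      by (rule R.proper_ideal_subset_maximalideal)
    then have "a \<in> M" using M(2) R.cgenideal_self[of a] a by auto
    then show ?thesis using t(2) by (auto simp: cgenideal_def)
  qed
  \<comment> \<open>If \<open>t\<close> were zero, every nonzero element would be a unit, against
    the exclusion of fields.\<close>
  have t0: "t \<noteq> \<zero>"
  proof
    assume "t = \<zero>"
    then have "inv a \<in> R" if "a \<in> R" "a \<noteq> \<zero>" for a using nonunit[of a] that K by auto
    then have "Units ?R = carrier ?R - {\<zero>\<^bsub>?R\<^esub>}"
      using inv K by (auto simp: Units_def) (metis one_not_zero r_null)
    then have "field ?R" by (rule R.cring_fieldI)
    then show False using dvr by (simp add: discrete_valuation_ring_def)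
  qed
  have t_unit: "x \<otimes> t \<noteq> \<one>" if "x \<in> R" for x
    using M.I_l_closed[OF tM, of x] that one_M by auto
  have tn: "t [^] (n::nat) \<in> R" "t [^] (n::nat) \<noteq> \<zero>" for n
    by (induction n) (use RE t t0 nz K in auto)
  have bounded: "\<exists>n. \<forall>b\<in>R. a \<noteq> b \<otimes> t [^] Suc n" if a: "a \<in> R" "a \<noteq> \<zero>" for a
  proof -
    \<comment> \<open>\<open>J\<close> is the union of the ascending ideals of all \<open>y\<close>
      for which \<open>y * t^n\<close> is a multiple of \<open>a\<close>. A generator
      \<open>c\<close> lies in one of them, which fixes \<open>n\<close>. If \<open>t^(n+1)\<close>
      divided \<open>a\<close>, the quotient would be a multiple of \<open>c\<close>, and cancelling
      \<open>a\<close> would make \<open>t\<close> a unit.\<close>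
    define J where "J = {y\<in>R. \<exists>n::nat. \<exists>r\<in>R. y \<otimes> t [^] n = r \<otimes> a}"
    have "ideal J ?R"
    proof (rule subring_idealI[OF sub])
      show "J \<subseteq> R" by (auto simp: J_def)
      show "\<zero> \<in> J" using RE(2) a K tn by (auto simp: J_def intro!: bexI[of _ \<zero>])
      fix x y assume "x \<in> J" "y \<in> J"
      then obtain n m r s where *: "x \<in> R" "y \<in> R" "r \<in> R" "s \<in> R" "x \<otimes> t [^] (n::nat) = r \<otimes> a" "y \<otimes> t [^] (m::nat) = s \<otimes> a"
        by (auto simp: J_def)
      have "(x \<oplus> y) \<otimes> t [^] (n + m) = (x \<otimes> t [^] n) \<otimes> t [^] m \<oplus> (y \<otimes> t [^] m) \<otimes> t [^] n"
        using *(1-4) K tn t(1) by (simp add: nat_pow_mult[symmetric] l_distr r_distr m_ac)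
      also have "\<dots> = (r \<otimes> t [^] m \<oplus> s \<otimes> t [^] n) \<otimes> a"
        unfolding *(5,6) using *(1-4) K tn a by (simp add: l_distr r_distr m_ac)
      finally show "x \<oplus> y \<in> J"
        using * RE(6,7) tn by (auto simp: J_def intro!: exI[of _ "n + m"] bexI[of _ "r \<otimes> t [^] m \<oplus> s \<otimes> t [^] n"])
    next
      fix r x assume rx: "r \<in> R" "x \<in> J"
      then obtain n s where *: "x \<in> R" "s \<in> R" "x \<otimes> t [^] (n::nat) = s \<otimes> a"
        by (auto simp: J_def)
      have "(r \<otimes> x) \<otimes> t [^] n = (r \<otimes> s) \<otimes> a" using * rx K tn a by (simp add: m_assoc)
      then show "r \<otimes> x \<in> J" using * rx RE(6) by (auto simp: J_def intro!: exI[of _ n] bexI[of _ "r \<otimes> s"])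
      then show "x \<otimes> r \<in> J" using * rx K m_comm by metis
    qed
    then obtain c where c: "c \<in> R" "J = PIdl\<^bsub>?R\<^esub> c" using R.exists_gen by auto
    have "c \<in> J" using R.cgenideal_self[of c] c by simp
    then obtain n r where r: "r \<in> R" "c \<otimes> t [^] (n::nat) = r \<otimes> a" by (auto simp: J_def)
    have "a \<noteq> b \<otimes> t [^] Suc n" if b: "b \<in> R" for b
    proof
      assume ab: "a = b \<otimes> t [^] Suc n"
      then have "b \<in> J" using b RE(3) a K unfolding J_def by (auto intro!: exI[of _ "Suc n"] bexI[of _ \<one>])
      then obtain s where s: "s \<in> R" "b = s \<otimes> c" using c(2) by (auto simp: cgenideal_def)
      have "a = s \<otimes> (c \<otimes> t [^] n) \<otimes> t"
        unfolding ab s(2) using s c K tn t(1) by (simp add: m_assoc)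
      also have "\<dots> = (s \<otimes> r \<otimes> t) \<otimes> a"
        unfolding r(2) using s r a t(1) K by (simp add: m_ac)
      finally have "(s \<otimes> r \<otimes> t) \<otimes> a = \<one> \<otimes> a" using a K by simp
      then have "s \<otimes> r \<otimes> t = \<one>"
        using m_rcancel[OF a(2), of "s \<otimes> r \<otimes> t" \<one>] s r a t(1) K by simp
      then show False using t_unit[of "s \<otimes> r"] s r RE(6) by blast
    qed
    then show ?thesis by blast
  qed
  define U where "U = {u\<in>R. u \<noteq> \<zero> \<and> inv u \<in> R}"
  have UK: "u \<in> carrier K" "u \<noteq> \<zero>" "u \<in> R" "inv u \<in> R" if "u \<in> U" for u using that K by (auto simp: U_def)
  have U_mult: "u \<otimes> u' \<in> U" if "u \<in> U" "u' \<in> U" for u u'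
  proof -
    have "inv (u \<otimes> u') = inv u \<otimes> inv u'"
      using UK that by (intro field_inv_mult) auto
    then show ?thesis using that RE(6) nz[of u u'] K by (auto simp: U_def)
  qed
  have decomp: "\<exists>n. \<exists>u\<in>U. a = u \<otimes> t [^] (n::nat)" if a: "a \<in> R" "a \<noteq> \<zero>" for a
  proof -
    let ?P = "\<lambda>n. \<exists>b\<in>R. a = b \<otimes> t [^] (n::nat)"
    obtain N where N: "\<not> ?P (Suc N)" using bounded[OF a] by blast
    have P0: "?P 0" using a K by (auto intro!: bexI[of _ a])
    have "\<exists>n. ?P n \<and> \<not> ?P (Suc n)"
    proof (rule ccontr)
      assume no: "\<nexists>n. ?P n \<and> \<not> ?P (Suc n)"
      have "?P n" for n
      proof (induction n)
        case (Suc n)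
        then show ?case using no by blast
      qed (rule P0)
      with N show False by blast
    qed
    then obtain n where n: "?P n" "\<not> ?P (Suc n)" by blast
    then obtain b where b: "b \<in> R" "a = b \<otimes> t [^] n" by blast
    have b0: "b \<noteq> \<zero>" using b a K tn by auto
    have "inv b \<in> R"
    proof (rule ccontr)
      assume "inv b \<notin> R"
      then obtain c where c: "c \<in> R" "b = c \<otimes> t" using nonunit b b0 by blast
      then have "a = c \<otimes> t [^] Suc n" unfolding b(2) using K t(1) tn by (simp add: m_ac)
      then show False using n(2) c by blast
    qed
    then have "b \<in> U" using b b0 by (simp add: U_def)
    then show ?thesis using b by blast
  qed
  have less: False if u: "u \<in> U" "u' \<in> U" "n < m" "u \<otimes> t [^] (n::nat) = u' \<otimes> t [^] m" for u u' n m
  proof -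
    obtain k where k: "m = Suc k + n" using u(3) by (metis add.commute add_Suc_right less_imp_Suc_add)
    have "u \<otimes> t [^] n = (u' \<otimes> t [^] Suc k) \<otimes> t [^] n"
      unfolding u(4) k using UK u t(1) K tn by (simp add: nat_pow_mult[symmetric] m_ac)
    then have "u = u' \<otimes> t [^] Suc k"
      using m_rcancel[OF tn(2)[of n]] UK u K tn t(1) by (metis m_closed)
    then have "inv u \<otimes> u = (inv u \<otimes> u' \<otimes> t [^] k) \<otimes> t"
      using UK u K tn t(1) inv by (simp add: m_assoc)
    then have "(inv u \<otimes> u' \<otimes> t [^] k) \<otimes> t = \<one>" using inv UK u by simp
    moreover have "inv u \<otimes> u' \<otimes> t [^] k \<in> R"
      using UK(4)[OF u(1)] UK(3)[OF u(2)] tn(1) by (intro RE(6))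
    ultimately show False using t_unit by blast
  qed
  have unique: "n = m" if "u \<in> U" "u' \<in> U" "u \<otimes> t [^] (n::nat) = u' \<otimes> t [^] (m::nat)" for u u' n m
    using less[of u u' n m] less[of u' u m n] that by (metis linorder_neqE_nat)
  obtain w where w: "\<And>a. a \<in> R \<Longrightarrow> a \<noteq> \<zero> \<Longrightarrow> \<exists>u\<in>U. a = u \<otimes> t [^] (w a :: nat)"
    using decomp by metis
  have w_eq: "w (u \<otimes> t [^] n) = n" if u: "u \<in> U" for u n
  proof -
    have "u \<otimes> t [^] n \<in> R" "u \<otimes> t [^] n \<noteq> \<zero>" using UK[OF u] tn RE(6) nz K by auto
    from w[OF this] show ?thesis using unique[OF u] by metis
  qed
  have w_mult: "w (a \<otimes> b) = w a + w b" if ab: "a \<in> R" "a \<noteq> \<zero>" "b \<in> R" "b \<noteq> \<zero>" for a b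
  proof -
    obtain u u' where u: "u \<in> U" "u' \<in> U" "a = u \<otimes> t [^] w a" "b = u' \<otimes> t [^] w b"
      using w ab by metis
    have "a \<otimes> b = (u \<otimes> t [^] w a) \<otimes> (u' \<otimes> t [^] w b)" using u by simp
    also have "\<dots> = (u \<otimes> u') \<otimes> t [^] (w a + w b)"
      using UK u(1,2) t(1) K tn by (simp add: nat_pow_mult[symmetric] m_ac)
    finally show ?thesis using w_eq[OF U_mult[OF u(1,2)]] by simp
  qed
  have one_U: "\<one> \<in> U" using RE(3) by (simp add: U_def)
  have "\<exists>a b. a \<in> R \<and> b \<in> R \<and> b \<noteq> \<zero> \<and> x = a \<otimes> inv b" if "x \<in> carrier K" for x
    using frac[OF that] by blast
  then obtain A B where AB: "\<And>x. x \<in> carrier K \<Longrightarrow> A x \<in> R \<and> B x \<in> R \<and> B x \<noteq> \<zero> \<and> x = A x \<otimes> inv (B x)"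
    by metis
  \<comment> \<open>The definition uses one chosen fraction for each element; the fact that follows
    shows that every other fraction gives the same difference.\<close>
  define v where "v x = int (w (A x)) - int (w (B x))" for x
  have v: "v x = int (w a) - int (w b)" if x: "x \<in> carrier K" "x \<noteq> \<zero>" "x \<otimes> b = a" "a \<in> R" "b \<in> R" "b \<noteq> \<zero>" for x a b
  proof -
    note ABx = AB[OF x(1)]
    have "x \<otimes> B x = A x \<otimes> (inv (B x) \<otimes> B x)"
      using ABx K inv x(1) by (metis m_assoc)
    then have xB: "x \<otimes> B x = A x" using ABx inv[of "B x"] K by simp
    have a0: "a \<noteq> \<zero>" "A x \<noteq> \<zero>" using nz[of x b] nz[of x "B x"] x ABx K xB by auto
    have "a \<otimes> B x = A x \<otimes> b"
      unfolding x(3)[symmetric] using xB x ABx K by (metis m_assoc m_comm)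
    then have "w a + w (B x) = w (A x) + w b" using w_mult a0 ABx x by metis
    then show ?thesis by (simp add: v_def)
  qed
  show ?thesis
  proof
    fix x y assume xy: "x \<in> carrier K - {\<zero>}" "y \<in> carrier K - {\<zero>}"
    obtain a b where a: "a \<in> R" "b \<in> R" "b \<noteq> \<zero>" "x \<otimes> b = a"
      using AB[of x] xy inv K by (metis DiffD1 m_assoc r_one)
    obtain c d where c: "c \<in> R" "d \<in> R" "d \<noteq> \<zero>" "y \<otimes> d = c"
      using AB[of y] xy inv K by (metis DiffD1 m_assoc r_one)
    have "(x \<otimes> y) \<otimes> (b \<otimes> d) = (x \<otimes> b) \<otimes> (y \<otimes> d)"
      using xy a(2) c(2) K by (simp add: m_ac)
    then have "v (x \<otimes> y) = int (w (a \<otimes> c)) - int (w (b \<otimes> d))"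
      using xy a c K nz RE(6) by (intro v) auto
    moreover have "a \<noteq> \<zero>" "c \<noteq> \<zero>" using nz[of x b] nz[of y d] a c xy K by auto
    ultimately show "v (x \<otimes> y) = v x + v y"
      using v[of x b a] v[of y d c] a c xy by (simp add: w_mult)
  next
    fix x assume x: "x \<in> carrier K - {\<zero>}"
    obtain a b where a: "a \<in> R" "b \<in> R" "b \<noteq> \<zero>" "x \<otimes> b = a"
      using AB[of x] x inv K by (metis DiffD1 m_assoc r_one)
    have a0: "a \<noteq> \<zero>" using nz[of x b] a x K by auto
    show "x \<in> R \<longleftrightarrow> 0 \<le> v x"
    proof
      assume "x \<in> R"
      then have "v x = int (w x) - int (w \<one>)" using x RE(3) by (intro v) auto
      then show "0 \<le> v x" using w_eq[OF one_U, of 0] by simp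
    next
      assume "0 \<le> v x"
      then have "w b \<le> w a" using v[of x b a] x a by simp
      then obtain k where k: "w a = k + w b" by (metis add.commute le_Suc_ex)
      obtain u u' where u: "u \<in> U" "u' \<in> U" "a = u \<otimes> t [^] w a" "b = u' \<otimes> t [^] w b"
        using w a a0 by metis
      have iu: "inv u' \<in> carrier K" "inv u' \<otimes> u' = \<one>" using inv[of u'] UK(1,2)[OF u(2)] by simp_all
      define tb where "tb = t [^] w b"
      have tb: "b = u' \<otimes> tb" "tb \<in> carrier K" using u(4) tn K by (simp_all add: tb_def)
      have uk: "u \<in> carrier K" "u' \<in> carrier K" "t [^] k \<in> carrier K" using UK u(1,2) tn K by simp_all
      have "(u \<otimes> inv u' \<otimes> t [^] k) \<otimes> b = (u \<otimes> t [^] k \<otimes> tb) \<otimes> (inv u' \<otimes> u')"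
        using uk iu(1) tb(2) by (simp add: tb(1) m_ac)
      also have "\<dots> = u \<otimes> t [^] (k + w b)"
        using uk iu(2) t(1) K tn(1) by (simp add: tb_def nat_pow_mult[symmetric] m_assoc)
      also have "\<dots> = a" using u(3) k by simp
      finally have "(u \<otimes> inv u' \<otimes> t [^] k) \<otimes> b = x \<otimes> b" using a(4) by simp
      then have "u \<otimes> inv u' \<otimes> t [^] k = x"
        using m_rcancel[OF a(3)] a x UK u iu K tn by (metis DiffD1 m_closed)
      then show "x \<in> R" using UK[OF u(1)] UK[OF u(2)] tn RE(6) by blast
    qed
  next
    have "v t = int (w t) - int (w \<one>)" using t t0 K RE(3) by (intro v) auto
    moreover have "w t = 1" using w_eq[OF one_U, of 1] t K by simp
    moreover have "w \<one> = 0" using w_eq[OF one_U, of 0] by simp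
    ultimately show "\<exists>t \<in> carrier K - {\<zero>}. v t = 1" using t t0 K by auto
  qed
qed

section \<open>The valuations of an almost Dedekind domain\<close>

lemma ideal_prod_mono: "A \<subseteq> A' \<Longrightarrow> B \<subseteq> B' \<Longrightarrow> ideal_prod K A B \<subseteq> ideal_prod K A' B'"
proof
  fix x assume "A \<subseteq> A'" "B \<subseteq> B'" "x \<in> ideal_prod K A B"
  from this(3,1,2) show "x \<in> ideal_prod K A' B'"
    by (induction rule: ideal_prod.induct) (auto intro: ideal_prod.intros)
qed

lemma ideal_prod_finite:
  assumes "x \<in> ideal_prod K I J"
  obtains A B where "finite A" "A \<subseteq> I" "finite B" "B \<subseteq> J" "x \<in> ideal_prod K A B"
proof -
  from assms have "\<exists>A B. finite A \<and> A \<subseteq> I \<and> finite B \<and> B \<subseteq> J \<and> x \<in> ideal_prod K A B"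
  proof (induction rule: ideal_prod.induct)
    case (prod i j)
    then show ?case
      by (intro exI[of _ "{i}"] exI[of _ "{j}"]) (auto intro: ideal_prod.intros)
  next
    case (sum x y)
    then obtain A B A' B' where *: "finite A" "A \<subseteq> I" "finite B" "B \<subseteq> J" "x \<in> ideal_prod K A B"
      "finite A'" "A' \<subseteq> I" "finite B'" "B' \<subseteq> J" "y \<in> ideal_prod K A' B'" by blast
    have "x \<in> ideal_prod K (A \<union> A') (B \<union> B')" "y \<in> ideal_prod K (A \<union> A') (B \<union> B')"
      using *(5,10) ideal_prod_mono[of A "A \<union> A'" B "B \<union> B'" K] ideal_prod_mono[of A' "A \<union> A'" B' "B \<union> B'" K] by blast+
    then show ?case
      using * by (intro exI[of _ "A \<union> A'"] exI[of _ "B \<union> B'"]) (auto intro: ideal_prod.intros)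
  qed
  then show ?thesis using that by blast
qed

locale almost_dedekind_domain = field K for K (structure) +
  fixes D :: "'a set"
  assumes almost_Dedekind: "almost_Dedekind K D"
begin

lemma quotient_field: "is_quotient_field K D"
  using almost_Dedekind by (simp add: almost_Dedekind_def)

lemma subring_D: "subring D K"
  using quotient_field by (simp add: is_quotient_field_def)

lemmas DE = subringE[OF subring_D]

lemma D_carrier: "a \<in> D \<Longrightarrow> a \<in> carrier K"
  using DE(1) by blast

abbreviation DR where "DR \<equiv> K\<lparr>carrier := D\<rparr>"

abbreviation Ms where "Ms \<equiv> Max_ideals K D"

lemma cring_DR: "cring DR"
  using subcring_iff[OF DE(1)] subcringI'[OF subring_D] by simp

lemma MsD:
  assumes "M \<in> Ms"
  shows "maximalideal M DR" "M \<subseteq> D" "\<zero> \<in> M" "\<one> \<notin> M"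
proof -
  show M: "maximalideal M DR" using assms by (simp add: Max_ideals_def)
  have I: "ideal M DR" using M by (rule maximalideal.axioms(1))
  show "M \<subseteq> D" using ideal.Icarr[OF I] by auto
  show "\<zero> \<in> M" using additive_subgroup.zero_closed[OF ideal.axioms(1)[OF I]] by simp
  show "\<one> \<notin> M" using ideal.one_imp_carrier[OF I] maximalideal.I_notcarr[OF M] by auto
qed

lemma D_subset_localization:
  assumes "M \<in> Ms"
  shows "D \<subseteq> localization_at K D M"
proof
  fix a assume a: "a \<in> D"
  then have "a = a \<otimes> inv \<one>" using D_carrier by simp
  then show "a \<in> localization_at K D M"
    unfolding localization_at_def using a MsD(4)[OF assms] DE(3) by blast
qed

lemma localization_carrier:
  assumes "M \<in> Ms"
  shows "localization_at K D M \<subseteq> carrier K"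
proof
  fix x assume "x \<in> localization_at K D M"
  then obtain a s where as: "x = a \<otimes> inv s" "a \<in> D" "s \<in> D" "s \<notin> M"
    by (auto simp: localization_at_def)
  then have "s \<noteq> \<zero>" using MsD(3)[OF assms] by auto
  then show "x \<in> carrier K" using as field_inv(1)[of s] D_carrier by simp
qed

lemma fraction: "x \<in> carrier K \<Longrightarrow> \<exists>a\<in>D. \<exists>b\<in>D - {\<zero>}. x = a \<otimes> inv b"
  using quotient_field unfolding is_quotient_field_def by blast

definition val :: "'a set \<Rightarrow> 'a \<Rightarrow> int" where
  "val M = (SOME v. (\<forall>x\<in>carrier K - {\<zero>}. \<forall>y\<in>carrier K - {\<zero>}. v (x \<otimes> y) = v x + v y) \<and>
     (\<forall>x\<in>carrier K - {\<zero>}. x \<in> localization_at K D M \<longleftrightarrow> 0 \<le> v x) \<and>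
     (\<exists>t\<in>carrier K - {\<zero>}. v t = 1))"

lemma dvr_localization:
  "M \<in> Ms \<Longrightarrow> discrete_valuation_ring (K\<lparr>carrier := localization_at K D M\<rparr>)"
  using almost_Dedekind by (simp add: almost_Dedekind_def)

lemma val:
  assumes "M \<in> Ms"
  shows val_mult: "\<And>x y. x \<in> carrier K \<Longrightarrow> x \<noteq> \<zero> \<Longrightarrow> y \<in> carrier K \<Longrightarrow> y \<noteq> \<zero> \<Longrightarrow> val M (x \<otimes> y) = val M x + val M y"
    and val_localization: "\<And>x. x \<in> carrier K \<Longrightarrow> x \<noteq> \<zero> \<Longrightarrow> x \<in> localization_at K D M \<longleftrightarrow> 0 \<le> val M x"
    and val_uniformizer: "\<exists>t\<in>carrier K - {\<zero>}. val M t = 1"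
proof -
  have frac: "\<exists>a\<in>localization_at K D M. \<exists>b\<in>localization_at K D M - {\<zero>}. x = a \<otimes> inv b"
    if "x \<in> carrier K" for x
    using fraction[OF that] D_subset_localization[OF assms] by blast
  have "\<exists>v :: 'a \<Rightarrow> int. (\<forall>x\<in>carrier K - {\<zero>}. \<forall>y\<in>carrier K - {\<zero>}. v (x \<otimes> y) = v x + v y) \<and>
     (\<forall>x\<in>carrier K - {\<zero>}. x \<in> localization_at K D M \<longleftrightarrow> 0 \<le> v x) \<and>
     (\<exists>t\<in>carrier K - {\<zero>}. v t = 1)"
    by (rule dvr_valuation[OF field_axioms localization_carrier[OF assms] dvr_localization[OF assms] frac]) blast+
  from someI_ex[OF this, folded val_def]
  show "\<And>x y. x \<in> carrier K \<Longrightarrow> x \<noteq> \<zero> \<Longrightarrow> y \<in> carrier K \<Longrightarrow> y \<noteq> \<zero> \<Longrightarrow> val M (x \<otimes> y) = val M x + val M y"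
    "\<And>x. x \<in> carrier K \<Longrightarrow> x \<noteq> \<zero> \<Longrightarrow> x \<in> localization_at K D M \<longleftrightarrow> 0 \<le> val M x"
    "\<exists>t\<in>carrier K - {\<zero>}. val M t = 1" by blast+
qed

lemma val_one: "M \<in> Ms \<Longrightarrow> val M \<one> = 0"
  using val_mult[of M \<one> \<one>] by simp

lemma val_inv: "M \<in> Ms \<Longrightarrow> x \<in> carrier K \<Longrightarrow> x \<noteq> \<zero> \<Longrightarrow> val M (inv x) = - val M x"
  using val_mult[of M x "inv x"] field_inv[of x] val_one[of M] by simp

lemma val_D: "M \<in> Ms \<Longrightarrow> x \<in> D \<Longrightarrow> x \<noteq> \<zero> \<Longrightarrow> 0 \<le> val M x"
  using val_localization[of M x] D_subset_localization[of M] D_carrier by blast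

text \<open>For \<open>x\<close> in \<open>M\<close> the inverse is missing from the localization,
  as \<open>inv x = a / s\<close> would put \<open>s = a x\<close> into \<open>M\<close>; outside
  \<open>M\<close> the element \<open>x\<close> is itself a denominator.\<close>

lemma val_M:
  assumes M: "M \<in> Ms" and x: "x \<in> D" "x \<noteq> \<zero>"
  shows "x \<in> M \<longleftrightarrow> 1 \<le> val M x"
proof
  assume "x \<in> M"
  have "\<not> 0 \<le> val M (inv x)"
  proof
    assume "0 \<le> val M (inv x)"
    then have "inv x \<in> localization_at K D M"
      using val_localization[OF M, of "inv x"] field_inv[of x] x D_carrier by simp
    then obtain a s where as: "inv x = a \<otimes> inv s" "a \<in> D" "s \<in> D" "s \<notin> M"
      by (auto simp: localization_at_def)
    have s0: "s \<noteq> \<zero>" using as(4) MsD(3)[OF M] by auto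
    have c: "x \<in> carrier K" "s \<in> carrier K" "a \<in> carrier K" using x as D_carrier by auto
    have "s = (x \<otimes> inv x) \<otimes> s" using c x field_inv by simp
    also have "\<dots> = (a \<otimes> x) \<otimes> (inv s \<otimes> s)" unfolding as(1) using c s0 field_inv(1)[of s] by (simp add: m_ac)
    also have "\<dots> = a \<otimes> x" using c s0 field_inv(2)[of s] by simp
    finally have "s = a \<otimes> x" .
    have "s \<in> M"
      using ideal.I_l_closed[OF maximalideal.axioms(1)[OF MsD(1)[OF M]] \<open>x \<in> M\<close>, of a] as(2) \<open>s = a \<otimes> x\<close>
      by simp
    then show False using as(4) by simp
  qed
  then show "1 \<le> val M x" using val_inv[OF M, of x] x D_carrier by simp
next
  assume v: "1 \<le> val M x"
  show "x \<in> M"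
  proof (rule ccontr)
    assume "x \<notin> M"
    then have "\<one> \<otimes> inv x \<in> localization_at K D M"
      unfolding localization_at_def using x DE(3) by blast
    then have "inv x \<in> localization_at K D M" using field_inv(1)[of x] x D_carrier by simp
    then have "0 \<le> val M (inv x)"
      using val_localization[OF M, of "inv x"] field_inv[of x] x D_carrier by simp
    then show False using v val_inv[OF M, of x] x D_carrier by simp
  qed
qed

text \<open>\<open>ge M n x\<close> says that the \<open>M\<close>-adic valuation of \<open>x\<close>, infinite at zero, is at least \<open>n\<close>;
  the junk value of \<^const>\<open>val\<close> at zero is never used.\<close>

definition ge :: "'a set \<Rightarrow> int \<Rightarrow> 'a \<Rightarrow> bool" where
  "ge M n x \<longleftrightarrow> x \<in> carrier K \<and> (x = \<zero> \<or> n \<le> val M x)"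

lemma ge_zero [simp]: "ge M n \<zero>"
  by (simp add: ge_def)

lemma ge_carrier: "ge M n x \<Longrightarrow> x \<in> carrier K"
  by (simp add: ge_def)

lemma ge_mono: "ge M n x \<Longrightarrow> m \<le> n \<Longrightarrow> ge M m x"
  by (auto simp: ge_def)

lemma ge_mult: "M \<in> Ms \<Longrightarrow> ge M n x \<Longrightarrow> ge M m y \<Longrightarrow> ge M (n + m) (x \<otimes> y)"
  using val_mult[of M x y] by (cases "x = \<zero> \<or> y = \<zero>") (auto simp: ge_def)

lemma ge_localization: "M \<in> Ms \<Longrightarrow> ge M 0 x \<longleftrightarrow> x \<in> localization_at K D M"
  using val_localization[of M x] localization_carrier[of M] D_subset_localization[of M] DE(2)
  by (auto simp: ge_def)

text \<open>Dividing by the element of smaller value reduces the claim to closure of the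
  localization under addition: \<open>x + y = x (1 + y/x)\<close>.\<close>

lemma ge_add:
  assumes M: "M \<in> Ms" and x: "ge M n x" and y: "ge M n y"
  shows "ge M n (x \<oplus> y)"
proof -
  interpret L: principal_domain "K\<lparr>carrier := localization_at K D M\<rparr>"
    using dvr_localization[OF M] by (simp add: discrete_valuation_ring_def)
  have sum: "ge M n (x \<oplus> y)" if xy: "ge M n x" "ge M n y" "x \<noteq> \<zero>" "y \<noteq> \<zero>" "val M x \<le> val M y" for x y
  proof -
    have c: "x \<in> carrier K" "y \<in> carrier K" using xy by (auto simp: ge_def)
    have "ge M (val M y - val M x) (y \<otimes> inv x)"
      using val_mult[OF M, of y "inv x"] val_inv[OF M, of x] c xy field_inv[of x] by (simp add: ge_def)
    then have "y \<otimes> inv x \<in> localization_at K D M"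
      using ge_localization[OF M] ge_mono xy(5) by (metis diff_ge_0_iff_ge)
    moreover have "\<one> \<in> localization_at K D M" using L.one_closed by simp
    ultimately have "ge M 0 (\<one> \<oplus> y \<otimes> inv x)"
      using ge_localization[OF M] L.a_closed by simp
    then have "ge M (val M x + 0) (x \<otimes> (\<one> \<oplus> y \<otimes> inv x))"
      using c by (intro ge_mult[OF M]) (auto simp: ge_def)
    moreover have "x \<otimes> (\<one> \<oplus> y \<otimes> inv x) = x \<oplus> y \<otimes> (x \<otimes> inv x)"
      using c field_inv(1)[of x] xy(3) by (simp add: r_distr m_ac)
    moreover have "\<dots> = x \<oplus> y" using c field_inv(3)[of x] xy(3) by simp
    moreover have "n \<le> val M x" using xy by (auto simp: ge_def)
    ultimately show ?thesis using ge_mono by simp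
  qed
  have c: "x \<in> carrier K" "y \<in> carrier K" using x y by (auto simp: ge_def)
  consider "x = \<zero>" | "y = \<zero>" | "x \<noteq> \<zero>" "y \<noteq> \<zero>" "val M x \<le> val M y" | "x \<noteq> \<zero>" "y \<noteq> \<zero>" "val M y \<le> val M x"
    by linarith
  then show ?thesis
  proof cases
    case 4
    then show ?thesis using sum[OF y x] a_comm[OF c] by simp
  qed (use x y c sum in auto)
qed

lemma ge_ideal_prod:
  assumes M: "M \<in> Ms" and "\<And>a. a \<in> A \<Longrightarrow> ge M n a" "\<And>b. b \<in> B \<Longrightarrow> ge M m b"
    and "x \<in> ideal_prod K A B"
  shows "ge M (n + m) x"
  using assms(4) by (induction rule: ideal_prod.induct) (use assms ge_mult ge_add in auto)

lemma D_iff: "x \<in> D \<longleftrightarrow> x \<in> carrier K \<and> (\<forall>M\<in>Ms. ge M 0 x)"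
  using overring_of_Max_ideals[OF quotient_field] ge_localization
  unfolding overring_of_def by blast

section \<open>Least values of finite sets\<close>

definition fin :: "'a set \<Rightarrow> bool" where
  "fin A \<longleftrightarrow> finite A \<and> A \<noteq> {} \<and> A \<subseteq> carrier K - {\<zero>}"

text \<open>As \<open>fin\<close> bars zero, the minimum never meets the arbitrary value of
  \<open>val\<close> at zero. The value 0 off \<open>Ms\<close> makes the function unique and
  confines its support to the space.\<close>

definition nu :: "'a set \<Rightarrow> 'a set \<Rightarrow> int" where
  "nu A M = (if M \<in> Ms then Min (val M ` A) else 0)"

lemma nu_le: "fin A \<Longrightarrow> M \<in> Ms \<Longrightarrow> a \<in> A \<Longrightarrow> nu A M \<le> val M a"
  by (auto simp: nu_def fin_def)

lemma nu_attained:
  assumes "fin A" "M \<in> Ms"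
  obtains a where "a \<in> A" "nu A M = val M a"
proof -
  have "Min (val M ` A) \<in> val M ` A" using assms by (intro Min_in) (auto simp: fin_def)
  then show ?thesis using that assms by (auto simp: nu_def)
qed

lemma nu_ge: "fin A \<Longrightarrow> M \<in> Ms \<Longrightarrow> a \<in> A \<Longrightarrow> ge M (nu A M) a"
  using nu_le[of A M a] by (auto simp: ge_def fin_def)

lemma nu_eqI:
  assumes "fin A" "M \<in> Ms" "\<And>a. a \<in> A \<Longrightarrow> n \<le> val M a" "\<exists>a\<in>A. val M a = n"
  shows "nu A M = n"
  using assms nu_le by (metis nu_attained order_antisym)

text \<open>This is \<open>(D : A)\<close>, the inverse of the fractional ideal generated by
  \<open>A\<close>.\<close>

definition dual :: "'a set \<Rightarrow> 'a set" where
  "dual A = {y \<in> carrier K. \<forall>a\<in>A. a \<otimes> y \<in> D}"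

lemma dual_ge:
  assumes A: "fin A" "M \<in> Ms" "y \<in> dual A"
  shows "ge M (- nu A M) y"
proof (cases "y = \<zero>")
  case False
  obtain a where a: "a \<in> A" "nu A M = val M a" using nu_attained[OF A(1,2)] .
  have c: "a \<in> carrier K" "a \<noteq> \<zero>" "y \<in> carrier K" using A a by (auto simp: fin_def dual_def)
  have "a \<otimes> y \<in> D" using A(3) a by (simp add: dual_def)
  moreover have "a \<otimes> y \<noteq> \<zero>" using c False integral by blast
  ultimately have "0 \<le> val M (a \<otimes> y)" by (rule val_D[OF A(2)])
  then show ?thesis using val_mult[OF A(2) c False] a(2) c(3) by (simp add: ge_def)
qed simp

lemma denominator:
  assumes M: "M \<in> Ms" and A: "finite A" "\<And>a. a \<in> A \<Longrightarrow> ge M 0 a"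
  shows "\<exists>s\<in>D - M. \<forall>a\<in>A. s \<otimes> a \<in> D"
  using A
proof (induction A rule: finite_induct)
  case empty
  then show ?case using MsD(4)[OF M] DE(3) by auto
next
  case (insert x A)
  then obtain s where s: "s \<in> D - M" "\<forall>a\<in>A. s \<otimes> a \<in> D" by auto
  obtain a u where u: "x = a \<otimes> inv u" "a \<in> D" "u \<in> D" "u \<notin> M"
    using insert.prems[of x] ge_localization[OF M] by (auto simp: localization_at_def)
  have nz: "s \<noteq> \<zero>" "u \<noteq> \<zero>" using s u MsD(3)[OF M] by auto
  have c: "s \<in> carrier K" "u \<in> carrier K" "a \<in> carrier K" using s u D_carrier by auto
  have "val M (s \<otimes> u) = 0"
    using val_mult[OF M c(1) nz(1) c(2) nz(2)] val_M[OF M, of s] val_M[OF M, of u] val_D[OF M, of s]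
      val_D[OF M, of u] s u nz by auto
  moreover have "s \<otimes> u \<noteq> \<zero>" using c nz integral by blast
  moreover have "s \<otimes> u \<in> D" using s u DE(6) by blast
  ultimately have "s \<otimes> u \<in> D - M" using val_M[OF M, of "s \<otimes> u"] by simp
  moreover have "(s \<otimes> u) \<otimes> x = s \<otimes> a \<otimes> (u \<otimes> inv u)"
    unfolding u(1) using c nz field_inv(1)[of u] by (simp add: m_ac)
  then have "(s \<otimes> u) \<otimes> x \<in> D" using c nz field_inv(3)[of u] s u DE(6) by simp
  moreover have "(s \<otimes> u) \<otimes> y \<in> D" if "y \<in> A" for y
  proof -
    have "y \<in> carrier K" using insert.prems that by (auto simp: ge_def)
    then have "(s \<otimes> u) \<otimes> y = u \<otimes> (s \<otimes> y)" using c by (simp add: m_ac)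
    then show ?thesis using s(2) that u(3) DE(6) by simp
  qed
  ultimately show ?case by blast
qed

text \<open>Nonzero finitely generated ideals are invertible: \<open>D\<close> is a Pruefer domain.
  Were the product inside a maximal ideal \<open>M\<close>, take \<open>x\<close> in
  \<open>A\<close> of least value at \<open>M\<close>. All \<open>a / x\<close> lie in the
  localization and have a common denominator \<open>s\<close> outside \<open>M\<close>; so
  \<open>s / x\<close> is in the dual, and \<open>s = x (s / x)\<close> lies in
  \<open>M\<close>.\<close>

lemma one_in_prod_dual:
  assumes A: "fin A"
  shows "\<one> \<in> ideal_prod K A (dual A)"
proof -
  let ?J = "ideal_prod K A (dual A)"
  have zero_dual: "\<zero> \<in> dual A" using A DE(2) by (auto simp: dual_def fin_def)
  have AK: "A \<subseteq> carrier K" using A by (auto simp: fin_def)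
  have dual_mult: "d \<otimes> y \<in> dual A" if "d \<in> D" "y \<in> dual A" for d y
  proof -
    have "a \<otimes> (d \<otimes> y) = d \<otimes> (a \<otimes> y)" if "a \<in> A" for a
      using that \<open>d \<in> D\<close> \<open>y \<in> dual A\<close> AK D_carrier by (auto simp: dual_def m_ac)
    then show ?thesis using that DE(6) D_carrier by (auto simp: dual_def)
  qed
  have JD: "?J \<subseteq> D"
  proof
    fix x assume "x \<in> ?J" then show "x \<in> D"
      by (induction rule: ideal_prod.induct) (auto simp: dual_def intro: DE(7))
  qed
  have ideal: "ideal ?J DR"
  proof (rule subring_idealI[OF subring_D JD])
    obtain a where "a \<in> A" using A by (auto simp: fin_def)
    then show "\<zero> \<in> ?J" using ideal_prod.prod[OF _ zero_dual, of a A K] AK by auto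
    show l: "r \<otimes> x \<in> ?J" if "r \<in> D" "x \<in> ?J" for r x
      using that(2)
    proof (induction rule: ideal_prod.induct)
      case (prod i j)
      have "r \<otimes> (i \<otimes> j) = i \<otimes> (r \<otimes> j)"
        using prod that(1) AK D_carrier by (auto simp: dual_def m_ac)
      then show ?case using prod that(1) dual_mult by (auto intro: ideal_prod.prod)
    next
      case (sum x y)
      then have "r \<otimes> (x \<oplus> y) = r \<otimes> x \<oplus> r \<otimes> y"
        using that(1) JD D_carrier by (intro r_distr) auto
      then show ?case using sum by (auto intro: ideal_prod.sum)
    qed
    show "x \<otimes> r \<in> ?J" if "r \<in> D" "x \<in> ?J" for r x
      using l[OF that] m_comm[of r x] that JD D_carrier by auto
  qed (rule ideal_prod.sum)
  show ?thesis
  proof (rule ccontr)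
    assume "\<one> \<notin> ?J"
    then have "?J \<noteq> carrier DR" using DE(3) by auto
    then obtain M where "maximalideal M DR" "?J \<subseteq> M"
      using cring.proper_ideal_subset_maximalideal[OF cring_DR ideal] by blast
    then have M: "M \<in> Ms" by (simp add: Max_ideals_def)
    obtain x where x: "x \<in> A" "nu A M = val M x" using nu_attained[OF A M] .
    have xK: "x \<in> carrier K" "x \<noteq> \<zero>" using x A by (auto simp: fin_def)
    have "ge M 0 (a \<otimes> inv x)" if "a \<in> A" for a
    proof -
      have "ge M (- nu A M) (inv x)" using x xK val_inv[OF M] field_inv(1) by (simp add: ge_def)
      from ge_mult[OF M nu_ge[OF A M that] this] show ?thesis by simp
    qed
    then obtain s where s: "s \<in> D - M" "\<forall>y\<in>(\<lambda>a. a \<otimes> inv x) ` A. s \<otimes> y \<in> D"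
      using denominator[OF M, of "(\<lambda>a. a \<otimes> inv x) ` A"] A by (auto simp: fin_def)
    then have s: "s \<in> D" "s \<notin> M" "\<And>a. a \<in> A \<Longrightarrow> s \<otimes> (a \<otimes> inv x) \<in> D" by auto
    have inv: "inv x \<in> carrier K" "x \<otimes> inv x = \<one>"
      using field_inv(1,3) xK by blast+
    note sK = D_carrier[OF s(1)]
    have "a \<otimes> (s \<otimes> inv x) = s \<otimes> (a \<otimes> inv x)" if "a \<in> A" for a
      by (rule m_lcomm) (use that AK inv sK in auto)
    then have "s \<otimes> inv x \<in> dual A" using s(3) sK inv by (auto simp: dual_def)
    then have "x \<otimes> (s \<otimes> inv x) \<in> ?J" using x(1) by (rule ideal_prod.prod[rotated])
    moreover have "x \<otimes> (s \<otimes> inv x) = s \<otimes> (x \<otimes> inv x)"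
      by (rule m_lcomm) (use xK inv sK in auto)
    ultimately have "s \<in> ?J" using inv(2) sK by simp
    then show False using \<open>?J \<subseteq> M\<close> s(2) by blast
  qed
qed

text \<open>Finitely many elements of the dual suffice to express 1. Zero is removed from them to
  meet \<open>fin\<close>, and it returns in \<open>insert \<zero> B\<close> so that the expression
  of 1 persists.\<close>

lemma dual_generators:
  assumes A: "fin A"
  obtains B where "fin B" "B \<subseteq> dual A" "\<one> \<in> ideal_prod K A (insert \<zero> B)"
proof -
  obtain A' B' where *: "A' \<subseteq> A" "finite B'" "B' \<subseteq> dual A" "\<one> \<in> ideal_prod K A' B'"
    by (rule ideal_prod_finite[OF one_in_prod_dual[OF A]])
  have AK: "A \<subseteq> carrier K" using A by (auto simp: fin_def)
  have one: "\<one> \<in> ideal_prod K A (insert \<zero> (B' - {\<zero>}))"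
    using *(4) ideal_prod_mono[OF *(1), of B' "insert \<zero> (B' - {\<zero>})" K] by blast
  have "B' - {\<zero>} \<noteq> {}"
  proof
    assume "B' - {\<zero>} = {}"
    have "x = \<zero>" if "x \<in> ideal_prod K A {\<zero>}" for x
      using that by (induction rule: ideal_prod.induct) (use AK in auto)
    moreover have "\<one> \<in> ideal_prod K A {\<zero>}" using one \<open>B' - {\<zero>} = {}\<close> by simp
    ultimately show False using one_not_zero by blast
  qed
  then show ?thesis
    using * one by (intro that[of "B' - {\<zero>}"]) (auto simp: fin_def dual_def)
qed

text \<open>Membership in the dual bounds \<open>nu B\<close> below by \<open>- nu A\<close>; the
  expression of 1 by products bounds \<open>nu A + nu B\<close> above by the value of 1, which is
  0.\<close>

lemma nu_dual:
  assumes A: "fin A" and B: "fin B" "B \<subseteq> dual A" "\<one> \<in> ideal_prod K A (insert \<zero> B)"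
  shows "nu B = - nu A"
proof
  fix M
  show "nu B M = (- nu A) M"
  proof (cases "M \<in> Ms")
    case True
    obtain b where b: "b \<in> B" "nu B M = val M b" using nu_attained[OF B(1) True] .
    then have "b \<noteq> \<zero>" using B(1) by (auto simp: fin_def)
    then have "- nu A M \<le> nu B M"
      using dual_ge[OF A True, of b] b B(2) by (auto simp: ge_def)
    moreover have "ge M (nu A M + nu B M) \<one>"
      by (rule ge_ideal_prod[OF True _ _ B(3)]) (use nu_ge[OF A True] nu_ge[OF B(1) True] in auto)
    then have "nu A M + nu B M \<le> 0" using val_one[OF True] by (simp add: ge_def)
    ultimately show ?thesis by simp
  qed (simp add: nu_def)
qed

section \<open>The lattice-ordered group of least-value functions\<close>

definition G :: "('a set \<Rightarrow> int) set" where
  "G = {nu A |A. fin A}"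

lemma nu_G: "fin A \<Longrightarrow> nu A \<in> G"
  by (auto simp: G_def)

lemma nu_singleton: "M \<in> Ms \<Longrightarrow> nu {x} M = val M x"
  by (simp add: nu_def)

lemma zero_in_G: "0 \<in> G"
proof -
  have "nu {\<one>} = 0" using val_one by (auto simp: nu_def fun_eq_iff)
  then show ?thesis using nu_G[of "{\<one>}"] by (simp add: fin_def)
qed

lemma neg_in_G: "g \<in> G \<Longrightarrow> - g \<in> G"
  unfolding G_def using dual_generators nu_dual by (smt (verit, best) mem_Collect_eq)

lemma add_in_G:
  assumes "g \<in> G" "h \<in> G"
  shows "g + h \<in> G"
proof -
  obtain A B where AB: "fin A" "fin B" "g = nu A" "h = nu B" using assms by (auto simp: G_def)
  let ?C = "(\<lambda>(a, b). a \<otimes> b) ` (A \<times> B)"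
  have C: "fin ?C" using AB(1,2) integral by (auto simp: fin_def)
  have "nu ?C M = nu A M + nu B M" for M
  proof (cases "M \<in> Ms")
    case True
    have mult: "val M (a \<otimes> b) = val M a + val M b" if "a \<in> A" "b \<in> B" for a b
      using that AB by (intro val_mult[OF True]) (auto simp: fin_def)
    obtain a where a: "a \<in> A" "nu A M = val M a" using nu_attained[OF AB(1) True] .
    obtain b where b: "b \<in> B" "nu B M = val M b" using nu_attained[OF AB(2) True] .
    show ?thesis
    proof (rule nu_eqI[OF C True])
      show "nu A M + nu B M \<le> val M c" if "c \<in> ?C" for c
        using that mult nu_le[OF AB(1) True] nu_le[OF AB(2) True] by (auto intro!: add_mono)
      show "\<exists>c\<in>?C. val M c = nu A M + nu B M"
        using a b mult by (intro bexI[of _ "a \<otimes> b"]) auto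
    qed
  qed (simp add: nu_def)
  then have "g + h = nu ?C" using AB by (simp add: fun_eq_iff)
  then show ?thesis using nu_G[OF C] by simp
qed

lemma subspace_in_G: "zf.subspace G"
proof (rule zf.subspaceI)
  fix n g assume g: "g \<in> G"
  have nat: "zscale (int k) g \<in> G" for k
  proof (induction k)
    case 0
    have "zscale (int 0) g = 0" by (simp add: fun_eq_iff)
    show ?case unfolding \<open>zscale (int 0) g = 0\<close> by (rule zero_in_G)
  next
    case (Suc k)
    have eq: "zscale (int (Suc k)) g = g + zscale (int k) g" by (simp add: fun_eq_iff algebra_simps)
    show ?case unfolding eq by (rule add_in_G[OF g Suc])
  qed
  show "zscale n g \<in> G"
  proof (cases "0 \<le> n")
    case True
    then show ?thesis using nat[of "nat n"] by simp
  next
    case False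
    then have eq: "zscale n g = - zscale (int (nat (- n))) g" by (simp add: fun_eq_iff)
    show ?thesis unfolding eq by (rule neg_in_G[OF nat])
  qed
qed (use zero_in_G add_in_G in auto)

lemma min_in_G:
  assumes "g \<in> G" "h \<in> G"
  shows "(\<lambda>M. min (g M) (h M)) \<in> G"
proof -
  obtain A B where AB: "fin A" "fin B" "g = nu A" "h = nu B" using assms by (auto simp: G_def)
  have "nu (A \<union> B) M = min (nu A M) (nu B M)" for M
    using AB by (simp add: nu_def fin_def image_Un Min_Un)
  moreover have "fin (A \<union> B)" using AB by (auto simp: fin_def)
  moreover have "(\<lambda>M. min (g M) (h M)) = nu (A \<union> B)"
    using calculation(1) AB by (intro ext) simp
  ultimately show ?thesis using nu_G by simp
qed

lemma nonneg_D:
  assumes "fin A" "\<And>M. M \<in> Ms \<Longrightarrow> 0 \<le> nu A M"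
  shows "A \<subseteq> D"
proof
  fix a assume a: "a \<in> A"
  then have "ge M 0 a" if "M \<in> Ms" for M using nu_ge[OF assms(1) that a] assms(2)[OF that] ge_mono by blast
  then show "a \<in> D" using a assms(1) by (auto simp: D_iff fin_def)
qed

lemma nu_D_nonneg: "fin A \<Longrightarrow> A \<subseteq> D \<Longrightarrow> 0 \<le> nu A M"
proof (cases "M \<in> Ms")
  case True
  assume A: "fin A" "A \<subseteq> D"
  obtain a where a: "a \<in> A" "nu A M = val M a" using nu_attained[OF A(1) True] .
  then have "a \<in> D" "a \<noteq> \<zero>" using A by (auto simp: fin_def)
  then show ?thesis using val_D[OF True] a(2) by simp
qed (simp add: nu_def)

text \<open>The bridge between \<open>G\<close> and the subbasis of the topology: inside
  \<open>D\<close> all values are nonnegative, so the least one is nonzero at \<open>M\<close> iff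
  all of \<open>A\<close> has positive value there.\<close>

lemma supp_nu:
  assumes A: "fin A" "A \<subseteq> D"
  shows "supp (nu A) = {M \<in> Ms. A \<subseteq> M}"
proof -
  have "nu A M \<noteq> 0 \<longleftrightarrow> A \<subseteq> M" if M: "M \<in> Ms" for M
  proof -
    obtain a where a: "a \<in> A" "nu A M = val M a" using nu_attained[OF A(1) M] .
    have *: "b \<in> M \<longleftrightarrow> 1 \<le> val M b" if "b \<in> A" for b
      using that A val_M[OF M, of b] by (auto simp: fin_def)
    show ?thesis
    proof
      assume "nu A M \<noteq> 0"
      then have "1 \<le> nu A M" using nu_D_nonneg[OF A, of M] by simp
      then show "A \<subseteq> M" using * nu_le[OF A(1) M] by force
    next
      assume "A \<subseteq> M"
      then have "1 \<le> val M a" using * a by blast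
      then show "nu A M \<noteq> 0" using a by simp
    qed
  qed
  then show ?thesis by (auto simp: nu_def)
qed

lemma Idl_subset_iff: "M \<in> Ms \<Longrightarrow> A \<subseteq> D \<Longrightarrow> Idl\<^bsub>DR\<^esub> A \<subseteq> M \<longleftrightarrow> A \<subseteq> M"
  using ring.genideal_minimal[OF cring.axioms(1)[OF cring_DR], of M A]
    ring.genideal_self[OF cring.axioms(1)[OF cring_DR], of A]
    maximalideal.axioms(1)[OF MsD(1), of M] by auto

abbreviation subbasis where
  "subbasis \<equiv> {{M \<in> Ms. I \<subseteq> M} | I. fg_ideal DR I} \<union> {{M \<in> Ms. \<not> I \<subseteq> M} | I. fg_ideal DR I}"

lemma fg_supp:
  assumes "fg_ideal DR I"
  shows "{M \<in> Ms. I \<subseteq> M} = Ms \<or> (\<exists>g\<in>G. {M \<in> Ms. I \<subseteq> M} = supp g)"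
proof -
  obtain A where A: "finite A" "A \<subseteq> D" "I = Idl\<^bsub>DR\<^esub> A" using assms by (auto simp: fg_ideal_def)
  have eq: "{M \<in> Ms. I \<subseteq> M} = {M \<in> Ms. A - {\<zero>} \<subseteq> M}"
    using Idl_subset_iff[OF _ A(2)] A(3) MsD(3) by blast
  show ?thesis
  proof (cases "A - {\<zero>} = {}")
    case False
    then have "fin (A - {\<zero>})" using A D_carrier by (auto simp: fin_def)
    then show ?thesis unfolding eq using supp_nu[of "A - {\<zero>}"] nu_G A(2) by blast
  qed (use eq in auto)
qed

lemma supp_fg:
  assumes "fin A" "A \<subseteq> D"
  shows "fg_ideal DR (Idl\<^bsub>DR\<^esub> A)" "supp (nu A) = {M \<in> Ms. Idl\<^bsub>DR\<^esub> A \<subseteq> M}"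
  using assms Idl_subset_iff[OF _ assms(2)] supp_nu[OF assms] by (auto simp: fg_ideal_def fin_def)

lemma topspace_constructible: "topspace (constructible_Max K D) = Ms"
proof -
  have "fg_ideal DR (Idl\<^bsub>DR\<^esub> {\<zero>})" using DE(2) by (auto simp: fg_ideal_def)
  moreover have "{M \<in> Ms. Idl\<^bsub>DR\<^esub> {\<zero>} \<subseteq> M} = Ms"
    using Idl_subset_iff[of _ "{\<zero>}"] DE(2) MsD(3) by blast
  ultimately have "Ms \<in> subbasis" by blast
  then show ?thesis unfolding constructible_Max_def topology_generated_by_topspace by blast
qed

section \<open>Fractional ideals cut out by valuations\<close>

definition closed_ideal :: "('a set \<Rightarrow> int) \<Rightarrow> 'a set" where
  "closed_ideal g = {x \<in> carrier K. \<forall>M\<in>Ms. ge M (g M) x}"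

lemma closed_ideal_self: "fin A \<Longrightarrow> A \<subseteq> closed_ideal (nu A)"
  using nu_ge by (auto simp: closed_ideal_def fin_def)

lemma closed_ideal_closed:
  shows "\<zero> \<in> closed_ideal g"
    and "x \<in> closed_ideal g \<Longrightarrow> y \<in> closed_ideal g \<Longrightarrow> x \<oplus> y \<in> closed_ideal g"
    and "x \<in> closed_ideal g \<Longrightarrow> y \<in> closed_ideal h \<Longrightarrow> x \<otimes> y \<in> closed_ideal (g + h)"
    and "closed_ideal 0 = D"
  using ge_add ge_mult D_iff D_carrier by (auto simp: closed_ideal_def)

lemma closed_ideal_D:
  assumes "d \<in> D" "x \<in> closed_ideal g"
  shows "d \<otimes> x \<in> closed_ideal g"
  using closed_ideal_closed(3)[of d 0 x g] closed_ideal_closed(4) assms by simp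

text \<open>Minima of functions give larger ideals \<open>closed_ideal h\<close>, so the union over
  \<open>F\<close> is directed and an ideal. It is proper, since 1 in \<open>closed_ideal h\<close>
  forces \<open>h \<le> 0\<close>. A maximal ideal above it contains generators of every
  \<open>h\<close> in \<open>F\<close> and so lies in every support.\<close>

lemma common_support_point:
  assumes F: "F \<subseteq> G" "F \<noteq> {}" "\<And>h. h \<in> F \<Longrightarrow> h \<noteq> 0 \<and> (\<forall>M. 0 \<le> h M)"
    and min: "\<And>h k. h \<in> F \<Longrightarrow> k \<in> F \<Longrightarrow> (\<lambda>x. min (h x) (k x)) \<in> F"
  shows "\<exists>M\<in>Ms. \<forall>h\<in>F. h M \<noteq> 0"
proof -
  let ?I = "\<Union>h\<in>F. closed_ideal h"
  have mono: "closed_ideal h \<subseteq> closed_ideal k" if "\<And>M. k M \<le> h M" for h k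
    using that ge_mono by (auto simp: closed_ideal_def)
  have ID: "?I \<subseteq> D"
  proof -
    have "closed_ideal h \<subseteq> D" if "h \<in> F" for h
      using mono[of 0 h] F(3)[OF that] closed_ideal_closed(4) by simp
    then show ?thesis by blast
  qed
  have "ideal ?I DR"
  proof (rule subring_idealI[OF subring_D ID])
    show "\<zero> \<in> ?I" using F(2) closed_ideal_closed(1) by blast
    fix x y assume "x \<in> ?I" "y \<in> ?I"
    then obtain h k where hk: "h \<in> F" "x \<in> closed_ideal h" "k \<in> F" "y \<in> closed_ideal k" by blast
    let ?m = "\<lambda>x. min (h x) (k x)"
    have "x \<in> closed_ideal ?m" "y \<in> closed_ideal ?m"
      using hk mono[of ?m h] mono[of ?m k] by auto
    then show "x \<oplus> y \<in> ?I" using min[OF hk(1,3)] closed_ideal_closed(2) by blast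
  next
    fix r x assume r: "r \<in> D" "x \<in> ?I"
    then show "r \<otimes> x \<in> ?I" using closed_ideal_D by blast
    moreover have "x \<in> carrier K" using r(2) ID D_carrier by blast
    ultimately show "x \<otimes> r \<in> ?I" using m_comm[of r x] r(1) D_carrier by simp
  qed
  moreover have "\<one> \<notin> ?I"
  proof
    assume "\<one> \<in> ?I"
    then obtain h where h: "h \<in> F" "\<one> \<in> closed_ideal h" by blast
    obtain A where A: "h = nu A" using h(1) F(1) by (auto simp: G_def)
    have "h M = 0" for M
    proof (cases "M \<in> Ms")
      case True
      then have "h M \<le> 0" using h(2) val_one[OF True] by (auto simp: closed_ideal_def ge_def)
      then show ?thesis using F(3)[OF h(1)] by (simp add: order_antisym)
    qed (simp add: A nu_def)
    then show False using F(3)[OF h(1)] by (simp add: fun_eq_iff)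
  qed
  then have "?I \<noteq> carrier DR" using DE(3) by auto
  ultimately obtain M where "maximalideal M DR" and IM: "?I \<subseteq> M"
    using cring.proper_ideal_subset_maximalideal[OF cring_DR] by blast
  then have M: "M \<in> Ms" by (simp add: Max_ideals_def)
  have "h M \<noteq> 0" if hF: "h \<in> F" for h
  proof -
    obtain A where A: "fin A" "h = nu A" using hF F(1) by (auto simp: G_def)
    have "A \<subseteq> M" using closed_ideal_self[OF A(1)] A(2) hF IM by blast
    moreover have "A \<subseteq> D" using calculation MsD(2)[OF M] by blast
    ultimately show ?thesis using supp_nu[OF A(1)] M A(2) by blast
  qed
  then show ?thesis using M by blast
qed

sublocale L: lattice_group_space "constructible_Max K D" G subbasis
proof
  let ?X = "constructible_Max K D"
  show "supp g \<subseteq> topspace ?X" if "g \<in> G" for g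
    using that by (auto simp: topspace_constructible G_def nu_def split: if_splits)
  show "\<exists>g\<in>G. g M = 1" if "M \<in> topspace ?X" for M
  proof -
    have M: "M \<in> Ms" using that by (simp add: topspace_constructible)
    then obtain t where "t \<in> carrier K - {\<zero>}" "val M t = 1" using val_uniformizer by blast
    then show ?thesis
      using nu_singleton[OF M] by (intro bexI[of _ "nu {t}"] nu_G) (auto simp: fin_def)
  qed
  show "?X = topology_generated_by subbasis" by (simp add: constructible_Max_def)
  show "S = topspace ?X \<or> S = {} \<or> (\<exists>g\<in>G. S = supp g \<or> S = topspace ?X - supp g)" if "S \<in> subbasis" for S
  proof -
    have compl: "{M \<in> Ms. \<not> I \<subseteq> M} = Ms - {M \<in> Ms. I \<subseteq> M}" for I by blast
    from that obtain I where I: "fg_ideal DR I" "S = {M \<in> Ms. I \<subseteq> M} \<or> S = Ms - {M \<in> Ms. I \<subseteq> M}"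
      unfolding compl by blast
    show ?thesis
      using fg_supp[OF I(1)] I(2) unfolding topspace_constructible by (elim disjE) auto
  qed
  show "openin ?X (supp g) \<and> closedin ?X (supp g)" if g: "g \<in> G" "\<And>x. 0 \<le> g x" for g
  proof -
    obtain A where A: "fin A" "g = nu A" using g(1) by (auto simp: G_def)
    have AD: "A \<subseteq> D" using nonneg_D[OF A(1)] g(2) A(2) by simp
    note s = supp_fg[OF A(1) AD]
    have "supp g \<in> subbasis" using s A(2) by blast
    moreover have "Ms - supp g = {M \<in> Ms. \<not> Idl\<^bsub>DR\<^esub> A \<subseteq> M}" using s(2) A(2) by blast
    then have "Ms - supp g \<in> subbasis" using s(1) by blast
    moreover have "supp g \<subseteq> Ms" using s(2) A(2) by blast
    ultimately show ?thesis
      unfolding closedin_def topspace_constructible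
      by (simp add: constructible_Max_def topology_generated_by_Basis)
  qed
  show "\<exists>x\<in>topspace ?X. \<forall>h\<in>F. h x \<noteq> 0"
    if "F \<subseteq> G" "F \<noteq> {}" "\<And>h. h \<in> F \<Longrightarrow> h \<noteq> 0 \<and> (\<forall>x. 0 \<le> h x)"
      "\<And>h k. h \<in> F \<Longrightarrow> k \<in> F \<Longrightarrow> (\<lambda>x. min (h x) (k x)) \<in> F" for F
    unfolding topspace_constructible using that by (rule common_support_point)
qed (use subspace_in_G min_in_G in auto)

end

section \<open>Critical ideals of the overrings\<close>

context almost_dedekind_domain begin

abbreviation Xc where "Xc \<equiv> constructible_Max K D"

abbreviation T where "T \<equiv> overring_of K D"

abbreviation TR where "TR S \<equiv> K\<lparr>carrier := T S\<rparr>"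

lemma overring_iff:
  "S \<subseteq> Ms \<Longrightarrow> x \<in> T S \<longleftrightarrow> x \<in> carrier K \<and> (\<forall>M\<in>S. ge M 0 x)"
  using ge_localization unfolding overring_of_def by auto

lemma ge_minus:
  assumes M: "M \<in> Ms" and x: "ge M n x"
  shows "ge M n (\<ominus> x)"
proof -
  have "ge M 0 (\<ominus> \<one>)" using D_iff[of "\<ominus> \<one>"] DE(3,5) M by blast
  then have "ge M (0 + n) (\<ominus> \<one> \<otimes> x)" using x by (rule ge_mult[OF M])
  then show ?thesis using ge_carrier[OF x] by (simp add: l_minus)
qed

lemma subring_overring:
  assumes "S \<subseteq> Ms"
  shows "subring (T S) K"
proof (rule subringI)
  show "\<one> \<in> T S"
    using assms val_one by (auto simp: overring_iff[OF assms] ge_def)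
  fix x assume x: "x \<in> T S"
  show "\<ominus> x \<in> T S"
    using x assms ge_minus unfolding overring_iff[OF assms] by blast
  fix y assume y: "y \<in> T S"
  show "x \<otimes> y \<in> T S"
    using x y assms ge_mult[of _ 0 x 0 y] unfolding overring_iff[OF assms] by auto
  show "x \<oplus> y \<in> T S"
    using x y assms ge_add[of _ 0 x y] unfolding overring_iff[OF assms] by auto
qed (auto simp: overring_of_def)

lemma overring_fin:
  assumes "S \<subseteq> Ms" "fin A"
  shows "A \<subseteq> T S \<longleftrightarrow> (\<forall>M\<in>S. 0 \<le> nu A M)"
proof
  assume A: "A \<subseteq> T S"
  show "\<forall>M\<in>S. 0 \<le> nu A M"
  proof
    fix M assume M: "M \<in> S"
    then obtain a where "a \<in> A" "nu A M = val M a" using nu_attained[OF assms(2)] assms(1) by blast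
    moreover from this have "ge M 0 a" "a \<noteq> \<zero>"
      using A M assms(2) by (auto simp: overring_iff[OF assms(1)] fin_def)
    ultimately show "0 \<le> nu A M" by (simp add: ge_def)
  qed
next
  assume nn: "\<forall>M\<in>S. 0 \<le> nu A M"
  show "A \<subseteq> T S"
  proof
    fix a assume a: "a \<in> A"
    have "ge M 0 a" if "M \<in> S" for M
      using nu_ge[OF assms(2) _ a, of M] nn that assms(1) ge_mono by blast
    then show "a \<in> T S" using a assms by (auto simp: overring_iff[OF assms(1)] fin_def)
  qed
qed

text \<open>A partition of unity: writing 1 as a sum of products \<open>a b\<close> writes
  \<open>x\<close> as the sum of the terms \<open>a (b x)\<close>. This is how membership in a
  generated ideal is deduced from bounds on valuations.\<close>

lemma one_in_prod_imp_mem: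
  assumes "\<one> \<in> ideal_prod K A B" "A \<subseteq> carrier K" "B \<subseteq> carrier K" "x \<in> carrier K"
    and add: "\<And>y z. y \<in> J \<Longrightarrow> z \<in> J \<Longrightarrow> y \<oplus> z \<in> J"
    and mult: "\<And>a b. a \<in> A \<Longrightarrow> b \<in> B \<Longrightarrow> a \<otimes> (b \<otimes> x) \<in> J"
  shows "x \<in> J"
proof -
  have "z \<in> carrier K \<and> z \<otimes> x \<in> J" if "z \<in> ideal_prod K A B" for z
    using that
  proof (induction rule: ideal_prod.induct)
    case (prod a b)
    then have "a \<in> carrier K" "b \<in> carrier K" using assms(2,3) by auto
    then show ?case using mult[OF prod] assms(4) by (simp add: m_assoc)
  next
    case (sum y z)
    then show ?case using assms(4) add by (simp add: l_distr)
  qed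
  from this[OF assms(1)] show ?thesis using assms(4) by simp
qed

definition ideal_over :: "'a set set \<Rightarrow> ('a set \<Rightarrow> int) \<Rightarrow> 'a set" where
  "ideal_over S n = {x \<in> carrier K. \<forall>M\<in>S. ge M (n M) x}"

lemma ideal_ideal_over:
  assumes S: "S \<subseteq> Ms" and n: "\<And>M. M \<in> S \<Longrightarrow> 0 \<le> n M"
  shows "ideal (ideal_over S n) (TR S)"
proof (rule subring_idealI[OF subring_overring[OF S]])
  show "ideal_over S n \<subseteq> T S"
  proof
    fix x assume x: "x \<in> ideal_over S n"
    have "ge M 0 x" if "M \<in> S" for M
      using ge_mono[of M "n M" x 0] n[OF that] x that by (simp add: ideal_over_def)
    then show "x \<in> T S" using x by (simp add: overring_iff[OF S] ideal_over_def)
  qed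
  show "x \<oplus> y \<in> ideal_over S n" if "x \<in> ideal_over S n" "y \<in> ideal_over S n" for x y
    using that ge_add S by (auto simp: ideal_over_def)
  show *: "r \<otimes> x \<in> ideal_over S n" if "r \<in> T S" "x \<in> ideal_over S n" for r x
  proof -
    have "ge M (n M) (r \<otimes> x)" if "M \<in> S" for M
      using ge_mult[of M 0 r "n M" x] that S \<open>r \<in> _\<close> \<open>x \<in> _\<close> by (auto simp: ideal_over_def overring_iff[OF S])
    then show ?thesis using that by (auto simp: ideal_over_def overring_iff[OF S])
  qed
  show "x \<otimes> r \<in> ideal_over S n" if "r \<in> T S" "x \<in> ideal_over S n" for r x
    using *[OF that] that m_comm[of r x] by (auto simp: ideal_over_def overring_iff[OF S])
qed (simp add: ideal_over_def)

lemma ring_TR: "S \<subseteq> Ms \<Longrightarrow> ring (TR S)"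
  using subring_is_ring[OF subring_overring] .

text \<open>Elements \<open>B\<close> of the dual that express 1 over \<open>D\<close> serve for the
  overring too: if \<open>x\<close> meets the bounds on \<open>S\<close>, each \<open>b x\<close>
  has nonnegative value on \<open>S\<close> and is a coefficient in the overring.\<close>

lemma Idl_overring:
  assumes S: "S \<subseteq> Ms" and A: "fin A" "A \<subseteq> T S"
  shows "Idl\<^bsub>TR S\<^esub> A = ideal_over S (nu A)"
proof
  interpret TR: ring "TR S" by (rule ring_TR[OF S])
  have nn: "\<And>M. M \<in> S \<Longrightarrow> 0 \<le> nu A M" using overring_fin[OF S A(1)] A(2) by blast
  show "Idl\<^bsub>TR S\<^esub> A \<subseteq> ideal_over S (nu A)"
  proof (rule TR.genideal_minimal[OF ideal_ideal_over[OF S nn]])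
    show "A \<subseteq> ideal_over S (nu A)"
      using nu_ge[OF A(1)] S A(1) by (auto simp: ideal_over_def fin_def)
  qed
  have Idl: "ideal (Idl\<^bsub>TR S\<^esub> A) (TR S)" "A \<subseteq> Idl\<^bsub>TR S\<^esub> A"
    using TR.genideal_ideal[of A] TR.genideal_self[of A] A(2) by auto
  obtain B where B: "fin B" "B \<subseteq> dual A" "\<one> \<in> ideal_prod K A (insert \<zero> B)"
    by (rule dual_generators[OF A(1)])
  show "ideal_over S (nu A) \<subseteq> Idl\<^bsub>TR S\<^esub> A"
  proof
    fix x assume x: "x \<in> ideal_over S (nu A)"
    then have xK: "x \<in> carrier K" by (simp add: ideal_over_def)
    have BK: "insert \<zero> B \<subseteq> carrier K" using B(1) by (auto simp: fin_def)
    show "x \<in> Idl\<^bsub>TR S\<^esub> A"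
    proof (rule one_in_prod_imp_mem[OF B(3) _ BK xK])
      show "A \<subseteq> carrier K" using A(1) by (auto simp: fin_def)
      show "y \<oplus> z \<in> Idl\<^bsub>TR S\<^esub> A" if "y \<in> Idl\<^bsub>TR S\<^esub> A" "z \<in> Idl\<^bsub>TR S\<^esub> A" for y z
        using additive_subgroup.a_closed[OF ideal.axioms(1)[OF Idl(1)] that] by simp
      fix a b assume ab: "a \<in> A" "b \<in> insert \<zero> B"
      have "ge M 0 (b \<otimes> x)" if "M \<in> S" for M
      proof -
        have "ge M (- nu A M) b" using ab(2) B(2) dual_ge[OF A(1)] that S by auto
        moreover have "ge M (nu A M) x" using x that by (simp add: ideal_over_def)
        ultimately show ?thesis using ge_mult[of M "- nu A M" b "nu A M" x] that S by auto
      qed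
      then have "b \<otimes> x \<in> T S" using ab(2) BK xK by (auto simp: overring_iff[OF S])
      then show "a \<otimes> (b \<otimes> x) \<in> Idl\<^bsub>TR S\<^esub> A"
        using ideal.I_r_closed[OF Idl(1), of a "b \<otimes> x"] Idl(2) ab(1) by auto
    qed
  qed
qed

lemma G_nu:
  assumes "g \<in> G"
  obtains A where "fin A" "g = nu A"
  using assms by (auto simp: G_def)

lemma nonneg_generators:
  assumes "g \<in> G" "\<And>M. 0 \<le> g M"
  obtains C where "fin C" "g = nu C" "C \<subseteq> D" "\<And>P. P \<in> Ms \<Longrightarrow> g P \<noteq> 0 \<Longrightarrow> C \<subseteq> P"
proof -
  obtain C where C: "fin C" "g = nu C" using G_nu[OF assms(1)] .
  have "C \<subseteq> D" using nonneg_D[OF C(1)] assms(2) C(2) by simp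
  then show ?thesis using that[OF C] supp_nu[OF C(1)] C(2) by blast
qed

lemma D_overring: "S \<subseteq> Ms \<Longrightarrow> D \<subseteq> T S"
  using D_iff by (meson overring_iff subset_iff)

lemma Idl_mono:
  assumes "S \<subseteq> Ms" "C \<subseteq> P" "P \<subseteq> T S"
  shows "Idl\<^bsub>TR S\<^esub> C \<subseteq> Idl\<^bsub>TR S\<^esub> P"
proof -
  interpret TR: ring "TR S" by (rule ring_TR[OF assms(1)])
  show ?thesis
    using TR.genideal_minimal[OF TR.genideal_ideal[of P], of C] TR.genideal_self[of P] assms by auto
qed

section \<open>Extensions of maximal ideals to an overring\<close>

definition prime_over :: "'a set set \<Rightarrow> 'a set \<Rightarrow> 'a set" where
  "prime_over S P = {x \<in> T S. ge P 1 x}"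

context
  fixes S assumes S: "closedin Xc S"
begin

lemma S_Ms: "S \<subseteq> Ms"
  using closedin_subset[OF S] by (simp add: topspace_constructible)

lemma prime_overring: "P \<in> Ms \<Longrightarrow> P \<subseteq> T S"
  using MsD(2) D_overring[OF S_Ms] by blast

text \<open>Closedness of \<open>S\<close> gives a local unit at \<open>P\<close> with support off
  \<open>S\<close>. Its generators lie in \<open>P\<close> and have least value zero throughout
  \<open>S\<close>, so they generate the unit ideal of the overring.\<close>

lemma Idl_outside:
  assumes P: "P \<in> Ms" "P \<notin> S"
  shows "\<one> \<in> Idl\<^bsub>TR S\<^esub> P"
proof -
  have "openin Xc (topspace Xc - S)" using S by blast
  moreover have "P \<in> topspace Xc - S" using P by (simp add: topspace_constructible)
  ultimately obtain e where e: "e \<in> G" "\<And>M. 0 \<le> e M" "e P = 1" "supp e \<subseteq> topspace Xc - S"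
    by (rule L.local_unit) blast
  obtain C where C: "fin C" "e = nu C" "C \<subseteq> D" "\<And>P. P \<in> Ms \<Longrightarrow> e P \<noteq> 0 \<Longrightarrow> C \<subseteq> P"
    using nonneg_generators[OF e(1,2)] by blast
  have "nu C M = 0" if "M \<in> S" for M using e(4) C(2) that by blast
  then have "\<one> \<in> ideal_over S (nu C)"
    using val_one S_Ms by (auto simp: ideal_over_def ge_def)
  then have "\<one> \<in> Idl\<^bsub>TR S\<^esub> C"
    using Idl_overring[OF S_Ms C(1)] C(3) D_overring[OF S_Ms] by blast
  moreover have "C \<subseteq> P" using C(4)[OF P(1)] e(3) by simp
  ultimately show ?thesis using Idl_mono[OF S_Ms _ prime_overring[OF P(1)]] by blast
qed

lemma ideal_prime_over:
  assumes P: "P \<in> S"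
  shows "ideal (prime_over S P) (TR S)"
proof -
  have "prime_over S P = ideal_over S (\<lambda>M. of_bool (M = P))"
    using P S_Ms ge_mono[of P 1 _ 0] by (auto simp: prime_over_def ideal_over_def overring_iff[OF S_Ms])
  then show ?thesis using ideal_ideal_over[OF S_Ms] by simp
qed

text \<open>For \<open>x\<close> of positive value at \<open>P\<close>, generators inside
  \<open>P\<close> are wanted whose least value on \<open>S\<close> does not exceed that of
  \<open>x\<close>; the positive part of \<open>nu {x}\<close> provides them.\<close>

lemma Idl_prime:
  assumes P: "P \<in> S"
  shows "Idl\<^bsub>TR S\<^esub> P = prime_over S P"
proof
  interpret TR: ring "TR S" by (rule ring_TR[OF S_Ms])
  have PM: "P \<in> Ms" using P S_Ms by blast
  have "P \<subseteq> prime_over S P"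
  proof
    fix x assume x: "x \<in> P"
    then have "x \<in> D" "x \<in> T S" using MsD(2)[OF PM] prime_overring[OF PM] by auto
    then show "x \<in> prime_over S P"
      using val_M[OF PM, of x] x D_carrier by (auto simp: prime_over_def ge_def)
  qed
  then show "Idl\<^bsub>TR S\<^esub> P \<subseteq> prime_over S P"
    by (rule TR.genideal_minimal[OF ideal_prime_over[OF P]])
  show "prime_over S P \<subseteq> Idl\<^bsub>TR S\<^esub> P"
  proof
    fix x assume x: "x \<in> prime_over S P"
    then have xT: "x \<in> carrier K" "\<And>M. M \<in> S \<Longrightarrow> ge M 0 x" "ge P 1 x"
      by (auto simp: prime_over_def overring_iff[OF S_Ms])
    show "x \<in> Idl\<^bsub>TR S\<^esub> P"
    proof (cases "x = \<zero>")
      case True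
      have "ideal (Idl\<^bsub>TR S\<^esub> P) (TR S)" using prime_overring[OF PM] by (intro TR.genideal_ideal) simp
      then show ?thesis using True additive_subgroup.zero_closed[OF ideal.axioms(1)] by fastforce
    next
      case False
      \<comment> \<open>Off \<open>S\<close> the value of \<open>x\<close> may be negative;
        truncation at zero puts the generators into \<open>D\<close> and changes nothing on
        \<open>S\<close>.\<close>
      let ?g = "\<lambda>M. max (nu {x} M) 0"
      have fx: "fin {x}" using False xT by (simp add: fin_def)
      obtain C where C: "fin C" "?g = nu C" "C \<subseteq> D" "\<And>P. P \<in> Ms \<Longrightarrow> ?g P \<noteq> 0 \<Longrightarrow> C \<subseteq> P"
        using nonneg_generators[OF L.pos_G[OF nu_G[OF fx]]] by auto
      have v: "nu {x} M = val M x" if "M \<in> S" for M using nu_singleton that S_Ms by blast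
      have "?g P \<noteq> 0" using v[OF P] xT(3) False by (simp add: ge_def)
      then have "C \<subseteq> P" using C(4)[OF PM] by blast
      have "ge M (nu C M) x" if "M \<in> S" for M
        using xT(1) xT(2)[OF that] v[OF that] C(2)[symmetric] by (simp add: ge_def)
      then have "x \<in> ideal_over S (nu C)" using xT(1) by (simp add: ideal_over_def)
      then have "x \<in> Idl\<^bsub>TR S\<^esub> C"
        using Idl_overring[OF S_Ms C(1)] C(3) D_overring[OF S_Ms] by blast
      then show ?thesis using Idl_mono[OF S_Ms \<open>C \<subseteq> P\<close> prime_overring[OF PM]] by blast
    qed
  qed
qed

text \<open>An element \<open>x\<close> of the overring outside the ideal has value zero at
  \<open>P\<close>. A local unit at \<open>P\<close> supported away from the points of positive
  value of \<open>x\<close> has generators in \<open>P\<close>; together with \<open>x\<close> they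
  have least value at most zero on all of \<open>S\<close>, so they generate 1.\<close>

lemma maximal_prime_over:
  assumes P: "P \<in> S"
  shows "maximalideal (prime_over S P) (TR S)"
proof (rule maximalidealI[OF ideal_prime_over[OF P]])
  have PM: "P \<in> Ms" using P S_Ms by blast
  have oneT: "\<one> \<in> T S" using subringE(3)[OF subring_overring[OF S_Ms]] .
  have one: "\<one> \<notin> prime_over S P" using val_one[OF PM] by (simp add: prime_over_def ge_def)
  then show "carrier (TR S) \<noteq> prime_over S P" using oneT by auto
  fix J assume J: "ideal J (TR S)" "prime_over S P \<subseteq> J" "J \<subseteq> carrier (TR S)"
  show "J = prime_over S P \<or> J = carrier (TR S)"
  proof (cases "J = prime_over S P")
    case False
    then obtain x where x: "x \<in> J" "x \<notin> prime_over S P" using J(2) by blast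
    have xT: "x \<in> T S" using x J(3) by auto
    then have xT': "x \<in> carrier K" "\<And>M. M \<in> S \<Longrightarrow> ge M 0 x" by (auto simp: overring_iff[OF S_Ms])
    have x0: "x \<noteq> \<zero>" "val P x = 0"
      using x(2) xT xT'(2)[OF P] by (auto simp: prime_over_def ge_def)
    let ?g = "\<lambda>M. max (nu {x} M) 0"
    have fx: "fin {x}" using x0 xT' by (simp add: fin_def)
    have "openin Xc (topspace Xc - supp ?g)" using L.clopen(2)[OF L.pos_G[OF nu_G[OF fx]]] by blast
    moreover have "P \<in> topspace Xc - supp ?g"
      using PM x0(2) nu_singleton[OF PM] by (simp add: topspace_constructible)
    ultimately obtain e where e: "e \<in> G" "\<And>M. 0 \<le> e M" "e P = 1" "supp e \<subseteq> topspace Xc - supp ?g"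
      by (rule L.local_unit) blast
    obtain C where C: "fin C" "e = nu C" "C \<subseteq> D" "\<And>P. P \<in> Ms \<Longrightarrow> e P \<noteq> 0 \<Longrightarrow> C \<subseteq> P"
      using nonneg_generators[OF e(1,2)] by blast
    have "C \<subseteq> P" using C(4)[OF PM] e(3) by simp
    moreover have "P \<subseteq> prime_over S P"
      using Idl_prime[OF P] ring.genideal_self[OF ring_TR[OF S_Ms], of P] prime_overring[OF PM] by simp
    ultimately have CJ: "insert x C \<subseteq> J" using J(2) x(1) by blast
    have fxC: "fin (insert x C)" using fx C(1) by (auto simp: fin_def)
    have CT: "insert x C \<subseteq> T S" using xT C(3) D_overring[OF S_Ms] by blast
    have "nu (insert x C) M \<le> 0" if "M \<in> S" for M
    proof (cases "val M x = 0")
      case True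
      then show ?thesis using nu_le[OF fxC, of M x] that S_Ms by auto
    next
      case False
      have M: "M \<in> Ms" using that S_Ms by blast
      have "?g M \<noteq> 0" using False xT'(2)[OF that] x0(1) nu_singleton[OF M] by (simp add: ge_def)
      then have "nu C M = 0" using e(4) C(2) by blast
      moreover obtain c where "c \<in> C" "nu C M = val M c" using nu_attained[OF C(1) M] .
      ultimately show ?thesis using nu_le[OF fxC M, of c] by simp
    qed
    then have "\<one> \<in> ideal_over S (nu (insert x C))"
      using val_one S_Ms by (auto simp: ideal_over_def ge_def)
    then have "\<one> \<in> Idl\<^bsub>TR S\<^esub> (insert x C)" using Idl_overring[OF S_Ms fxC CT] by blast
    then have "\<one> \<in> J" using ring.genideal_minimal[OF ring_TR[OF S_Ms] J(1) CJ] by blast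
    then show ?thesis using ideal.one_imp_carrier[OF J(1)] by simp
  qed simp
qed

section \<open>Radical ideals and functions with values 0 and 1\<close>

lemma nat_pow_TR: "x [^]\<^bsub>TR S\<^esub> (n::nat) = x [^] n"
  by (induction n) (simp_all add: nat_pow_def)

lemma val_pow: "M \<in> Ms \<Longrightarrow> x \<in> carrier K \<Longrightarrow> x \<noteq> \<zero> \<Longrightarrow> x [^] (n::nat) \<noteq> \<zero> \<and> val M (x [^] n) = int n * val M x"
proof (induction n)
  case 0
  then show ?case using val_one by simp
next
  case (Suc n)
  then show ?case using val_mult[of M "x [^] n" x] integral[of "x [^] n" x] by (auto simp: algebra_simps)
qed

text \<open>A bound of 0 or 1 passes from a positive power to its base: for an integer
  \<open>v \<ge> 0\<close>, \<open>n * v \<ge> 1\<close> forces \<open>v \<ge> 1\<close>.\<close>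

lemma radical_of_unit:
  assumes P: "P \<in> S" and g: "g \<in> G" "g P = 1" "\<And>M. M \<in> S \<Longrightarrow> g M \<in> {0, 1}"
  shows "\<exists>I. fg_ideal (TR S) I \<and> radical_ideal (TR S) I \<and> I \<noteq> {\<zero>} \<and> I \<subseteq> prime_over S P"
proof -
  obtain A where A: "fin A" "g = nu A" using G_nu[OF g(1)] .
  have AT: "A \<subseteq> T S" using overring_fin[OF S_Ms A(1)] g(3) A(2) by force
  let ?I = "ideal_over S g"
  have I: "?I = Idl\<^bsub>TR S\<^esub> A" using Idl_overring[OF S_Ms A(1) AT] A(2) by simp
  have "fg_ideal (TR S) ?I" unfolding I using A(1) AT by (auto simp: fg_ideal_def fin_def)
  moreover have nn: "0 \<le> g M" if "M \<in> S" for M using g(3)[OF that] by auto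
  have idl: "ideal ?I (TR S)" by (rule ideal_ideal_over[OF S_Ms nn])
  have "radical_ideal (TR S) ?I"
    unfolding radical_ideal_def
  proof (intro conjI idl equalityI subsetI)
    fix x assume x: "x \<in> ?I"
    then have "x \<in> T S" using ideal.Icarr[OF idl] by simp
    moreover have "x [^] (1::nat) \<in> ?I" using x by (simp add: ideal_over_def)
    ultimately show "x \<in> {x \<in> carrier (TR S). \<exists>n::nat. 0 < n \<and> x [^]\<^bsub>TR S\<^esub> n \<in> ?I}"
      unfolding nat_pow_TR by (auto intro!: exI[of _ 1])
  next
    fix x assume "x \<in> {x \<in> carrier (TR S). \<exists>n::nat. 0 < n \<and> x [^]\<^bsub>TR S\<^esub> n \<in> ?I}"
    then obtain n where x: "x \<in> T S" "0 < n" "x [^] (n::nat) \<in> ?I"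
      unfolding nat_pow_TR by auto
    have "ge M (g M) x" if M: "M \<in> S" for M
    proof (cases "x = \<zero>")
      case False
      have x': "x \<in> carrier K" "ge M 0 x" using x(1) M by (auto simp: overring_iff[OF S_Ms])
      note vp = val_pow[of M x n] 
      have "ge M (g M) (x [^] n)" using x(3) M by (simp add: ideal_over_def)
      then have "g M \<le> int n * val M x" using vp False x' M S_Ms by (auto simp: ge_def)
      moreover have "0 \<le> val M x" using x'(2) False by (simp add: ge_def)
      ultimately have "g M \<le> val M x" using g(3)[OF M] by (cases "val M x = 0") auto
      then show ?thesis using x'(1) by (simp add: ge_def)
    qed simp
    then show "x \<in> ?I" using x(1) by (simp add: ideal_over_def overring_iff[OF S_Ms])
  qed
  moreover have "A \<subseteq> ?I" unfolding I using ring.genideal_self[OF ring_TR[OF S_Ms], of A] AT by simp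
  then have "?I \<noteq> {\<zero>}" using A(1) by (auto simp: fin_def)
  moreover have "?I \<subseteq> prime_over S P"
    using P g(2) ideal.Icarr[OF idl] by (auto simp: prime_over_def ideal_over_def)
  ultimately show ?thesis by blast
qed

text \<open>Suppose the function of the ideal were at least 2 at some \<open>M\<close> in
  \<open>S\<close>. A function \<open>h\<close> with the support of its positive part and value 1 at
  \<open>M\<close> has a multiple that dominates it. An element \<open>c\<close> that realizes
  \<open>h\<close> at \<open>M\<close> then has a power in the ideal without lying in the
  ideal.\<close>

lemma unit_of_radical:
  assumes P: "P \<in> S" and fg: "fg_ideal (TR S) I" and rad: "radical_ideal (TR S) I"
    and I0: "I \<noteq> {\<zero>}" and IP: "I \<subseteq> prime_over S P"
  shows "\<exists>g\<in>G. g P = 1 \<and> (\<forall>M\<in>S. g M \<in> {0, 1})"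
proof -
  interpret TR: ring "TR S" by (rule ring_TR[OF S_Ms])
  obtain A' where A': "finite A'" "A' \<subseteq> T S" "I = Idl\<^bsub>TR S\<^esub> A'"
    using fg by (auto simp: fg_ideal_def)
  define A where "A = A' - {\<zero>}"
  have A'I: "A' \<subseteq> I" using TR.genideal_self[of A'] A' by simp
  have "A \<noteq> {}"
  proof
    assume "A = {}"
    then have "A' \<subseteq> {\<zero>}" by (auto simp: A_def)
    then have "I \<subseteq> {\<zero>}" using TR.genideal_minimal[OF TR.zeroideal, of A'] A'(3) by simp
    moreover have "\<zero> \<in> I"
      using additive_subgroup.zero_closed[OF ideal.axioms(1), of I "TR S"] rad by (simp add: radical_ideal_def)
    ultimately show False using I0 by blast
  qed
  then have A: "fin A" "A \<subseteq> T S"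
    using A' subringE(1)[OF subring_overring[OF S_Ms]] by (auto simp: fin_def A_def)
  have "I = ideal_over S (nu A)"
  proof
    have "A' \<subseteq> insert \<zero> A" by (auto simp: A_def)
    also have "\<dots> \<subseteq> ideal_over S (nu A)"
      using nu_ge[OF A(1)] S_Ms A(1) by (auto simp: ideal_over_def fin_def)
    finally show "I \<subseteq> ideal_over S (nu A)"
      unfolding A'(3) using overring_fin[OF S_Ms A(1)] A(2)
      by (intro TR.genideal_minimal ideal_ideal_over[OF S_Ms]) auto
    have "Idl\<^bsub>TR S\<^esub> A \<subseteq> I" unfolding A'(3) using A'(2) by (intro Idl_mono[OF S_Ms]) (auto simp: A_def)
    then show "ideal_over S (nu A) \<subseteq> I" using Idl_overring[OF S_Ms A] by simp
  qed
  note I = this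
  let ?g = "nu A"
  have nn: "0 \<le> ?g M" if "M \<in> S" for M using overring_fin[OF S_Ms A(1)] A(2) that by blast
  have gP: "1 \<le> ?g P"
  proof -
    have PM: "P \<in> Ms" using P S_Ms by blast
    obtain a where a: "a \<in> A" "?g P = val P a" using nu_attained[OF A(1) PM] .
    then have "a \<in> prime_over S P" "a \<noteq> \<zero>" using A'I IP by (auto simp: A_def)
    then show ?thesis using a(2) by (simp add: prime_over_def ge_def)
  qed
  have le1: "?g M \<le> 1" if M: "M \<in> S" for M
  proof (rule ccontr)
    assume g2: "\<not> ?g M \<le> 1"
    have MM: "M \<in> Ms" using M S_Ms by blast
    obtain t where t: "t \<in> carrier K - {\<zero>}" "val M t = 1" using val_uniformizer[OF MM] by blast
    let ?p = "\<lambda>N. max (?g N) 0" and ?t = "\<lambda>N. max (nu {t} N) 0"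
    have pG: "?p \<in> G" by (rule L.pos_G[OF nu_G[OF A(1)]])
    have tG: "?t \<in> G" using t by (intro L.pos_G nu_G) (simp add: fin_def)
    \<comment> \<open>\<open>h\<close> has the same support as \<open>?p\<close>, but takes the value 1 at \<open>M\<close>.\<close>
    define h where "h = (\<lambda>N. min (?p N) (?t N)) + L.restrict_to (- supp ?t) ?p"
    have hG: "h \<in> G"
      unfolding h_def by (intro L.add_G L.min_G L.restrict_compl_supp_G pG tG)
    have h0: "0 \<le> h N" for N by (simp add: h_def)
    have hM: "h M = 1" using g2 t(2) nu_singleton[OF MM] by (simp add: h_def)
    have hs: "?p N = 0" if "h N = 0" for N
      using that by (auto split: if_splits simp: h_def min_def)
    obtain n where n: "n \<ge> 0" "\<forall>N\<in>supp h. ?p N \<le> n * h N"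
      using L.bounded_on_supp[OF pG hG h0] by blast
    have ple: "?p N \<le> (n + 1) * h N" for N
    proof (cases "h N = 0")
      case True
      then show ?thesis using hs[OF True] by simp
    next
      case False
      then have "?p N \<le> n * h N" using n(2) by simp
      also have "\<dots> \<le> (n + 1) * h N" using h0[of N] by (intro mult_right_mono) auto
      finally show ?thesis .
    qed
    obtain C where C: "fin C" "h = nu C" "C \<subseteq> D" "\<And>P. P \<in> Ms \<Longrightarrow> h P \<noteq> 0 \<Longrightarrow> C \<subseteq> P"
      by (rule nonneg_generators[OF hG h0]) blast
    obtain c where c: "c \<in> C" "nu C M = val M c" using nu_attained[OF C(1) MM] .
    have cK: "c \<in> carrier K" "c \<noteq> \<zero>" "c \<in> T S"
      using c(1) C D_overring[OF S_Ms] by (auto simp: fin_def)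
    \<comment> \<open>The radical condition asks for a positive exponent, while \<open>n\<close> may
      be zero.\<close>
    define k where "k = nat (n + 1)"
    have k: "int k = n + 1" "0 < k" using n(1) by (auto simp: k_def)
    have "ge N (?g N) (c [^] k)" if N: "N \<in> S" for N
    proof -
      have NM: "N \<in> Ms" using N S_Ms by blast
      have "?g N \<le> ?p N" by simp
      also have "\<dots> \<le> (n + 1) * h N" by (rule ple)
      also have "\<dots> = int k * nu C N" using k(1) C(2) by simp
      also have "\<dots> \<le> int k * val N c" using nu_le[OF C(1) NM c(1)] by (intro mult_left_mono) auto
      also have "\<dots> = val N (c [^] k)" using val_pow[OF NM cK(1,2)] by simp
      finally show ?thesis using cK(1) by (simp add: ge_def)
    qed
    then have "c [^]\<^bsub>TR S\<^esub> k \<in> I" unfolding nat_pow_TR I using cK(1) by (simp add: ideal_over_def)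
    then have "c \<in> {x \<in> carrier (TR S). \<exists>n::nat. 0 < n \<and> x [^]\<^bsub>TR S\<^esub> n \<in> I}" using cK(3) k(2) by auto
    then have "c \<in> I" using rad unfolding radical_ideal_def by blast
    then have "?g M \<le> val M c" using M cK(2) unfolding I by (auto simp: ideal_over_def ge_def)
    then show False using c(2) C(2)[symmetric] hM g2 by simp
  qed
  show ?thesis
  proof (intro bexI[of _ ?g] conjI ballI)
    show "?g P = 1" using gP le1[OF P] by simp
    show "?g M \<in> {0, 1}" if "M \<in> S" for M using nn[OF that] le1[OF that] by auto
    show "?g \<in> G" by (rule nu_G[OF A(1)])
  qed
qed

text \<open>The inverse of a uniformizer at \<open>P\<close> is missing from the overring. So the
  convention for \<open>K\<close> in \<open>Crit\<close> does not apply when \<open>S\<close> is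
  nonempty.\<close>

lemma overring_proper:
  assumes P: "P \<in> S"
  shows "T S \<noteq> carrier K"
proof
  assume eq: "T S = carrier K"
  have PM: "P \<in> Ms" using P S_Ms by blast
  obtain t where t: "t \<in> carrier K - {\<zero>}" "val P t = 1" using val_uniformizer[OF PM] by blast
  have "inv t \<in> T S" using field_inv(1) t(1) eq by simp
  then have "ge P 0 (inv t)" using P by (simp add: overring_iff[OF S_Ms])
  then show False using val_inv[OF PM, of t] t field_inv(4)[of t] by (simp add: ge_def)
qed

text \<open>For \<open>P\<close> in \<open>S\<close>, \<open>radical_of_unit\<close> and
  \<open>unit_of_radical\<close> translate radical ideals below the extension of \<open>P\<close>
  into functions. For \<open>P\<close> outside \<open>S\<close> the extension is the whole ring,
  hence not maximal; this covers empty \<open>S\<close> as well.\<close>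

lemma Crit_step_eq: "Crit_step K D S = S - L.noncrit S"
proof -
  have "P \<in> Crit_step K D S \<longleftrightarrow> P \<in> S - L.noncrit S" if P: "P \<in> Ms" for P
  proof (cases "P \<in> S")
    case True
    have "P \<in> Crit_step K D S \<longleftrightarrow> prime_over S P \<in> Crit K (T S)"
      using P Idl_prime[OF True] by (simp add: Crit_step_def)
    also have "\<dots> \<longleftrightarrow> \<not> (\<exists>I. fg_ideal (TR S) I \<and> radical_ideal (TR S) I \<and> I \<noteq> {\<zero>} \<and> I \<subseteq> prime_over S P)"
      using overring_proper[OF True] maximal_prime_over[OF True] by (simp add: Crit_def Max_ideals_def)
    also have "\<dots> \<longleftrightarrow> \<not> (\<exists>g\<in>G. g P = 1 \<and> (\<forall>M\<in>S. g M \<in> {0, 1}))"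
      using radical_of_unit[OF True] unit_of_radical[OF True] by blast
    also have "\<dots> \<longleftrightarrow> P \<in> S - L.noncrit S" using True by (simp add: L.noncrit_def)
    finally show ?thesis .
  next
    case False
    have "Idl\<^bsub>TR S\<^esub> P \<notin> Max_ideals K (T S)"
    proof
      assume "Idl\<^bsub>TR S\<^esub> P \<in> Max_ideals K (T S)"
      then have m: "maximalideal (Idl\<^bsub>TR S\<^esub> P) (TR S)" by (simp add: Max_ideals_def)
      show False
        using ideal.one_imp_carrier[OF maximalideal.axioms(1)[OF m]] Idl_outside[OF P False]
          maximalideal.I_notcarr[OF m] by simp
    qed
    then show ?thesis using False by (auto simp: Crit_step_def Crit_def split: if_splits)
  qed
  moreover have "Crit_step K D S \<subseteq> Ms" by (auto simp: Crit_step_def)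
  ultimately show ?thesis using S_Ms by blast
qed

end

end

section \<open>Invertible ideals\<close>

context almost_dedekind_domain begin

text \<open>The inclusion from right to left has the content: elements \<open>B\<close> expressing 1
  together with \<open>A\<close> belong to \<open>- g\<close>, so each \<open>b x\<close> meets the
  bounds of \<open>h\<close>.\<close>

lemma closed_ideal_mult:
  assumes "g \<in> G"
  shows "ideal_prod K (closed_ideal g) (closed_ideal h) = closed_ideal (g + h)"
proof
  show "ideal_prod K (closed_ideal g) (closed_ideal h) \<subseteq> closed_ideal (g + h)"
  proof
    fix x assume "x \<in> ideal_prod K (closed_ideal g) (closed_ideal h)"
    then show "x \<in> closed_ideal (g + h)"
    proof (induction rule: ideal_prod.induct)
      case (prod a b)
      then show ?case by (rule closed_ideal_closed(3))
    next
      case (sum a b)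
      from sum.IH show ?case by (rule closed_ideal_closed(2))
    qed
  qed
  obtain A where A: "fin A" "g = nu A" using G_nu[OF assms] .
  obtain B where B: "fin B" "B \<subseteq> dual A" "\<one> \<in> ideal_prod K A (insert \<zero> B)"
    by (rule dual_generators[OF A(1)])
  have Bg: "b \<in> closed_ideal (- g)" if "b \<in> insert \<zero> B" for b
    using that closed_ideal_self[OF B(1)] nu_dual[OF A(1) B] A(2) closed_ideal_closed(1) by auto
  show "closed_ideal (g + h) \<subseteq> ideal_prod K (closed_ideal g) (closed_ideal h)"
  proof
    fix x assume x: "x \<in> closed_ideal (g + h)"
    then have xK: "x \<in> carrier K" by (simp add: closed_ideal_def)
    show "x \<in> ideal_prod K (closed_ideal g) (closed_ideal h)"
    proof (rule one_in_prod_imp_mem[OF B(3) _ _ xK])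
      show "A \<subseteq> carrier K" "insert \<zero> B \<subseteq> carrier K" using A(1) B(1) by (auto simp: fin_def)
      fix a b assume ab: "a \<in> A" "b \<in> insert \<zero> B"
      have "b \<otimes> x \<in> closed_ideal (- g + (g + h))"
        by (rule closed_ideal_closed(3)[OF Bg[OF ab(2)] x])
      then have "b \<otimes> x \<in> closed_ideal h" by simp
      moreover have "a \<in> closed_ideal g" using ab(1) closed_ideal_self[OF A(1)] A(2) by blast
      ultimately show "a \<otimes> (b \<otimes> x) \<in> ideal_prod K (closed_ideal g) (closed_ideal h)"
        by (intro ideal_prod.prod)
    qed (rule ideal_prod.sum)
  qed
qed

lemma closed_ideal_inject:
  assumes "g \<in> G" "h \<in> G" "closed_ideal g = closed_ideal h"
  shows "g = h"
proof -
  have *: "h M \<le> g M" if "g \<in> G" "h \<in> G" "closed_ideal g \<subseteq> closed_ideal h" "M \<in> Ms" for g h M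
  proof -
    obtain A where A: "fin A" "g = nu A" using G_nu[OF \<open>g \<in> G\<close>] .
    obtain a where a: "a \<in> A" "nu A M = val M a" using nu_attained[OF A(1) \<open>M \<in> Ms\<close>] .
    have "a \<in> closed_ideal h" using a closed_ideal_self[OF A(1)] A(2) that(3) by blast
    moreover have "a \<noteq> \<zero>" using a A by (auto simp: fin_def)
    ultimately show ?thesis using a(2) A(2) \<open>M \<in> Ms\<close> by (auto simp: closed_ideal_def ge_def)
  qed
  show ?thesis
  proof
    fix M
    show "g M = h M"
    proof (cases "M \<in> Ms")
      case True
      then show ?thesis using *[of g h M] *[of h g M] assms by simp
    next
      case False
      then show ?thesis using assms(1,2) by (auto simp: G_def nu_def)
    qed
  qed
qed

lemma fractional_closed_ideal:
  assumes "g \<in> G"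
  shows "fractional_ideal K D (closed_ideal g)"
  unfolding fractional_ideal_def
proof (intro conjI ballI)
  have min: "\<ominus> x \<in> closed_ideal g" if "x \<in> closed_ideal g" for x
    using that ge_minus by (auto simp: closed_ideal_def)
  show "additive_subgroup (closed_ideal g) K"
  proof (rule additive_subgroup.intro, rule add.subgroupI)
    show "closed_ideal g \<noteq> {}" using closed_ideal_closed(1) by blast
  qed (use min closed_ideal_closed(2) in \<open>auto simp: closed_ideal_def\<close>)
  obtain A where A: "fin A" "g = nu A" using G_nu[OF assms] .
  show "closed_ideal g \<noteq> {\<zero>}" using closed_ideal_self[OF A(1)] A by (auto simp: fin_def)
  obtain B where B: "fin B" "- g = nu B" using G_nu[OF neg_in_G[OF assms]] .
  obtain b where b: "b \<in> B" using B(1) by (auto simp: fin_def)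
  then have bK: "b \<in> carrier K" "b \<noteq> \<zero>" using B(1) by (auto simp: fin_def)
  \<comment> \<open>\<open>b\<close> multiplies \<open>closed_ideal g\<close> into \<open>D\<close>
    but may lie outside \<open>D\<close>; its numerator \<open>d = s b\<close> does the same from
    inside \<open>D\<close>.\<close>
  obtain d s where ds: "d \<in> D" "s \<in> D" "s \<noteq> \<zero>" "b = d \<otimes> inv s" using fraction[OF bK(1)] by blast
  have sK: "s \<in> carrier K" "d \<in> carrier K" using ds D_carrier by auto
  have d: "d = s \<otimes> b" unfolding ds(4) using sK field_inv(1,3)[OF sK(1) ds(3)] by (simp add: m_lcomm[of s d])
  have "d \<otimes> x \<in> D" if x: "x \<in> closed_ideal g" for x
  proof -
    have "b \<in> closed_ideal (- g)" using b closed_ideal_self[OF B(1)] B(2) by auto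
    then have "b \<otimes> x \<in> closed_ideal (- g + g)" using x by (rule closed_ideal_closed(3))
    then have "b \<otimes> x \<in> D" using closed_ideal_closed(4) by simp
    then have "s \<otimes> (b \<otimes> x) \<in> D" using ds(2) DE(6) by blast
    moreover have "x \<in> carrier K" using x by (simp add: closed_ideal_def)
    ultimately show ?thesis using d sK bK by (simp add: m_assoc)
  qed
  moreover have "d \<noteq> \<zero>" using integral[of s b] d sK bK ds(3) by auto
  ultimately show "\<exists>d\<in>D - {\<zero>}. \<forall>x\<in>closed_ideal g. d \<otimes> x \<in> D" using ds(1) by blast
qed (rule closed_ideal_D)

text \<open>Finitely many elements \<open>A\<close> of \<open>I\<close> suffice to write 1 as a sum
  of products with elements of \<open>J\<close>. These cofactors lie in the dual of
  \<open>A\<close>, and both inclusions between \<open>I\<close> and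
  \<open>closed_ideal (nu A)\<close> follow from this one partition of unity.\<close>

lemma invertible_eq_closed_ideal:
  assumes I: "fractional_ideal K D I" and J: "fractional_ideal K D J" and IJ: "ideal_prod K I J = D"
  obtains g where "g \<in> G" "I = closed_ideal g"
proof -
  have IK: "I \<subseteq> carrier K" "J \<subseteq> carrier K"
    using I J additive_subgroup.a_subset unfolding fractional_ideal_def by blast+
  have addI: "x \<oplus> y \<in> I" if "x \<in> I" "y \<in> I" for x y
    using I that by (auto simp: fractional_ideal_def intro: additive_subgroup.a_closed)
  have DI: "d \<otimes> x \<in> I" if "d \<in> D" "x \<in> I" for d x
    using I that unfolding fractional_ideal_def by blast
  have "\<one> \<in> ideal_prod K I J" using IJ DE(3) by simp
  then obtain A' B where A': "finite A'" "A' \<subseteq> I" "B \<subseteq> J" "\<one> \<in> ideal_prod K A' B"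
    by (rule ideal_prod_finite) blast
  define A where "A = A' - {\<zero>}"
  have one: "\<one> \<in> ideal_prod K (insert \<zero> A) B"
    using A'(4) ideal_prod_mono[of A' "insert \<zero> A" B B K] by (auto simp: A_def)
  have "A \<noteq> {}"
  proof
    assume "A = {}"
    have "x = \<zero>" if "x \<in> ideal_prod K {\<zero>} B" for x
      using that by (induction rule: ideal_prod.induct) (use A'(3) IK in auto)
    moreover have "\<one> \<in> ideal_prod K {\<zero>} B" using one \<open>A = {}\<close> by simp
    ultimately show False using one_not_zero by blast
  qed
  then have A: "fin A" "A \<subseteq> I" using A' IK by (auto simp: fin_def A_def)
  have zeroI: "\<zero> \<in> I" using DI[OF DE(2)] A(2) \<open>A \<noteq> {}\<close> IK by fastforce
  let ?g = "nu A"
  have Bd: "B \<subseteq> dual A"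
  proof
    fix b assume b: "b \<in> B"
    have "a \<otimes> b \<in> D" if "a \<in> A" for a
      using ideal_prod.prod[of a I b J K] that A(2) b A'(3) IJ by blast
    then show "b \<in> dual A" using b A'(3) IK by (auto simp: dual_def)
  qed
  have ABK: "insert \<zero> A \<subseteq> carrier K" "B \<subseteq> carrier K" using A(1) A'(3) IK by (auto simp: fin_def)
  have "x \<in> I" if x: "x \<in> closed_ideal ?g" for x
  proof (rule one_in_prod_imp_mem[OF one ABK _ addI])
    show xK: "x \<in> carrier K" using x by (simp add: closed_ideal_def)
    fix a b assume ab: "a \<in> insert \<zero> A" "b \<in> B"
    have "ge M 0 (b \<otimes> x)" if M: "M \<in> Ms" for M
    proof -
      have "ge M (?g M) x" using x M by (simp add: closed_ideal_def)
      moreover have "ge M (- ?g M) b" using dual_ge[OF A(1) M] ab(2) Bd by blast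
      ultimately show ?thesis using ge_mult[OF M, of "- ?g M" b "?g M" x] by simp
    qed
    moreover have c: "a \<in> carrier K" "b \<in> carrier K" using ab ABK by blast+
    ultimately have "b \<otimes> x \<in> D" using xK by (simp add: D_iff)
    then have "(b \<otimes> x) \<otimes> a \<in> I" using ab(1) A(2) zeroI by (intro DI) auto
    then show "a \<otimes> (b \<otimes> x) \<in> I" using c xK by (simp add: m_ac)
  qed
  moreover have "x \<in> closed_ideal ?g" if x: "x \<in> I" for x
  proof (rule one_in_prod_imp_mem[OF one ABK _ closed_ideal_closed(2)])
    show xK: "x \<in> carrier K" using x IK by blast
    fix a b assume ab: "a \<in> insert \<zero> A" "b \<in> B"
    have a: "a \<in> closed_ideal ?g" using ab(1) closed_ideal_self[OF A(1)] closed_ideal_closed(1) by blast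
    have c: "a \<in> carrier K" "b \<in> carrier K" using ab ABK by blast+
    have "x \<otimes> b \<in> D" using ideal_prod.prod[of x I b J K] x ab(2) A'(3) IJ by blast
    then have "(x \<otimes> b) \<otimes> a \<in> closed_ideal ?g" using a by (rule closed_ideal_D)
    then show "a \<otimes> (b \<otimes> x) \<in> closed_ideal ?g" using c xK by (simp add: m_ac)
  qed
  ultimately have "I = closed_ideal ?g" by blast
  then show ?thesis using that nu_G[OF A(1)] by blast
qed

lemma Inv_iso: "closed_ideal \<in> iso (fun_group G) (Inv K D)"
proof (rule isoI)
  have inv: "closed_ideal g \<in> carrier (Inv K D)" if g: "g \<in> G" for g
  proof -
    have "ideal_prod K (closed_ideal g) (closed_ideal (- g)) = D"
      using closed_ideal_mult[OF g, of "- g"] closed_ideal_closed(4) by simp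
    then show ?thesis
      using fractional_closed_ideal[OF g] fractional_closed_ideal[OF neg_in_G[OF g]]
      by (auto simp: Inv_def)
  qed
  show "closed_ideal \<in> hom (fun_group G) (Inv K D)"
  proof (rule homI)
    fix g h assume "g \<in> carrier (fun_group G)" "h \<in> carrier (fun_group G)"
    then show "closed_ideal (g \<otimes>\<^bsub>fun_group G\<^esub> h) = closed_ideal g \<otimes>\<^bsub>Inv K D\<^esub> closed_ideal h"
      using closed_ideal_mult by (simp add: fun_group_def Inv_def)
  qed (use inv in \<open>simp add: fun_group_def\<close>)
  show "bij_betw closed_ideal (carrier (fun_group G)) (carrier (Inv K D))"
    unfolding bij_betw_def
  proof
    show "inj_on closed_ideal (carrier (fun_group G))"
      using closed_ideal_inject by (auto simp: inj_on_def fun_group_def)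
    have "I \<in> closed_ideal ` G" if I: "I \<in> carrier (Inv K D)" for I
    proof -
      obtain J where J: "fractional_ideal K D I" "fractional_ideal K D J" "ideal_prod K I J = D"
        using I by (auto simp: Inv_def)
      then obtain g where "g \<in> G" "I = closed_ideal g" by (rule invertible_eq_closed_ideal)
      then show ?thesis by blast
    qed
    then show "closed_ideal ` carrier (fun_group G) = carrier (Inv K D)"
      using inv by (auto simp: fun_group_def)
  qed
qed

end

theorem proposition5p3:
  fixes K :: "('a, 'b) ring_scheme" and D :: "'a set" and \<alpha> :: "'o::wellorder"
  assumes "almost_Dedekind K D"
    and "is_SP_rank K D \<alpha>"
  shows "Inv K D \<cong> sum_group {..<\<alpha>}
           (\<lambda>i. Cc_int (subtopology (constructible_Max K D) (Crit_chain K D i - Crit_next K D i)))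
         \<and> is_free_abelian (Inv K D)"
proof -
  interpret field K using assms(1) by (simp add: almost_Dedekind_def is_quotient_field_def)
  interpret almost_dedekind_domain K D by unfold_locales (rule assms(1))
  interpret C: critical_chain Xc G subbasis "Crit_chain K D" \<alpha>
  proof
    fix i :: 'o
    show "Crit_chain K D i = topspace Xc" if "\<forall>\<beta>. i \<le> \<beta>"
      unfolding topspace_constructible by (rule Crit_chain_zero[OF that])
    show "Crit_chain K D j = Crit_chain K D i - L.noncrit (Crit_chain K D i)"
      if "is_succ_of j i" "closedin Xc (Crit_chain K D i)" for j
      unfolding Crit_chain_succ[OF that(1)] by (rule Crit_step_eq[OF that(2)])
    show "Crit_chain K D i = (\<Inter>j\<in>{..<i}. Crit_chain K D j)"
      if "\<not> (\<forall>\<beta>. i \<le> \<beta>)" "\<not> (\<exists>j. is_succ_of i j)"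
      by (rule Crit_chain_limit[OF that])
    \<comment> \<open>Stationarity at the rank means that the step removes no point from the last
      set.\<close>
    show "L.noncrit (Crit_chain K D \<alpha>) = {}" if "closedin Xc (Crit_chain K D \<alpha>)"
    proof -
      have "Crit_chain K D \<alpha> = Crit_chain K D \<alpha> - L.noncrit (Crit_chain K D \<alpha>)"
        using assms(2) Crit_step_eq[OF that] by (simp add: is_SP_rank_def Crit_next_def)
      moreover have "L.noncrit (Crit_chain K D \<alpha>) \<subseteq> Crit_chain K D \<alpha>"
        by (auto simp: L.noncrit_def)
      ultimately show ?thesis by blast
    qed
  qed
  have next_eq: "Crit_next K D i = C.C' i" for i
    unfolding Crit_next_def by (rule Crit_step_eq[OF C.closedin_C])
  let ?S = "sum_group {..<\<alpha>} (\<lambda>i. Cc_int (C.layer i))"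
  have grpG: "group (fun_group G)" by (rule group_fun_group[OF subspace_in_G])
  have grpS: "group ?S" by (rule sum_group) (simp add: comm_group_Cc_int comm_group.axioms(2))
  have iso: "inv_into (carrier (fun_group G)) closed_ideal \<in> iso (Inv K D) (fun_group G)"
    by (rule group.iso_set_sym[OF grpG Inv_iso])
  have "fun_group G \<cong> ?S" using group.iso_sym[OF grpS C.sum_group_iso] .
  with is_isoI[OF iso] have "Inv K D \<cong> ?S" by (rule iso_trans)
  moreover obtain B where "zf.independent B" "zf.span B = G" by (rule C.G_basis)
  with iso have "is_free_abelian (Inv K D)" by (rule is_free_abelian_iso)
  ultimately show ?thesis unfolding next_eq by (rule conjI)
qed

end
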